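(* Let $\mathcal J\subset\mathcal P_a$ be a stable submodule. If $$d_{\mathcal J}-c_{\mathcal J}>2\pi D_{BM}(\mathcal Z_{\mathcal J}),$$ then $\mathcal J$ is non-trivial ($\mathcal J\ne\{0\}$) and weakly localisable.
   Context: $\omega:[0,\infty)\to[0,\infty)$ is a non-decreasing continuous function such that: $t\mapsto\omega(e^t)$ is convex on $[0,\infty)$; $\omega(x)=o(x)$ and $\ln x=o(\omega(x))$ as $x\to\infty$; for every $\sigma>1$ there is $C>0$ with $\omega(x+y)\le\sigma(\omega(x)+\omega(y))+C$ for all $x,y\ge0$; $\int_1^\infty \omega(x)x^{-2}\,dx<\infty$. Fix $0<a\le+\infty$ and sequences $0<c_k\nearrow a$ with $c_k<a$, $0<r_k\nearrow1$ with $r_k<1$. $P_k$ is the Banach space of entire functions $\varphi$ with $\|\varphi\|_k=\sup_{z\in\mathbb C}|\varphi(z)|e^{-r_k\omega(|z|)-c_k|\mathrm{Im}\,z|}<\infty$, and $\mathcal P_a$ is the locally convex inductive limit of the $P_k$. $\mathcal P_a$ is a topological module over $\mathbb C[z]$; "submodule" means closed $\mathbb C[z]$-submodule. For a submodule $\mathcal J$ and $\lambda\in\mathbb C$ let $n_\lambda$ be the minimal multiplicity of vanishing at $\lambda$ of functions in $\mathcal J$ ($n_\lambda=\infty$ for all $\lambda$ if $\mathcal J=\{0\}$). $\mathcal Z_{\mathcal J}$ is the set of points $\lambda$ with $n_\lambda\ge1$, counted with multiplicity $n_\lambda$. $\mathcal J$ is stable at $\lambda$ if $\varphi/(z-\lambda)\in\mathcal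 J$ whenever $\varphi\in\mathcal J$ vanishes at $\lambda$ with multiplicity greater than $n_\lambda$; $\mathcal J$ is stable if it is stable at every $\lambda\in\mathbb C$. For nonzero $\varphi\in\mathcal P_a$ let $h_\varphi(\theta)=\limsup_{r\to\infty}r^{-1}\ln|\varphi(re^{\mathrm i\theta})|$, $c_\varphi=-h_\varphi(-\pi/2)$, $d_\varphi=h_\varphi(\pi/2)$. The indicator segment of $\mathcal J$ is $[c_{\mathcal J};d_{\mathcal J}]\subset\overline{\mathbb R}$, $c_{\mathcal J}=\inf c_\varphi$, $d_{\mathcal J}=\sup d_\varphi$ over nonzero $\varphi\in\mathcal J$ (so $c_{\mathcal J}=+\infty$, $d_{\mathcal J}=-\infty$ for $\mathcal J=\{0\}$). A submodule $\mathcal J\ne\{0\}$ is weakly localisable if it is maximal among all submodules with the same zero set and the same indicator segment; equivalently, $\mathcal J$ contains every nonzero $\psi\in\mathcal P_a$ with $[c_\psi;d_\psi]\subset[c_{\mathcal J};d_{\mathcal J}]$ that vanishes on $\mathcal Z_{\mathcal J}$ (with multiplicities). For a collection $\Lambda=\{(\lambda_j;m_j)\}$ of points with multiplicities, the completeness radius $r(\Lambda)\in[0,+\infty]$ is the infimum of all $r>0$ such that the system $\{t^ke^{-\mathrm i\lambda_jt}:0\le k\le m_j-1\}_j$ is incomplete in $C^\infty(-r,r)$ (equivalently in $C(-r,r)$). $D_{BM}(\Lambda)$ is the Beurling-Malliavin density; by the Beurling-Malliavin theorem $r(\Lambda)=\pi D_{BM}(\Lambda)$, which may be taken as its definition here.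 *)

theory Defs
  imports "HOL-Complex_Analysis.Complex_Analysis" "HOL-Library.Landau_Symbols"
    "HOL-Library.Extended_Nat" "HOL-Library.Extended_Real"
    "HOL-Computational_Algebra.Polynomial"
begin

(* A weight is a function on [0,oo); its values at negative reals are irrelevant. *)
definition weight :: "(real \<Rightarrow> real) \<Rightarrow> bool" where
  "weight w \<longleftrightarrow>
     (\<forall>x\<ge>0. 0 \<le> w x) \<and>
     mono_on {0..} w \<and>
     continuous_on {0..} w \<and>
     convex_on {0..} (\<lambda>t. w (exp t)) \<and>
     w \<in> o[at_top](\<lambda>x. x) \<and>
     (\<lambda>x. ln x) \<in> o[at_top](w) \<and>
     (\<forall>\<sigma>>1. \<exists>C>0. \<forall>x\<ge>0. \<forall>y\<ge>0. w (x + y) \<le> \<sigma> * (w x + w y) + C) \<and>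
     set_integrable lborel {1..} (\<lambda>x. w x / x\<^sup>2)"

(* Throughout, r and c are the sequences r_k, c_k. *)

definition P_weighted ::
    "(real \<Rightarrow> real) \<Rightarrow> (nat \<Rightarrow> real) \<Rightarrow> (nat \<Rightarrow> real) \<Rightarrow> nat \<Rightarrow> (complex \<Rightarrow> complex) \<Rightarrow> complex \<Rightarrow> real" where
  "P_weighted w r c k \<phi> z = norm (\<phi> z) * exp (- r k * w (norm z) - c k * \<bar>Im z\<bar>)"

definition P_step ::
    "(real \<Rightarrow> real) \<Rightarrow> (nat \<Rightarrow> real) \<Rightarrow> (nat \<Rightarrow> real) \<Rightarrow> nat \<Rightarrow> (complex \<Rightarrow> complex) set" where
  "P_step w r c k = {\<phi>. \<phi> holomorphic_on UNIV \<and> bdd_above (range (P_weighted w r c k \<phi>))}"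

definition P_norm ::
    "(real \<Rightarrow> real) \<Rightarrow> (nat \<Rightarrow> real) \<Rightarrow> (nat \<Rightarrow> real) \<Rightarrow> nat \<Rightarrow> (complex \<Rightarrow> complex) \<Rightarrow> real" where
  "P_norm w r c k \<phi> = (SUP z. P_weighted w r c k \<phi> z)"

definition P_space ::
    "(real \<Rightarrow> real) \<Rightarrow> (nat \<Rightarrow> real) \<Rightarrow> (nat \<Rightarrow> real) \<Rightarrow> (complex \<Rightarrow> complex) set" where
  "P_space w r c = (\<Union>k. P_step w r c k)"

(* The standard 0-neighbourhood base of the locally convex inductive limit (the finest
   locally convex topology making all inclusions of the steps continuous): absolutely
   convex sets whose trace on every step is a 0-neighbourhood of that step. *)
definition P_nhd ::
    "(real \<Rightarrow> real) \<Rightarrow> (nat \<Rightarrow> real) \<Rightarrow> (nat \<Rightarrow> real) \<Rightarrow> (complex \<Rightarrow> complex) set \<Rightarrow> bool" where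
  "P_nhd w r c U \<longleftrightarrow>
     U \<subseteq> P_space w r c \<and>
     (\<forall>u\<in>U. \<forall>v\<in>U. \<forall>\<alpha> \<beta>. norm \<alpha> + norm \<beta> \<le> 1 \<longrightarrow> (\<lambda>z. \<alpha> * u z + \<beta> * v z) \<in> U) \<and>
     (\<forall>k. \<exists>\<epsilon>>0. {\<phi> \<in> P_step w r c k. P_norm w r c k \<phi> < \<epsilon>} \<subseteq> U)"

definition P_top ::
    "(real \<Rightarrow> real) \<Rightarrow> (nat \<Rightarrow> real) \<Rightarrow> (nat \<Rightarrow> real) \<Rightarrow> (complex \<Rightarrow> complex) topology" where
  "P_top w r c = topology (\<lambda>S. S \<subseteq> P_space w r c \<and>
     (\<forall>\<phi>\<in>S. \<exists>U. P_nhd w r c U \<and> (\<forall>u\<in>U. (\<lambda>z. \<phi> z + u z) \<in> S)))"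

lemma P_nhd_Int:
  assumes "P_nhd w r c U" and "P_nhd w r c V"
  shows "P_nhd w r c (U \<inter> V)"
proof -
  have "\<exists>\<epsilon>>0. {\<phi> \<in> P_step w r c k. P_norm w r c k \<phi> < \<epsilon>} \<subseteq> U \<inter> V" for k
  proof -
    obtain e1 where e1: "e1 > 0" "{\<phi> \<in> P_step w r c k. P_norm w r c k \<phi> < e1} \<subseteq> U"
      using assms(1) unfolding P_nhd_def by blast
    obtain e2 where e2: "e2 > 0" "{\<phi> \<in> P_step w r c k. P_norm w r c k \<phi> < e2} \<subseteq> V"
      using assms(2) unfolding P_nhd_def by blast
    show ?thesis
      using e1 e2 by (intro exI[of _ "min e1 e2"]) auto
  qed
  then show ?thesis
    using assms unfolding P_nhd_def by (intro conjI) blast+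
qed

lemma openin_P_top:
  "openin (P_top w r c) S \<longleftrightarrow> S \<subseteq> P_space w r c \<and>
     (\<forall>\<phi>\<in>S. \<exists>U. P_nhd w r c U \<and> (\<forall>u\<in>U. (\<lambda>z. \<phi> z + u z) \<in> S))"
proof -
  have "istopology (\<lambda>S. S \<subseteq> P_space w r c \<and>
     (\<forall>\<phi>\<in>S. \<exists>U. P_nhd w r c U \<and> (\<forall>u\<in>U. (\<lambda>z. \<phi> z + u z) \<in> S)))"
    unfolding istopology_def
  proof (intro conjI allI impI ballI)
    fix S T \<phi>
    assume S: "S \<subseteq> P_space w r c \<and>
       (\<forall>\<phi>\<in>S. \<exists>U. P_nhd w r c U \<and> (\<forall>u\<in>U. (\<lambda>z. \<phi> z + u z) \<in> S))"
      and T: "T \<subseteq> P_space w r c \<and>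
       (\<forall>\<phi>\<in>T. \<exists>U. P_nhd w r c U \<and> (\<forall>u\<in>U. (\<lambda>z. \<phi> z + u z) \<in> T))"
      and \<phi>: "\<phi> \<in> S \<inter> T"
    obtain U where U: "P_nhd w r c U" "\<forall>u\<in>U. (\<lambda>z. \<phi> z + u z) \<in> S" using S \<phi> by blast
    obtain V where V: "P_nhd w r c V" "\<forall>u\<in>V. (\<lambda>z. \<phi> z + u z) \<in> T" using T \<phi> by blast
    show "\<exists>U. P_nhd w r c U \<and> (\<forall>u\<in>U. (\<lambda>z. \<phi> z + u z) \<in> S \<inter> T)"
      using U V P_nhd_Int by (intro exI[of _ "U \<inter> V"]) auto
  next
    fix \<K> \<phi>
    assume K: "\<forall>K\<in>\<K>. K \<subseteq> P_space w r c \<and>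
       (\<forall>\<phi>\<in>K. \<exists>U. P_nhd w r c U \<and> (\<forall>u\<in>U. (\<lambda>z. \<phi> z + u z) \<in> K))"
      and "\<phi> \<in> \<Union>\<K>"
    then obtain K U where "K \<in> \<K>" "P_nhd w r c U" "\<forall>u\<in>U. (\<lambda>z. \<phi> z + u z) \<in> K" by blast
    then show "\<exists>U. P_nhd w r c U \<and> (\<forall>u\<in>U. (\<lambda>z. \<phi> z + u z) \<in> \<Union>\<K>)" by blast
  qed blast+
  then show ?thesis
    by (simp add: P_top_def topology_inverse')
qed

definition closed_submodule ::
    "(real \<Rightarrow> real) \<Rightarrow> (nat \<Rightarrow> real) \<Rightarrow> (nat \<Rightarrow> real) \<Rightarrow> (complex \<Rightarrow> complex) set \<Rightarrow> bool" where
  "closed_submodule w r c J \<longleftrightarrow>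
     closedin (P_top w r c) J \<and>
     (\<lambda>_. 0) \<in> J \<and>
     (\<forall>\<phi>\<in>J. \<forall>\<psi>\<in>J. (\<lambda>z. \<phi> z + \<psi> z) \<in> J) \<and>
     (\<forall>p. \<forall>\<phi>\<in>J. (\<lambda>z. poly p z * \<phi> z) \<in> J)"

(* The library's zorder is unspecified for the zero function. *)
definition vanishing_mult :: "(complex \<Rightarrow> complex) \<Rightarrow> complex \<Rightarrow> enat" where
  "vanishing_mult \<phi> \<mu> = (if \<phi> = (\<lambda>_. 0) then \<infinity> else enat (nat (zorder \<phi> \<mu>)))"

(* The numbers n_mu.  The zero set with multiplicities is encoded by this function:
   mu belongs to it iff its multiplicity is at least 1. *)
definition zero_set :: "(complex \<Rightarrow> complex) set \<Rightarrow> complex \<Rightarrow> enat" where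
  "zero_set J \<mu> = (INF \<phi>\<in>J. vanishing_mult \<phi> \<mu>)"

(* The entire function phi/(z - mu), for phi vanishing at mu. *)
definition divide_root :: "(complex \<Rightarrow> complex) \<Rightarrow> complex \<Rightarrow> complex \<Rightarrow> complex" where
  "divide_root \<phi> \<mu> = (\<lambda>z. if z = \<mu> then deriv \<phi> \<mu> else \<phi> z / (z - \<mu>))"

definition stable_at :: "(complex \<Rightarrow> complex) set \<Rightarrow> complex \<Rightarrow> bool" where
  "stable_at J \<mu> \<longleftrightarrow> (\<forall>\<phi>\<in>J. vanishing_mult \<phi> \<mu> > zero_set J \<mu> \<longrightarrow> divide_root \<phi> \<mu> \<in> J)"

definition stable_submodule :: "(complex \<Rightarrow> complex) set \<Rightarrow> bool" where
  "stable_submodule J \<longleftrightarrow> (\<forall>\<mu>. stable_at J \<mu>)"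

(* ln |u| with the convention ln 0 = -oo (on the reals the library has ln 0 = 0). *)
definition ln_norm :: "complex \<Rightarrow> ereal" where
  "ln_norm u = (if u = 0 then -\<infinity> else ereal (ln (norm u)))"

definition indicator_fun :: "(complex \<Rightarrow> complex) \<Rightarrow> real \<Rightarrow> ereal" where
  "indicator_fun \<phi> \<theta> = Limsup at_top (\<lambda>\<rho>::real. ln_norm (\<phi> (of_real \<rho> * cis \<theta>)) / ereal \<rho>)"

definition c_fun :: "(complex \<Rightarrow> complex) \<Rightarrow> ereal" where
  "c_fun \<phi> = - indicator_fun \<phi> (- (pi / 2))"

definition d_fun :: "(complex \<Rightarrow> complex) \<Rightarrow> ereal" where
  "d_fun \<phi> = indicator_fun \<phi> (pi / 2)"

(* End points of the indicator segment; INF/SUP over the empty set are oo/-oo. *)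
definition c_sub :: "(complex \<Rightarrow> complex) set \<Rightarrow> ereal" where
  "c_sub J = (INF \<phi>\<in>J - {\<lambda>_. 0}. c_fun \<phi>)"

definition d_sub :: "(complex \<Rightarrow> complex) set \<Rightarrow> ereal" where
  "d_sub J = (SUP \<phi>\<in>J - {\<lambda>_. 0}. d_fun \<phi>)"

(* Maximality is with respect to inclusion; having the same indicator segment means
   having the same end points. *)
definition weakly_localisable ::
    "(real \<Rightarrow> real) \<Rightarrow> (nat \<Rightarrow> real) \<Rightarrow> (nat \<Rightarrow> real) \<Rightarrow> (complex \<Rightarrow> complex) set \<Rightarrow> bool" where
  "weakly_localisable w r c J \<longleftrightarrow>
     closed_submodule w r c J \<and> J \<noteq> {\<lambda>_. 0} \<and>
     (\<forall>J'. closed_submodule w r c J' \<and> zero_set J' = zero_set J \<and>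
           c_sub J' = c_sub J \<and> d_sub J' = d_sub J \<and> J \<subseteq> J' \<longrightarrow> J' = J)"

definition iter_deriv :: "nat \<Rightarrow> (real \<Rightarrow> complex) \<Rightarrow> real \<Rightarrow> complex" where
  "iter_deriv n = (\<lambda>g t. vector_derivative g (at t)) ^^ n"

definition smooth_on_sym :: "real \<Rightarrow> (real \<Rightarrow> complex) \<Rightarrow> bool" where
  "smooth_on_sym \<rho> f \<longleftrightarrow> (\<forall>n. \<forall>t\<in>{-\<rho><..<\<rho>}. iter_deriv n f differentiable at t)"

(* The linear span of t^k exp(-i mu t), 0 <= k < m(mu), where the family of points
   with multiplicities is given by its multiplicity function m. *)
definition exp_span :: "(complex \<Rightarrow> enat) \<Rightarrow> (real \<Rightarrow> complex) set" where
  "exp_span m = {(\<lambda>t. \<Sum>(\<mu>, k)\<in>F. b \<mu> k * (of_real t ^ k * exp (- \<i> * \<mu> * of_real t))) |F b.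
     finite F \<and> F \<subseteq> {(\<mu>, k). enat k < m \<mu>}}"

(* Density of the span in C^oo(-rho,rho) with its Frechet topology of uniform convergence
   of all derivatives on compact subsets. *)
definition exp_complete :: "(complex \<Rightarrow> enat) \<Rightarrow> real \<Rightarrow> bool" where
  "exp_complete m \<rho> \<longleftrightarrow>
     (\<forall>f. smooth_on_sym \<rho> f \<longrightarrow>
       (\<forall>K N. \<forall>\<epsilon>>0. compact K \<and> K \<subseteq> {-\<rho><..<\<rho>} \<longrightarrow>
         (\<exists>g\<in>exp_span m. \<forall>n\<le>N. \<forall>t\<in>K. norm (iter_deriv n f t - iter_deriv n g t) < \<epsilon>)))"

definition completeness_radius :: "(complex \<Rightarrow> enat) \<Rightarrow> ereal" where
  "completeness_radius m = (INF \<rho>\<in>{\<rho>. \<rho> > 0 \<and> \<not> exp_complete m \<rho>}. ereal \<rho>)"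

(* The Beurling-Malliavin density, defined through r(Lambda) = pi D_BM(Lambda). *)
definition BM_density :: "(complex \<Rightarrow> enat) \<Rightarrow> ereal" where
  "BM_density m = completeness_radius m / ereal pi"

end

theory Submission
  imports Defs "HOL-Real_Asymp.Real_Asymp"
begin

text \<open>A continuous functional \<open>S\<close> that annihilates \<open>J\<close> but not a given \<open>g\<close> would exist by Hahn-Banach if
  \<open>g \<notin> J\<close>. For \<open>f \<in> J\<close> and \<open>g\<close> vanishing on the zero set, stability of \<open>J\<close> makes
  \<open>G \<mu> = S (\<lambda>z. (f \<mu> * g z - g \<mu> * f z) / (z - \<mu>)) / f \<mu>\<close> an entire function independent of \<open>f\<close>.
  If \<open>G\<close> is bounded for \<open>g\<close> and for \<open>z\<^sup>2 g\<close>, Liouville's theorem gives \<open>S g = 0\<close>.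

  Convergence of the integral of \<open>w x / x\<^sup>2\<close> yields a harmonic majorant of \<open>w (norm z)\<close> of growth
  \<open>o (norm z)\<close> on the upper half plane, and a quotient of functions with comparable types on the imaginary
  axis is at most \<open>exp (e * (norm z)\<^sup>2 / \<bar>Im z\<bar>)\<close>. So boundedness of \<open>G\<close> only has to be shown in
  the double sector \<open>\<bar>Re z\<bar> \<le> 4 * \<bar>Im z\<bar>\<close>; the rest follows from the maximum principle on kites.
  When the indicator segment of \<open>g\<close> is interior to that of \<open>J\<close>, multiplying \<open>g\<close> by
  \<open>exp (\<i> * t * z)\<close> with small \<open>t\<close> of either sign bounds \<open>G\<close> there, so \<open>g \<in> J\<close>. In general take
  \<open>p \<noteq> 0\<close> with interior segment: \<open>p * G ^ n\<close> is again of this kind, hence in \<open>J\<close>, and its norm grows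
  at most geometrically in \<open>n\<close>, which bounds \<open>G\<close>.

  Such a \<open>p\<close> comes from the density condition: if the exponential system is incomplete on an interval, a
  functional annihilating it has a Fourier-Laplace transform that vanishes on the zero set, has polynomial
  growth on the real line, and after a shift has its indicator segment inside that of \<open>J\<close>.\<close>

section \<open>Quotients of bounded holomorphic functions\<close>

text \<open>The bound \<open>exp (e * (norm z)\<^sup>2 / \<bar>Im z\<bar>)\<close> is useless near
  the real axis, but in the double sector it is at most
  \<open>exp (17 * e * \<bar>Im z\<bar>)\<close>. Up to a bounded error, shifting \<open>g\<close>
  by \<open>exp (\<i> * t * z)\<close> writes \<open>G\<close> as
  \<open>exp (- \<i> * t * \<mu>)\<close> times the resolvent of the shifted function, and this
  factor absorbs the growth in one half plane once \<open>e\<close> is small against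
  \<open>t\<close>. The shift stays in the space because no \<open>c k\<close> attains the limit
  \<open>a\<close>. A \<open>g\<close> whose segment touches an end of that of \<open>J\<close>
  admits no shift, which forces the detour through \<open>p\<close>. For such \<open>g\<close> the
  quotient bound still holds with every \<open>e > 0\<close>, so \<open>G\<close> has type zero
  along the imaginary axis, and multiplying \<open>p\<close> by powers of \<open>G\<close> keeps its
  segment interior. Liouville's theorem makes the resolvent of \<open>g\<close> constant but does
  not yet give \<open>S g = 0\<close>. The resolvent of \<open>z\<^sup>2 g\<close> is then a
  quadratic polynomial in \<open>\<mu>\<close> with linear coefficient \<open>S g\<close>, and its
  boundedness kills that coefficient.\<close>

lemma holomorphic_zero_factor:
  fixes f :: "complex \<Rightarrow> complex"
  assumes "f holomorphic_on S" "open S" "f w = 0"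
  obtains q where "q holomorphic_on S" "\<And>z. f z = (z - w) * q z"
proof -
  define q where "q = (\<lambda>z. if z = w then deriv f w else (f z - f w) / (z - w))"
  have "q holomorphic_on S"
    unfolding q_def by (rule pole_lemma_open[OF assms(1,2)])
  moreover have "f z = (z - w) * q z" for z
    using assms by (auto simp: q_def)
  ultimately show ?thesis using that by blast
qed

text \<open>The Moebius map that sends \<open>0\<close> to \<open>w\<close> reduces the claim to
  Schwarz's lemma; the resulting quotient is cleared of its denominator.\<close>

lemma Schwarz_Pick_zero:
  fixes f :: "complex \<Rightarrow> complex"
  assumes holf: "f holomorphic_on ball 0 1" and le: "\<And>z. norm z < 1 \<Longrightarrow> norm (f z) \<le> 1"
    and w: "norm w < 1" "f w = 0" and z: "norm z < 1"
  shows "norm (f z) * norm (1 - cnj w * z) \<le> norm (z - w)"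
proof -
  have w': "norm (-w) < 1" using w by simp
  define m where "m = Moebius_function 0 (-w)"
  define \<xi> where "\<xi> = Moebius_function 0 w z"
  have holm: "m holomorphic_on ball 0 1"
    unfolding m_def by (rule Moebius_function_holomorphic[OF w'])
  have m1: "norm (m u) < 1" if "norm u < 1" for u
    unfolding m_def using Moebius_function_norm_lt_1[OF w' that] .
  have \<xi>1: "norm \<xi> < 1"
    unfolding \<xi>_def using Moebius_function_norm_lt_1[OF w(1) z] .
  have m\<xi>: "m \<xi> = z"
    unfolding m_def \<xi>_def using Moebius_function_compose[of "-w" w z] w w' z by simp
  have m0: "m 0 = w"
    by (simp add: m_def Moebius_function_simple)
  have nz: "1 - cnj w * z \<noteq> 0"
  proof
    assume "1 - cnj w * z = 0"
    then have "norm (cnj w * z) = 1" by (metis eq_iff_diff_eq_0 norm_one)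
    moreover have "norm (cnj w * z) < 1" using w z norm_mult_less[of "cnj w" 1 z 1] by simp
    ultimately show False by simp
  qed
  \<comment> \<open>Schwarz's lemma is applied to a function with values strictly inside the disc,
    hence the factor \<open>s < 1\<close>, which is removed afterwards by density.\<close>
  have *: "s * norm (f z) \<le> norm \<xi>" if s: "0 < s" "s < 1" for s :: real
  proof -
    define h where "h = (\<lambda>u. of_real s * f (m u))"
    have "(f \<circ> m) holomorphic_on ball 0 1"
      by (rule holomorphic_on_compose_gen[OF holm holf]) (auto simp: m1)
    then have holh: "h holomorphic_on ball 0 1"
      unfolding h_def o_def by (intro holomorphic_intros)
    have h0: "h 0 = 0" by (simp add: h_def m0 w)
    have h1: "norm (h u) < 1" if "norm u < 1" for u
    proof -
      have "norm (h u) = s * norm (f (m u))" using s by (simp add: h_def norm_mult)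
      also have "\<dots> \<le> s * 1" using s le[OF m1[OF that]] by (intro mult_left_mono) auto
      finally show ?thesis using s by simp
    qed
    have "norm (h \<xi>) \<le> norm \<xi>" by (rule Schwarz_Lemma(1)[OF holh h0 h1 \<xi>1])
    then show ?thesis using s by (simp add: h_def m\<xi> norm_mult)
  qed
  have "norm (f z) \<le> norm \<xi>"
  proof (rule ccontr)
    assume "\<not> norm (f z) \<le> norm \<xi>"
    then have gt: "norm \<xi> < norm (f z)" by simp
    obtain s where s3: "norm \<xi> / norm (f z) < s" and s2: "s < 1"
      using dense[of "norm \<xi> / norm (f z)" 1] gt by (metis divide_less_eq_1_pos norm_ge_zero order_le_less_trans)
    have "0 \<le> norm \<xi> / norm (f z)" by simp
    with s3 have s1: "0 < s" by linarith
    have "norm \<xi> < s * norm (f z)" using s3 gt by (simp add: divide_simps split: if_splits)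
    then show False using *[OF s1 s2] by simp
  qed
  also have "norm \<xi> = norm (z - w) / norm (1 - cnj w * z)"
    by (simp add: \<xi>_def Moebius_function_simple norm_divide)
  finally show ?thesis using nz by (simp add: field_simps)
qed

text \<open>Dividing by the Blaschke factor of a zero keeps the bound \<open>1\<close>: off
  \<open>w\<close> by \<open>Schwarz_Pick_zero\<close>, at \<open>w\<close> by continuity.\<close>

lemma Blaschke_divide:
  fixes f :: "complex \<Rightarrow> complex"
  assumes holf: "f holomorphic_on ball 0 1" and le: "\<And>z. norm z < 1 \<Longrightarrow> norm (f z) \<le> 1"
    and w: "norm w < 1" "f w = 0"
  obtains q where "q holomorphic_on ball 0 1" "\<And>z. norm z < 1 \<Longrightarrow> norm (q z) \<le> 1"
    "\<And>z. norm z < 1 \<Longrightarrow> f z * (1 - cnj w * z) = (z - w) * q z"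
proof -
  obtain p where p: "p holomorphic_on ball 0 1" "\<And>z. f z = (z - w) * p z"
    using holomorphic_zero_factor[OF holf _ w(2)] by auto
  define q where "q = (\<lambda>z. p z * (1 - cnj w * z))"
  have holq: "q holomorphic_on ball 0 1"
    unfolding q_def by (intro holomorphic_intros p)
  have le1: "norm (q z) \<le> 1" if "norm z < 1" "z \<noteq> w" for z
  proof -
    have "norm (z - w) * norm (q z) \<le> norm (z - w)"
      using Schwarz_Pick_zero[OF holf le w that(1)] p(2)[of z]
      by (simp add: q_def norm_mult mult_ac)
    then show ?thesis using that by simp
  qed
  have "isCont q w"
    using holomorphic_on_imp_continuous_on[OF holq] w by (simp add: continuous_on_eq_continuous_at)
  then have lim: "(\<lambda>z. norm (q z)) \<midarrow>w\<rightarrow> norm (q w)"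
    by (intro tendsto_norm) (simp add: isCont_def)
  have "\<forall>\<^sub>F z in at w. norm z < 1"
  proof -
    have "\<forall>\<^sub>F z in nhds w. z \<in> ball 0 1" using w by (intro eventually_nhds_in_open) auto
    then show ?thesis by (simp add: eventually_at_filter eventually_mono)
  qed
  then have "\<forall>\<^sub>F z in at w. norm (q z) \<le> 1"
    using eventually_at_filter[of "\<lambda>z. norm z < 1" w UNIV]
    by (auto simp: eventually_at_filter le1 elim!: eventually_mono)
  then have "norm (q w) \<le> 1" by (rule tendsto_upperbound[OF lim]) simp
  then show ?thesis
    using that[OF holq] le1 p(2) by (auto simp: q_def) 
qed

text \<open>Harnack's inequality for the positive harmonic function -ln |f|.\<close>

lemma Harnack_zero_free:
  fixes f :: "complex \<Rightarrow> complex"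
  assumes holf: "f holomorphic_on ball 0 t" and le: "\<And>z. norm z < t \<Longrightarrow> norm (f z) \<le> 1"
    and nz: "\<And>z. norm z < t \<Longrightarrow> f z \<noteq> 0" and \<xi>: "norm \<xi> < t"
  shows "norm (f 0) powr ((t + norm \<xi>) / (t - norm \<xi>)) \<le> norm (f \<xi>)"
proof -
  have t: "t > 0" using \<xi> norm_ge_zero[of \<xi>] by linarith
  obtain p where p: "p holomorphic_on ball 0 t" "\<And>z. norm z < t \<Longrightarrow> exp (p z) = f z"
    using holomorphic_logarithm_exists[OF convex_ball open_ball holf, of 0] nz t
    by (metis centre_in_ball dist_0_norm mem_ball)
  define s where "s = norm \<xi> / t"
  have s: "0 \<le> s" "s < 1" using \<xi> t by (auto simp: s_def)
  have Rep: "Re (p z) \<le> 0" if "norm z < t" for z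
    using le[OF that] p(2)[OF that, symmetric] by simp
  have main: "Re (p 0) * ((1 + s) / (1 - s)) - e * ((1 + s) / (1 - s)) \<le> Re (p \<xi>)" if e: "e > 0" for e
  proof -
    \<comment> \<open>Subtracting \<open>e\<close> makes the real part strictly negative, so
      \<open>P\<close> maps the disc into the open left half plane with the real value
      \<open>a\<close> at \<open>0\<close>; the Cayley transform \<open>q\<close> centred at
      \<open>a\<close> then falls under Schwarz's lemma.\<close>
    define P where "P = (\<lambda>z. p (of_real t * z) - of_real e - \<i> * of_real (Im (p 0)))"
    define a where "a = Re (p 0) - e"
    have tz: "norm (of_real t * z) < t" if "norm z < 1" for z :: complex
      using that t by (simp add: norm_mult)
    have P0: "P 0 = of_real a" by (simp add: P_def a_def complex_eq_iff)
    have a0: "a < 0" using Rep[of 0] e t by (simp add: a_def)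
    have ReP: "Re (P z) < 0" if "norm z < 1" for z
      using Rep[OF tz[OF that]] e by (simp add: P_def)
    have "(p \<circ> (\<lambda>z. of_real t * z)) holomorphic_on ball 0 1"
      by (rule holomorphic_on_compose_gen[OF _ p(1)]) (auto intro!: holomorphic_intros simp: tz)
    then have holP: "P holomorphic_on ball 0 1"
      unfolding P_def o_def by (intro holomorphic_intros)
    have nzq: "P z + of_real a \<noteq> 0" if "norm z < 1" for z
    proof
      assume "P z + of_real a = 0"
      then have "Re (P z) + a = 0" by (metis plus_complex.simps(1) Re_complex_of_real zero_complex.simps(1))
      then show False using ReP[OF that] a0 by simp
    qed
    define q where "q = (\<lambda>z. (P z - of_real a) / (P z + of_real a))"
    have holq: "q holomorphic_on ball 0 1"
      unfolding q_def by (intro holomorphic_intros holP) (use nzq in auto)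
    have q0: "q 0 = 0" by (simp add: q_def P0)
    have q1: "norm (q z) < 1" if "norm z < 1" for z
    proof -
      have "(norm (P z - of_real a))\<^sup>2 < (norm (P z + of_real a))\<^sup>2"
        using mult_neg_neg[OF ReP[OF that] a0]
        by (simp add: cmod_power2) (simp add: algebra_simps power2_eq_square)
      then have "norm (P z - of_real a) < norm (P z + of_real a)"
        by (rule power_less_imp_less_base) simp
      then show ?thesis using nzq[OF that] by (simp add: q_def norm_divide)
    qed
    define \<zeta> where "\<zeta> = \<xi> / of_real t"
    have \<zeta>: "norm \<zeta> = s" "norm \<zeta> < 1" using t s by (auto simp: \<zeta>_def s_def norm_divide)
    have qs: "norm (q \<zeta>) \<le> s" using Schwarz_Lemma(1)[OF holq q0 q1 \<zeta>(2)] \<zeta> by simp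
    define Q where "Q = q \<zeta>"
    have Q1: "1 - Q \<noteq> 0" using qs s by (auto simp: Q_def)
    have "Q * (P \<zeta> + of_real a) = P \<zeta> - of_real a"
      using nzq[OF \<zeta>(2)] by (simp add: Q_def q_def)
    then have "P \<zeta> * (1 - Q) = of_real a * (1 + Q)" by (simp add: algebra_simps)
    then have PQ: "P \<zeta> = of_real a * ((1 + Q) / (1 - Q))" using Q1 by (simp add: field_simps)
    have "Re ((1 + Q) / (1 - Q)) \<le> norm ((1 + Q) / (1 - Q))" by (rule complex_Re_le_cmod)
    also have "\<dots> = norm (1 + Q) / norm (1 - Q)" by (rule norm_divide)
    also have "\<dots> \<le> (1 + s) / (1 - s)"
    proof (rule frac_le)
      show "norm (1 + Q) \<le> 1 + s" using norm_triangle_ineq[of 1 Q] qs by (simp add: Q_def)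
      show "1 - s \<le> norm (1 - Q)" using norm_triangle_ineq2[of 1 Q] qs by (simp add: Q_def)
    qed (use s in auto)
    finally have "a * ((1 + s) / (1 - s)) \<le> a * Re ((1 + Q) / (1 - Q))"
      using a0 by (intro mult_left_mono_neg) auto
    also have "\<dots> = Re (P \<zeta>)" by (simp add: PQ del: times_divide_eq_right)
    also have "Re (P \<zeta>) = Re (p \<xi>) - e" using t by (simp add: P_def \<zeta>_def)
    finally show ?thesis using e unfolding a_def left_diff_distrib by linarith
  qed
  have "Re (p 0) * ((1 + s) / (1 - s)) \<le> Re (p \<xi>)"
  proof (rule field_le_epsilon)
    fix e :: real assume e: "e > 0"
    have k: "(1 + s) / (1 - s) > 0" using s by simp
    define K where "K = (1 + s) / (1 - s)"
    have kK: "K > 0" using k by (simp only: K_def)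
    have "e / K > 0" using e kK by simp
    from main[OF this] have "Re (p 0) * K - (e / K) * K \<le> Re (p \<xi>)" by (simp only: K_def)
    moreover have "(e / K) * K = e" using kK by simp
    ultimately show "Re (p 0) * ((1 + s) / (1 - s)) \<le> Re (p \<xi>) + e" unfolding K_def by linarith
  qed
  moreover have "(t + norm \<xi>) / (t - norm \<xi>) = (1 + s) / (1 - s)"
    using t \<xi> by (simp add: s_def field_simps)
  moreover have "norm (f 0) = exp (Re (p 0))" "norm (f \<xi>) = exp (Re (p \<xi>))"
    using p(2)[of 0, symmetric] p(2)[OF \<xi>, symmetric] t by simp_all
  ultimately show ?thesis by (simp add: powr_def mult.commute)
qed

text \<open>Dividing out a Blaschke factor of a zero in the disc of radius \<open>t\<close> multiplies \<open>norm (g 0)\<close> by at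
  least \<open>1 / t\<close>, so at most \<open>n\<close> zeros have to be removed before Harnack's inequality applies.\<close>

lemma bounded_quotient_aux:
  fixes f g h :: "complex \<Rightarrow> complex"
  assumes t: "0 < t" "t < 1" and \<xi>: "norm \<xi> < t"
    and "f holomorphic_on ball 0 1" "g holomorphic_on ball 0 1" "h holomorphic_on ball 0 1"
    and "\<And>z. norm z < 1 \<Longrightarrow> norm (f z) \<le> 1" "\<And>z. norm z < 1 \<Longrightarrow> norm (g z) \<le> 1"
    and "\<And>z. norm z < 1 \<Longrightarrow> f z = g z * h z" "t ^ n \<le> norm (g 0)"
  shows "norm (h \<xi>) * norm (g 0) powr ((t + norm \<xi>) / (t - norm \<xi>)) \<le> 1"
  using assms(4-)
proof (induction n arbitrary: f g rule: nat_less_induct)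
  case (1 n)
  have e0: "(t + norm \<xi>) / (t - norm \<xi>) \<ge> 0" using t \<xi> by simp
  show ?case
  proof (cases "\<exists>w. norm w < t \<and> g w = 0")
    case False
    have "norm (g 0) powr ((t + norm \<xi>) / (t - norm \<xi>)) \<le> norm (g \<xi>)"
      using False t 1 by (intro Harnack_zero_free \<xi>)
         (auto intro: holomorphic_on_subset[of g "ball 0 1"])
    then have "norm (h \<xi>) * norm (g 0) powr ((t + norm \<xi>) / (t - norm \<xi>)) \<le> norm (h \<xi>) * norm (g \<xi>)"
      by (rule mult_left_mono) simp
    also have "\<dots> = norm (f \<xi>)" using 1(7)[of \<xi>] t \<xi> by (simp add: norm_mult mult.commute)
    also have "\<dots> \<le> 1" using 1(5)[of \<xi>] t \<xi> by simp
    finally show ?thesis .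
  next
    case True
    then obtain w where w: "norm w < t" "g w = 0" by blast
    have w1: "norm w < 1" using w t by simp
    have fw: "f w = 0" using 1(7)[OF w1] w by simp
    obtain f' where f': "f' holomorphic_on ball 0 1" "\<And>z. norm z < 1 \<Longrightarrow> norm (f' z) \<le> 1"
      "\<And>z. norm z < 1 \<Longrightarrow> f z * (1 - cnj w * z) = (z - w) * f' z"
      using Blaschke_divide[OF 1(2) 1(5) w1 fw] by blast
    obtain g' where g': "g' holomorphic_on ball 0 1" "\<And>z. norm z < 1 \<Longrightarrow> norm (g' z) \<le> 1"
      "\<And>z. norm z < 1 \<Longrightarrow> g z * (1 - cnj w * z) = (z - w) * g' z"
      using Blaschke_divide[OF 1(3) 1(6) w1 w(2)] by blast
    have eq1: "f' z = g' z * h z" if "norm z < 1" "z \<noteq> w" for z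
    proof -
      have "(z - w) * f' z = (z - w) * (g' z * h z)"
        using f'(3)[OF that(1)] g'(3)[OF that(1)] 1(7)[OF that(1)] by (metis mult.assoc mult.commute)
      then show ?thesis using that by simp
    qed
    have eq: "f' z = g' z * h z" if "norm z < 1" for z
    proof (cases "z = w")
      case True
      have c: "isCont (\<lambda>z. f' z - g' z * h z) w"
        using f'(1)[THEN holomorphic_on_imp_continuous_on] g'(1)[THEN holomorphic_on_imp_continuous_on]
          1(4)[THEN holomorphic_on_imp_continuous_on] w1
        by (intro continuous_intros) (simp_all add: continuous_on_eq_continuous_at)
      have ev: "\<forall>\<^sub>F z in at w. f' z - g' z * h z = 0"
      proof -
        have "\<forall>\<^sub>F z in nhds w. z \<in> ball 0 1" using w1 by (intro eventually_nhds_in_open) auto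
        then show ?thesis using eq1 by (auto simp: eventually_at_filter elim!: eventually_mono)
      qed
      have "((\<lambda>z. f' z - g' z * h z) \<longlongrightarrow> 0) (at w)"
        by (rule tendsto_eventually[OF ev])
      then have "f' w - g' w * h w = 0"
        using c LIM_unique unfolding isCont_def by blast
      then show ?thesis using True by simp
    qed (use eq1 that in auto)
    have g0: "norm (g 0) = norm w * norm (g' 0)" using g'(3)[of 0] by (simp add: norm_mult)
    have gle: "norm (g 0) \<le> t * norm (g' 0)" using g0 w by (simp add: mult_right_mono)
    have "norm (g 0) > 0" using 1(8) t by (meson less_le_trans zero_less_power)
    then have "norm (g' 0) > 0" using g0 by (metis less_eq_real_def norm_ge_zero mult_zero_right order.irrefl)
    have "n \<noteq> 0"
    proof
      assume "n = 0"
      then have "1 \<le> t * norm (g' 0)" using 1(8) gle by simp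
      also have "\<dots> \<le> t * 1" using g'(2)[of 0] t by (intro mult_left_mono) auto
      finally show False using t by simp
    qed
    then obtain k where k: "n = Suc k" by (cases n) auto
    have "t * t ^ k \<le> t * norm (g' 0)" using 1(8) gle k by simp
    then have "t ^ k \<le> norm (g' 0)" using t by simp
    then have IH: "norm (h \<xi>) * norm (g' 0) powr ((t + norm \<xi>) / (t - norm \<xi>)) \<le> 1"
      using 1(1)[rule_format, of k f' g'] f' g' 1(4) eq k by auto
    have "norm (g 0) \<le> norm (g' 0)" using gle t \<open>norm (g' 0) > 0\<close>
      by (smt (verit) mult_le_cancel_right1)
    then have "norm (g 0) powr ((t + norm \<xi>) / (t - norm \<xi>)) \<le> norm (g' 0) powr ((t + norm \<xi>) / (t - norm \<xi>))"
      using e0 by (intro powr_mono2) auto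
    then have "norm (h \<xi>) * norm (g 0) powr ((t + norm \<xi>) / (t - norm \<xi>)) 
       \<le> norm (h \<xi>) * norm (g' 0) powr ((t + norm \<xi>) / (t - norm \<xi>))"
      by (rule mult_left_mono) simp
    then show ?thesis using IH by linarith
  qed
qed

text \<open>For each \<open>t < 1\<close> some power \<open>t ^ n\<close> lies below
  \<open>norm (g 0)\<close>, so the number of zeros of \<open>g\<close> never has to be known; the
  smaller disc disappears as \<open>t\<close> tends to \<open>1\<close>.\<close>

lemma bounded_quotient_disc:
  fixes f g h :: "complex \<Rightarrow> complex"
  assumes hol: "f holomorphic_on ball 0 1" "g holomorphic_on ball 0 1" "h holomorphic_on ball 0 1"
    and le: "\<And>z. norm z < 1 \<Longrightarrow> norm (f z) \<le> 1" "\<And>z. norm z < 1 \<Longrightarrow> norm (g z) \<le> 1"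
    and eq: "\<And>z. norm z < 1 \<Longrightarrow> f z = g z * h z" and g0: "g 0 \<noteq> 0" and \<xi>: "norm \<xi> < 1"
  shows "norm (h \<xi>) * norm (g 0) powr ((1 + norm \<xi>) / (1 - norm \<xi>)) \<le> 1"
proof -
  have ev: "\<forall>\<^sub>F t in at_left (1::real). norm (h \<xi>) * norm (g 0) powr ((t + norm \<xi>) / (t - norm \<xi>)) \<le> 1"
    using eventually_at_left_real[OF \<xi>]
  proof eventually_elim
    case (elim t)
    then have t: "0 < t" "t < 1" "norm \<xi> < t" using norm_ge_zero[of \<xi>] by (auto simp del: norm_ge_zero)
    obtain n where "t ^ n < norm (g 0)" using real_arch_pow_inv[of "norm (g 0)" t] g0 t by auto
    then show ?case using bounded_quotient_aux[OF t hol le eq] by (meson less_imp_le)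
  qed
  have lim: "((\<lambda>t. norm (h \<xi>) * norm (g 0) powr ((t + norm \<xi>) / (t - norm \<xi>))) \<longlongrightarrow>
      norm (h \<xi>) * norm (g 0) powr ((1 + norm \<xi>) / (1 - norm \<xi>))) (at_left 1)"
    using \<xi> g0 by (intro tendsto_intros) auto
  show ?thesis by (rule tendsto_upperbound[OF lim ev]) simp
qed

section \<open>Phragmen-Lindelof principles\<close>

declare csqrt.simps [simp del]

lemma norm_csqrt_eq: "norm (csqrt z) = sqrt (norm z)"
proof -
  have "(norm (csqrt z))\<^sup>2 = norm z" by (simp flip: norm_power)
  then show ?thesis by (intro real_sqrt_unique[symmetric]) auto
qed

text \<open>The function is the branch of z to the power 3/2. In the closed right angle its argument
  is at most 3 pi / 8 in modulus, so its real part is comparable with its modulus;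
  \<open>1/8\<close> is a crude substitute for the cosine of that angle.\<close>

lemma Re_mult_csqrt_ge:
  assumes "\<bar>Im z\<bar> \<le> Re z"
  shows "norm z * sqrt (norm z) / 8 \<le> Re (z * csqrt z)"
proof -
  define a b where "a = Re (csqrt z)" and "b = Im (csqrt z)"
  have w: "csqrt z = Complex a b" by (simp add: a_def b_def)
  have z: "z = (Complex a b)\<^sup>2" using power2_csqrt[of z] by (simp add: w)
  have a0: "a \<ge> 0" using csqrt_principal[of z] by (auto simp: a_def)
  have R: "Re z = a\<^sup>2 - b\<^sup>2" "Im z = 2 * a * b"
    by (simp_all add: z power2_eq_square)
  have h: "2 * a * \<bar>b\<bar> \<le> a\<^sup>2 - b\<^sup>2" using assms a0 by (simp add: R abs_mult)
  \<comment> \<open>The square root lies in the sector of half-angle pi / 8, whose slope is the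
    square root of 2 minus 1; the slope \<open>1/2\<close> is good enough.\<close>
  have b2: "2 * \<bar>b\<bar> \<le> a"
  proof (rule ccontr)
    assume "\<not> 2 * \<bar>b\<bar> \<le> a"
    then have *: "a < 2 * \<bar>b\<bar>" by simp
    have "a * a \<le> a * (2 * \<bar>b\<bar>)" using * a0 by (intro mult_left_mono) auto
    then have "b\<^sup>2 \<le> 0" using h by (simp add: power2_eq_square)
    then show False using * a0 by simp
  qed
  have b4: "b\<^sup>2 \<le> a\<^sup>2 / 4"
    using power_mono[OF b2, of 2] by (simp add: power_mult_distrib)
  note nw = norm_csqrt_eq[of z]
  have "(norm (csqrt z))\<^sup>2 = a\<^sup>2 + b\<^sup>2" by (simp only: a_def b_def cmod_power2)
  also have "\<dots> \<le> 25/16 * a\<^sup>2" using b4 zero_le_power2[of a] by linarith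
  also have "\<dots> = ((5/4) * a)\<^sup>2" by (simp only: power_mult_distrib) (simp add: power2_eq_square)
  finally have "(norm (csqrt z))\<^sup>2 \<le> ((5/4) * a)\<^sup>2" .
  then have n1: "norm (csqrt z) \<le> (5/4) * a" by (rule power2_le_imp_le) (use a0 in simp)
  have "norm z * sqrt (norm z) = (norm (csqrt z))^3"
    using nw by (simp add: power3_eq_cube)
  also have "\<dots> \<le> ((5/4) * a)^3" using n1 by (intro power_mono) auto
  also have "\<dots> \<le> 2 * a^3" using a0 by (simp add: power_mult_distrib power3_eq_cube)
  finally have 1: "norm z * sqrt (norm z) / 8 \<le> a^3/4" by simp
  have "Re (z * csqrt z) = a^3 - 3 * a * b\<^sup>2"
    by (simp add: R w power2_eq_square power3_eq_cube algebra_simps)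
  moreover have "a * b\<^sup>2 \<le> a * (a\<^sup>2/4)" using a0 b4 by (intro mult_left_mono) auto
  ultimately show ?thesis using 1 by (simp add: power3_eq_cube power2_eq_square)
qed

text \<open>The vertex \<open>0\<close> is the only point of the closed sector on the branch cut,
  and there the factor \<open>z\<close> forces continuity.\<close>

lemma continuous_on_mult_csqrt: "continuous_on {z. \<bar>Im z\<bar> \<le> Re z} (\<lambda>z. z * csqrt z)"
proof -
  have "continuous (at z within {z. \<bar>Im z\<bar> \<le> Re z}) (\<lambda>z. z * csqrt z)" if z: "\<bar>Im z\<bar> \<le> Re z" for z
  proof (cases "z = 0")
    case True
    have "((\<lambda>z. z * csqrt z) \<longlongrightarrow> 0) (at 0)"
    proof (rule Lim_null_comparison)
      show "\<forall>\<^sub>F z in at 0. norm (z * csqrt z) \<le> norm z * sqrt (norm z)"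
        by (simp add: norm_mult norm_csqrt_eq)
      show "((\<lambda>z. norm z * sqrt (norm z)) \<longlongrightarrow> 0) (at (0::complex))"
        by (auto intro!: tendsto_eq_intros)
    qed
    then have "isCont (\<lambda>z. z * csqrt z) 0" by (simp add: isCont_def)
    then show ?thesis unfolding True by (rule continuous_at_imp_continuous_at_within)
  next
    case False
    have "z \<notin> \<real>\<^sub>\<le>\<^sub>0"
    proof
      assume "z \<in> \<real>\<^sub>\<le>\<^sub>0"
      then have "Re z = 0" "Im z = 0" using z by (auto simp: complex_nonpos_Reals_iff)
      then show False using False by (simp add: complex_eq_iff)
    qed
    then have "isCont (\<lambda>z. z * csqrt z) z"
      by (rule continuous_mult[OF continuous_ident continuous_at_csqrt])
    then show ?thesis by (rule continuous_at_imp_continuous_at_within)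
  qed
  then show ?thesis unfolding continuous_on_eq_continuous_within by blast
qed

lemma holomorphic_on_mult_csqrt: "(\<lambda>z. z * csqrt z) holomorphic_on {z. \<bar>Im z\<bar> < Re z}"
  by (intro holomorphic_intros) (auto simp: complex_nonpos_Reals_iff)

lemma Phragmen_Lindelof_right_angle:
  fixes f :: "complex \<Rightarrow> complex"
  assumes cont: "continuous_on {z. \<bar>Im z\<bar> \<le> Re z} f"
    and hol: "f holomorphic_on {z. \<bar>Im z\<bar> < Re z}"
    and bd: "\<And>z. \<bar>Im z\<bar> = Re z \<Longrightarrow> norm (f z) \<le> K"
    and gr: "\<And>z. \<bar>Im z\<bar> \<le> Re z \<Longrightarrow> norm (f z) \<le> A * exp (B * norm z)"
    and z: "\<bar>Im z\<bar> \<le> Re z"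
  shows "norm (f z) \<le> K"
proof (cases "\<bar>Im z\<bar> = Re z")
  case False
  then have zi: "\<bar>Im z\<bar> < Re z" using z by simp
  have K0: "K \<ge> 0" using order_trans[OF norm_ge_zero bd[of 0]] by simp
  have A0: "A \<ge> 0" using order_trans[OF norm_ge_zero gr[of 0]] by simp
  have main: "norm (f z) \<le> (K + d) * exp (e * Re (z * csqrt z))" if d: "d > 0" and e: "e > 0" for d e
  proof -
    define g where "g = (\<lambda>z. f z * exp (- of_real e * (z * csqrt z)))"
    have ng: "norm (g u) = norm (f u) * exp (- e * Re (u * csqrt u))" for u
      by (simp add: g_def norm_mult)
    have lim: "((\<lambda>R. A * exp (B * R - e * (R * sqrt R / 8))) \<longlongrightarrow> 0) at_top"
      using e by real_asymp
    have "\<forall>\<^sub>F R in at_top. A * exp (B * R - e * (R * sqrt R / 8)) < d"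
      using order_tendstoD(2)[OF lim d] .
    moreover have "\<forall>\<^sub>F R in at_top. norm z < R" by (rule eventually_gt_at_top)
    ultimately have "\<forall>\<^sub>F R in at_top. A * exp (B * R - e * (R * sqrt R / 8)) < d \<and> norm z < R"
      by eventually_elim simp
    then obtain R where R: "A * exp (B * R - e * (R * sqrt R / 8)) < d" "norm z < R"
      using eventually_happens by fastforce
    define S where "S = {z. \<bar>Im z\<bar> < Re z} \<inter> ball 0 R"
    define T where "T = {z. \<bar>Im z\<bar> \<le> Re z} \<inter> cball 0 R"
    have oS: "open S" unfolding S_def
      by (intro open_Int open_ball open_Collect_less continuous_intros)
    have cT: "closed T" unfolding T_def
      by (intro closed_Int closed_cball closed_Collect_le continuous_intros)
    have ST: "S \<subseteq> T" by (auto simp: S_def T_def)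
    have clS: "closure S \<subseteq> T" using ST cT by (rule closure_minimal)
    have frS: "frontier S \<subseteq> T - S" using clS oS by (auto simp: frontier_def interior_open)
    have "norm (g z) \<le> K + d"
    proof (rule maximum_modulus_frontier[where f = g and S = S and \<xi> = z])
      show "g holomorphic_on interior S"
      proof (rule holomorphic_on_subset)
        show "g holomorphic_on {z. \<bar>Im z\<bar> < Re z}"
          unfolding g_def
          by (intro holomorphic_on_mult hol holomorphic_on_exp' holomorphic_on_mult_csqrt holomorphic_on_const)
        have "S \<subseteq> {z. \<bar>Im z\<bar> < Re z}" by (auto simp: S_def)
        with interior_subset show "interior S \<subseteq> {z. \<bar>Im z\<bar> < Re z}" by (rule subset_trans)
      qed
      show "continuous_on (closure S) g"
      proof (rule continuous_on_subset[of "{z. \<bar>Im z\<bar> \<le> Re z}"])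
        show "continuous_on {z. \<bar>Im z\<bar> \<le> Re z} g"
          unfolding g_def by (intro continuous_intros cont continuous_on_mult_csqrt)
      qed (use clS in \<open>auto simp: T_def\<close>)
      show "bounded S" unfolding S_def by (simp add: bounded_Int)
      show "z \<in> S" using zi R by (simp add: S_def)
    next
      fix u assume "u \<in> frontier S"
      then have u: "u \<in> T - S" using frS by blast
      have uT: "\<bar>Im u\<bar> \<le> Re u" using u by (simp add: T_def)
      note ge = Re_mult_csqrt_ge[OF uT]
      have nn: "norm u * sqrt (norm u) / 8 \<ge> 0" by simp
      consider "\<bar>Im u\<bar> = Re u" | "norm u = R" using u by (force simp: S_def T_def)
      then show "norm (g u) \<le> K + d"
      proof cases
        case 1
        have "0 \<le> e * Re (u * csqrt u)" using ge nn e by (intro mult_nonneg_nonneg) linarith+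
        then have "norm (g u) \<le> norm (f u) * 1" unfolding ng by (intro mult_left_mono) auto
        then show ?thesis using bd[OF 1] d by simp
      next
        case 2
        have "norm (g u) \<le> (A * exp (B * R)) * exp (- e * (R * sqrt R / 8))"
          unfolding ng using gr[OF uT] ge e 2 A0 by (intro mult_mono) auto
        also have "\<dots> = A * exp (B * R - e * (R * sqrt R / 8))"
          by (simp add: mult.assoc flip: exp_add)
        finally show ?thesis using R K0 by simp
      qed
    qed
    then have "norm (f z) * exp (- e * Re (z * csqrt z)) * exp (e * Re (z * csqrt z)) 
        \<le> (K + d) * exp (e * Re (z * csqrt z))"
      unfolding ng by (intro mult_right_mono) auto
    then show ?thesis by (simp add: mult.assoc flip: exp_add)
  qed
  have "norm (f z) \<le> (K + d)" if "d > 0" for d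
  proof (rule tendsto_lowerbound)
    show "((\<lambda>e. (K + d) * exp (e * Re (z * csqrt z))) \<longlongrightarrow> K + d) (at_right 0)"
      by (auto intro!: tendsto_eq_intros)
    show "\<forall>\<^sub>F e in at_right 0. norm (f z) \<le> (K + d) * exp (e * Re (z * csqrt z))"
      using main[OF that] by (auto simp: eventually_at_filter)
  qed simp
  then show ?thesis by (rule field_le_epsilon)
qed (use bd in auto)

lemma norm_one_minus_ge:
  assumes "Im z \<ge> 0" "e \<ge> 0"
  shows "1 \<le> norm (1 - \<i> * of_real e * z)"
proof -
  have "1 \<le> 1 + e * Im z" using assms by simp
  also have "\<dots> = Re (1 - \<i> * of_real e * z)" by simp
  also have "\<dots> \<le> norm (1 - \<i> * of_real e * z)" by (rule complex_Re_le_cmod)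
  finally show ?thesis .
qed

text \<open>The denominator \<open>1 - \<i> * e * z\<close> has modulus at least \<open>1\<close> on
  the half plane and is large on large half circles, which brings a bounded function below the
  real-line bound there; \<open>e\<close> then tends to \<open>0\<close>.\<close>

lemma Phragmen_Lindelof_bounded_half_plane:
  fixes f :: "complex \<Rightarrow> complex"
  assumes cont: "continuous_on {z. 0 \<le> Im z} f"
    and hol: "f holomorphic_on {z. 0 < Im z}"
    and bd: "\<And>z. Im z = 0 \<Longrightarrow> norm (f z) \<le> K"
    and gr: "\<And>z. 0 \<le> Im z \<Longrightarrow> norm (f z) \<le> M"
    and z: "0 \<le> Im z"
  shows "norm (f z) \<le> K"
proof (cases "Im z = 0")
  case False
  then have zi: "0 < Im z" using z by simp
  have K0: "K \<ge> 0" using order_trans[OF norm_ge_zero bd[of 0]] by simp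
  have M0: "M \<ge> 0" using order_trans[OF norm_ge_zero gr[of 0]] by simp
  have main: "norm (f z) \<le> (K + d) * norm (1 - \<i> * of_real e * z)" if d: "d > 0" and e: "e > 0" for d e
  proof -
    define g where "g = (\<lambda>z. f z / (1 - \<i> * of_real e * z))"
    have n1: "1 \<le> norm (1 - \<i> * of_real e * u)" if "0 \<le> Im u" for u
      using norm_one_minus_ge[OF that] e by auto
    have nz: "1 - \<i> * of_real e * u \<noteq> 0" if "0 \<le> Im u" for u
      using n1[OF that] by auto
    have lim: "((\<lambda>R. M / (e * R - 1)) \<longlongrightarrow> 0) at_top"
      using e by real_asymp
    have "\<forall>\<^sub>F R in at_top. M / (e * R - 1) < d"
      using order_tendstoD(2)[OF lim d] .
    moreover have "\<forall>\<^sub>F R in at_top. norm z < R" by (rule eventually_gt_at_top)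
    moreover have "\<forall>\<^sub>F R in at_top. 2/e < R" by (rule eventually_gt_at_top)
    ultimately have "\<forall>\<^sub>F R in at_top. M / (e * R - 1) < d \<and> norm z < R \<and> 2/e < R"
      by eventually_elim simp
    then obtain R where R: "M / (e * R - 1) < d" "norm z < R" "2/e < R"
      using eventually_happens by fastforce
    have eR: "1 < e * R - 1" using R(3) e by (simp add: field_simps)
    define S where "S = {z. 0 < Im z} \<inter> ball 0 R"
    define T where "T = {z. 0 \<le> Im z} \<inter> cball 0 R"
    have oS: "open S" unfolding S_def
      by (intro open_Int open_ball open_Collect_less continuous_intros)
    have cT: "closed T" unfolding T_def
      by (intro closed_Int closed_cball closed_Collect_le continuous_intros)
    have ST: "S \<subseteq> T" by (auto simp: S_def T_def)
    have clS: "closure S \<subseteq> T" using ST cT by (rule closure_minimal)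
    have frS: "frontier S \<subseteq> T - S" using clS oS by (auto simp: frontier_def interior_open)
    have "norm (g z) \<le> K + d"
    proof (rule maximum_modulus_frontier[where f = g and S = S and \<xi> = z])
      show "g holomorphic_on interior S"
      proof (rule holomorphic_on_subset)
        show "g holomorphic_on {z. 0 < Im z}"
          unfolding g_def using nz by (intro holomorphic_intros hol) fastforce
        have "S \<subseteq> {z. 0 < Im z}" by (auto simp: S_def)
        with interior_subset show "interior S \<subseteq> {z. 0 < Im z}" by (rule subset_trans)
      qed
      show "continuous_on (closure S) g"
      proof (rule continuous_on_subset[of "{z. 0 \<le> Im z}"])
        show "continuous_on {z. 0 \<le> Im z} g"
          unfolding g_def by (intro continuous_on_divide continuous_intros cont) (use nz in blast)
      qed (use clS in \<open>auto simp: T_def\<close>)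
      show "bounded S" unfolding S_def by (simp add: bounded_Int)
      show "z \<in> S" using zi R by (simp add: S_def)
    next
      fix u assume "u \<in> frontier S"
      then have u: "u \<in> T - S" using frS by blast
      have uT: "0 \<le> Im u" using u by (simp add: T_def)
      consider "Im u = 0" | "norm u = R" using u by (force simp: S_def T_def)
      then show "norm (g u) \<le> K + d"
      proof cases
        case 1
        have "norm (g u) \<le> norm (f u) / 1" unfolding g_def norm_divide
          using n1[OF uT] by (intro divide_left_mono) auto
        then show ?thesis using bd[OF 1] d by simp
      next
        case 2
        have "norm (\<i> * of_real e * u) - norm (1::complex) \<le> norm (\<i> * of_real e * u - 1)"
          by (rule norm_triangle_ineq2)
        then have "e * R - 1 \<le> norm (1 - \<i> * of_real e * u)" using e 2
          by (simp add: norm_mult norm_minus_commute)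
        then have "norm (g u) \<le> M / (e * R - 1)" unfolding g_def norm_divide
          using gr[OF uT] eR M0 by (intro frac_le) auto
        then show ?thesis using R K0 by simp
      qed
    qed
    then show ?thesis using nz[OF z] unfolding g_def norm_divide by (simp add: divide_le_eq)
  qed
  have "norm (f z) \<le> (K + d)" if "d > 0" for d
  proof (rule tendsto_lowerbound)
    show "((\<lambda>e. (K + d) * norm (1 - \<i> * of_real e * z)) \<longlongrightarrow> K + d) (at_right 0)"
      by (auto intro!: tendsto_eq_intros)
    show "\<forall>\<^sub>F e in at_right 0. norm (f z) \<le> (K + d) * norm (1 - \<i> * of_real e * z)"
      using main[OF that] by (auto simp: eventually_at_filter)
  qed simp
  then show ?thesis by (rule field_le_epsilon)
qed (use bd in auto)

text \<open>The imaginary axis cuts the half plane into two right angles in which exponential growth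
  is subcritical. This yields the provisional bound \<open>max K M\<close>, which the bounded case
  sharpens to \<open>K\<close>.\<close>

lemma Phragmen_Lindelof_half_plane:
  fixes f :: "complex \<Rightarrow> complex"
  assumes cont: "continuous_on {z. 0 \<le> Im z} f"
    and hol: "f holomorphic_on {z. 0 < Im z}"
    and bd: "\<And>z. Im z = 0 \<Longrightarrow> norm (f z) \<le> K"
    and im: "\<And>z. Re z = 0 \<Longrightarrow> 0 \<le> Im z \<Longrightarrow> norm (f z) \<le> M"
    and gr: "\<And>z. 0 \<le> Im z \<Longrightarrow> norm (f z) \<le> A * exp (B * norm z)"
    and z: "0 \<le> Im z"
  shows "norm (f z) \<le> K"
proof (rule Phragmen_Lindelof_bounded_half_plane[OF cont hol bd _ z])
  have A0: "A \<ge> 0" using order_trans[OF norm_ge_zero gr[of 0]] by simp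
  define B' where "B' = max B 0"
  have gr': "norm (f u) \<le> A * exp (B' * norm u)" if "0 \<le> Im u" for u
    using gr[OF that] A0 by (smt (verit) B'_def exp_le_cancel_iff max.cobounded1 mult_left_mono mult_right_mono norm_ge_zero)
  fix u assume u: "0 \<le> Im u"
  \<comment> \<open>Multiplication by \<open>Complex s 1\<close> carries the standard right angle
    onto the right quadrant for \<open>s = 1\<close> and onto the left one for
    \<open>s = -1\<close>. It stretches by the square root of 2, which accounts for the doubled
    growth constant.\<close>
  have gen: "norm (f u) \<le> max K M"
    if w: "w = Complex s 1" "\<bar>s\<bar> = 1" and v: "u = w * v" "\<bar>Im v\<bar> \<le> Re v" for s w v
  proof -
    have nw: "norm w \<le> 2" using w norm_complex_def[of w] real_sqrt_le_mono[of 2 4]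
      by (auto simp: power2_eq_square abs_if split: if_splits)
    have im: "Im (w * x) = s * Im x + Re x" "Re (w * x) = s * Re x - Im x" for x
      using w by (auto simp: algebra_simps)
    have s: "s = 1 \<or> s = -1" using w by auto
    have imge: "0 \<le> Im (w * x)" if "\<bar>Im x\<bar> \<le> Re x" for x
      unfolding im using s that by auto
    have imgt: "0 < Im (w * x)" if "\<bar>Im x\<bar> < Re x" for x
      unfolding im using s that by auto
    have "norm ((\<lambda>x. f (w * x)) v) \<le> max K M"
    proof (rule Phragmen_Lindelof_right_angle[where f = "\<lambda>x. f (w * x)" and z = v and A = A and B = "B' * 2"])
      show "continuous_on {z. \<bar>Im z\<bar> \<le> Re z} (\<lambda>x. f (w * x))"
        by (rule continuous_on_compose2[OF cont]) (use imge in \<open>auto intro!: continuous_intros\<close>)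
      have "(f \<circ> (\<lambda>x. w * x)) holomorphic_on {z. \<bar>Im z\<bar> < Re z}"
        by (rule holomorphic_on_compose_gen[OF _ hol]) (use imgt in \<open>auto intro!: holomorphic_intros\<close>)
      then show "(\<lambda>x. f (w * x)) holomorphic_on {z. \<bar>Im z\<bar> < Re z}" by (simp add: o_def)
    next
      fix x assume x: "\<bar>Im x\<bar> = Re x"
      then have "Im (w * x) = 0 \<or> (Re (w * x) = 0 \<and> 0 \<le> Im (w * x))"
        unfolding im using s by auto
      then show "norm (f (w * x)) \<le> max K M" using bd assms(4) by fastforce
    next
      fix x assume x: "\<bar>Im x\<bar> \<le> Re x"
      have "0 \<le> Im (w * x)" using imge x .
      then have "norm (f (w * x)) \<le> A * exp (B' * norm (w * x))" by (rule gr')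
      also have "\<dots> \<le> A * exp (B' * (2 * norm x))"
        using nw A0 by (intro mult_left_mono) (auto simp: norm_mult B'_def intro!: mult_left_mono mult_right_mono)
      finally show "norm (f (w * x)) \<le> A * exp (B' * 2 * norm x)" by (simp add: mult.assoc)
    qed (use v in auto)
    then show ?thesis using v by simp
  qed
  show "norm (f u) \<le> max K M"
  proof (cases "Re u \<ge> 0")
    case True
    show ?thesis
    proof (rule gen[of _ 1 "Complex ((Re u + Im u)/2) ((Im u - Re u)/2)"])
      show "u = Complex 1 1 * Complex ((Re u + Im u) / 2) ((Im u - Re u) / 2)"
        by (simp add: complex_eq_iff field_simps)
    qed (use True u in \<open>auto simp: field_simps abs_if\<close>)
  next
    case False
    show ?thesis
    proof (rule gen[of _ "-1" "Complex ((Im u - Re u)/2) ((- Im u - Re u)/2)"])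
      show "u = Complex (-1) 1 * Complex ((Im u - Re u) / 2) ((- Im u - Re u) / 2)"
        by (simp add: complex_eq_iff field_simps)
    qed (use False u in \<open>auto simp: field_simps abs_if\<close>)
  qed
qed

text \<open>The disc estimate is transplanted by the Cayley map taking \<open>0\<close> to
  \<open>\<i> * y\<close>. The exponent \<open>(1 + norm \<xi>) / (1 - norm \<xi>)\<close> is at
  most \<open>4 / (1 - (norm \<xi>)\<^sup>2)\<close>, and this equals the quotient in the
  conclusion.\<close>

lemma half_plane_quotient:
  fixes F f g :: "complex \<Rightarrow> complex"
  assumes hol: "F holomorphic_on {z. 0 < Im z}" "f holomorphic_on {z. 0 < Im z}" "g holomorphic_on {z. 0 < Im z}"
    and le: "\<And>z. 0 < Im z \<Longrightarrow> norm (F z) \<le> 1" "\<And>z. 0 < Im z \<Longrightarrow> norm (f z) \<le> 1"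
    and eq: "\<And>z. 0 < Im z \<Longrightarrow> F z = f z * g z"
    and y: "y > 0" "exp (- t) \<le> norm (f (\<i> * of_real y))" and t: "t \<ge> 0" and z: "0 < Im z"
  shows "norm (g z) \<le> exp (t * ((norm (z + \<i> * of_real y))\<^sup>2 / (Im z * y)))"
proof -
  define m where "m = (\<lambda>u. \<i> * of_real y * (1 + u) / (1 - u))"
  have ne: "1 - u \<noteq> 0" if "norm u < 1" for u :: complex using that by auto
  have Imm: "0 < Im (m u)" if u: "norm u < 1" for u
  proof -
    have "(norm u)\<^sup>2 < 1" using u by (simp add: power_less_one_iff abs_square_less_1)
    then have u2: "(Re u)\<^sup>2 + (Im u)\<^sup>2 < 1" by (simp add: cmod_power2)
    have e: "(1 + u) / (1 - u) = (1 + u) * cnj (1 - u) / of_real ((norm (1 - u))\<^sup>2)"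
      by (rule complex_div_cnj)
    have "Re ((1 + u) / (1 - u)) = (1 - ((Re u)\<^sup>2 + (Im u)\<^sup>2)) / (norm (1 - u))\<^sup>2"
      unfolding e Re_divide_of_real by (simp add: power2_eq_square algebra_simps)
    also have "\<dots> > 0" using u2 ne[OF u] by simp
    finally have "0 < y * Re ((1 + u) / (1 - u))" using y by simp
    moreover have "Im (m u) = y * Re ((1 + u) / (1 - u))"
    proof -
      have "m u = \<i> * (of_real y * ((1 + u) / (1 - u)))" by (simp add: m_def)
      then show ?thesis by (simp only: Im_i_times) (simp del: times_divide_eq_right)
    qed
    ultimately show ?thesis by simp
  qed
  have holm: "m holomorphic_on ball 0 1"
    unfolding m_def by (intro holomorphic_intros) (use ne in auto)
  have comp: "(\<lambda>u. h (m u)) holomorphic_on ball 0 1" if "h holomorphic_on {z. 0 < Im z}" for h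
    using holomorphic_on_compose_gen[OF holm that, unfolded o_def] Imm by fastforce
  define \<xi> where "\<xi> = (z - \<i> * of_real y) / (z + \<i> * of_real y)"
  define N where "N = (norm (z + \<i> * of_real y))\<^sup>2"
  have zy: "z + \<i> * of_real y \<noteq> 0"
  proof
    assume "z + \<i> * of_real y = 0"
    then have "Im (z + \<i> * of_real y) = 0" by simp
    then show False using z y by simp
  qed
  have N0: "N > 0" using zy by (simp add: N_def)
  have n2: "(norm (z - \<i> * of_real y))\<^sup>2 = N - 4 * (Im z * y)"
    unfolding N_def cmod_power2 by (simp add: power2_eq_square algebra_simps)
  have x2: "(norm \<xi>)\<^sup>2 = 1 - 4 * (Im z * y) / N"
  proof -
    have "(norm \<xi>)\<^sup>2 = (norm (z - \<i> * of_real y))\<^sup>2 / N"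
      by (simp only: \<xi>_def norm_divide power_divide N_def)
    then show ?thesis using N0 by (simp add: n2 diff_divide_distrib)
  qed
  have "(norm \<xi>)\<^sup>2 < 1" using x2 N0 z y by simp
  then have x1: "norm \<xi> < 1" by (simp add: abs_square_less_1)
  have m\<xi>: "m \<xi> = z"
  proof -
    have "1 - \<xi> = 2 * \<i> * of_real y / (z + \<i> * of_real y)" "1 + \<xi> = 2 * z / (z + \<i> * of_real y)"
      using zy by (auto simp: \<xi>_def field_simps)
    then show ?thesis using zy y by (simp add: m_def)
  qed
  have m0: "m 0 = \<i> * of_real y" by (simp add: m_def)
  define e where "e = (1 + norm \<xi>) / (1 - norm \<xi>)"
  have "e = (1 + norm \<xi>)\<^sup>2 / (1 - (norm \<xi>)\<^sup>2)"
  proof -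
    have "1 - (norm \<xi>)\<^sup>2 = (1 - norm \<xi>) * (1 + norm \<xi>)" by (simp add: power2_eq_square algebra_simps)
    moreover have "1 + norm \<xi> \<noteq> 0" using norm_ge_zero[of \<xi>] by linarith
    ultimately show ?thesis using x1 by (simp add: e_def power2_eq_square)
  qed
  also have "\<dots> \<le> 4 / (1 - (norm \<xi>)\<^sup>2)"
  proof (rule divide_right_mono)
    have "(1 + norm \<xi>)\<^sup>2 \<le> 2\<^sup>2" using x1 by (intro power_mono) auto
    then show "(1 + norm \<xi>)\<^sup>2 \<le> 4" by simp
  qed (use \<open>(norm \<xi>)\<^sup>2 < 1\<close> in simp)
  also have "\<dots> = N / (Im z * y)" using N0 z y by (simp add: x2)
  finally have eN: "e \<le> N / (Im z * y)" .
  have e0: "e \<ge> 0" using x1 by (simp add: e_def)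
  have f0: "norm (f (m 0)) > 0" using less_le_trans[OF exp_gt_zero y(2)] by (simp only: m0)
  have "norm (g (m \<xi>)) * norm (f (m 0)) powr e \<le> 1"
    unfolding e_def
    by (rule bounded_quotient_disc[OF comp[OF hol(1)] comp[OF hol(2)] comp[OF hol(3)]])
       (use le eq Imm x1 f0 in auto)
  then have 1: "norm (g z) * norm (f (\<i> * of_real y)) powr e \<le> 1" by (simp add: m\<xi> m0)
  have "exp (- (t * e)) = exp (- t) powr e" by (simp add: powr_def mult.commute)
  also have "\<dots> \<le> norm (f (\<i> * of_real y)) powr e" using y e0 by (intro powr_mono2) auto
  finally have "norm (g z) * exp (- (t * e)) \<le> 1"
    using 1 by (meson mult_left_mono norm_ge_zero order_trans)
  then have "norm (g z) \<le> exp (t * e)" by (simp add: exp_minus field_simps)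
  also have "\<dots> \<le> exp (t * (N / (Im z * y)))" using mult_left_mono[OF eN t] by simp
  finally show ?thesis by (simp add: N_def)
qed

text \<open>In the kite \<open>\<bar>Im z\<bar>\<close> is at most a quarter of the horizontal
  distance to either corner, so the real part stays close to its value at \<open>Re z\<close>. The
  errors leave \<open>13/16\<close> in the numerator and \<open>17/16\<close> in the denominator,
  and \<open>13/17\<close> exceeds \<open>3/4\<close>.\<close>

lemma kite_Re_bound:
  assumes z: "4 * \<bar>Im z\<bar> \<le> Re z" "4 * \<bar>Im z\<bar> \<le> R - Re z" and ne: "z \<noteq> of_real R"
  shows "3/4 * ((Re z)\<^sup>2 / (R - Re z)) \<le> Re (z\<^sup>2 / (of_real R - z))" and "Re z < R"
proof -
  define x y where "x = Re z" and "y = Im z"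
  have zxy: "z = Complex x y" by (simp add: x_def y_def)
  show Rx: "Re z < R"
  proof (rule ccontr)
    assume "\<not> Re z < R"
    then have "Im z = 0" "Re z = R" using z by auto
    then show False using ne by (simp add: complex_eq_iff)
  qed
  then have d: "R - x > 0" by (simp add: x_def)
  have x0: "x \<ge> 0" using z by (simp add: x_def)
  have "\<bar>y\<bar> * \<bar>y\<bar> \<le> (x / 4) * ((R - x) / 4)"
    using z by (intro mult_mono) (auto simp: x_def y_def)
  then have y1: "y * y \<le> x * (R - x) / 16" by simp
  have "\<bar>y\<bar> * \<bar>y\<bar> \<le> (x / 4) * (x / 4)"
    using z by (intro mult_mono) (auto simp: x_def y_def)
  then have y2: "y * y \<le> x * x / 16" by simp
  have "\<bar>y\<bar> * \<bar>y\<bar> \<le> ((R - x) / 4) * ((R - x) / 4)"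
    using z by (intro mult_mono) (auto simp: x_def y_def)
  then have y3: "y * y \<le> (R - x) * (R - x) / 16" by simp
  have "Re (z\<^sup>2 / (of_real R - z)) = ((x * x - y * y) * (R - x) - 2 * x * (y * y)) / ((R - x)\<^sup>2 + y\<^sup>2)"
  proof -
    have "z\<^sup>2 / (of_real R - z) = z\<^sup>2 * cnj (of_real R - z) / of_real ((norm (of_real R - z))\<^sup>2)"
      by (rule complex_div_cnj)
    moreover have "Re (z\<^sup>2 * cnj (of_real R - z)) = (x * x - y * y) * (R - x) - 2 * x * (y * y)"
      by (simp add: zxy power2_eq_square algebra_simps)
    moreover have "(norm (of_real R - z))\<^sup>2 = (R - x)\<^sup>2 + y\<^sup>2"
      unfolding cmod_power2 by (simp add: zxy)
    ultimately show ?thesis by (simp only: Re_divide_of_real)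
  qed
  also have "\<dots> \<ge> (13/16 * (x * x * (R - x))) / (17/16 * ((R - x) * (R - x)))"
  proof (rule frac_le)
    have "15/16 * (x * x) * (R - x) \<le> (x * x - y * y) * (R - x)"
      using y2 d by (intro mult_right_mono) auto
    moreover have "2 * x * (y * y) \<le> 2 * x * (x * (R - x) / 16)"
      using y1 x0 by (intro mult_left_mono) auto
    moreover have "15/16 * (x * x) * (R - x) = 15/16 * (x * x * (R - x))"
      "2 * x * (x * (R - x) / 16) = 1/8 * (x * x * (R - x))" by simp_all
    ultimately show "13/16 * (x * x * (R - x)) \<le> (x * x - y * y) * (R - x) - 2 * x * (y * y)"
      by linarith
    show "0 \<le> (x * x - y * y) * (R - x) - 2 * x * (y * y)"
      using \<open>13/16 * (x * x * (R - x)) \<le> (x * x - y * y) * (R - x) - 2 * x * (y * y)\<close> 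
      by (rule order_trans[rotated]) (use x0 d in simp)
    show "(R - x)\<^sup>2 + y\<^sup>2 \<le> 17/16 * ((R - x) * (R - x))"
      using y3 by (simp add: power2_eq_square)
    show "0 < (R - x)\<^sup>2 + y\<^sup>2" using d by (simp add: add_pos_nonneg)
  qed
  finally have "(13/16 * (x * x * (R - x))) / (17/16 * ((R - x) * (R - x))) \<le> Re (z\<^sup>2 / (of_real R - z))" .
  moreover have "(13/16 * (x * x * (R - x))) / (17/16 * ((R - x) * (R - x))) = 13/17 * (x * x / (R - x))"
  proof -
    have "(13/16 * (p * q)) / (17/16 * (q * q)) = 13/17 * (p / q)" if "q > 0" for p q :: real
      using that by simp
    from this[OF d] show ?thesis .
  qed
  moreover have "3/4 * (x * x / (R - x)) \<le> 13/17 * (x * x / (R - x))"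
    using d by (intro mult_right_mono) auto
  ultimately show "3/4 * ((Re z)\<^sup>2 / (R - Re z)) \<le> Re (z\<^sup>2 / (of_real R - z))"
    by (simp add: x_def power2_eq_square)
qed

text \<open>The factor \<open>exp (- A * z\<^sup>2 / (R - z))\<close> compensates the growth of \<open>g\<close> on the right-hand sides of the
  kite with corners \<open>0\<close> and \<open>R\<close>, and tends to \<open>1\<close> as \<open>R\<close> tends to infinity.\<close>

lemma wedge_bound:
  fixes g :: "complex \<Rightarrow> complex"
  assumes hol: "g holomorphic_on UNIV"
    and bd: "\<And>z. \<bar>Re z\<bar> \<le> 4 * \<bar>Im z\<bar> \<Longrightarrow> norm (g z) \<le> K"
    and gr: "\<And>z. Im z \<noteq> 0 \<Longrightarrow> norm (g z) \<le> K' * exp (C * ((norm z)\<^sup>2 / \<bar>Im z\<bar>))"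
    and z: "4 * \<bar>Im z\<bar> < Re z"
  shows "norm (g z) \<le> max K K'"
proof -
  define A where "A = 6 * max C 1"
  have A: "A \<ge> 6" "A \<ge> 6 * C" by (auto simp: A_def)
  have "0 \<le> K' * exp (C * ((norm \<i>)\<^sup>2 / \<bar>Im \<i>\<bar>))"
    by (rule order_trans[OF norm_ge_zero gr]) simp
  then have K'0: "K' \<ge> 0" by (simp add: zero_le_mult_iff)
  have contg: "continuous_on UNIV g" using hol holomorphic_on_imp_continuous_on by blast
  have main: "norm (g z) \<le> max K K' * exp (A * Re (z\<^sup>2 / (of_real R - z)))"
    if R: "R > Re z + 4 * \<bar>Im z\<bar>" for R
  proof -
    define S where "S = {z. 4 * \<bar>Im z\<bar> < Re z} \<inter> {z. 4 * \<bar>Im z\<bar> < R - Re z}"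
    define T where "T = {z. 4 * \<bar>Im z\<bar> \<le> Re z} \<inter> {z. 4 * \<bar>Im z\<bar> \<le> R - Re z}"
    \<comment> \<open>The exponent blows up at the corner \<open>R\<close>, so the compensated
      function tends to \<open>0\<close> there within the kite and the value \<open>0\<close> makes
      it continuous up to the boundary.\<close>
    define h where "h = (\<lambda>z. if z = of_real R then 0 else g z * exp (- of_real A * (z\<^sup>2 / (of_real R - z))))"
    have nh: "norm (h u) = norm (g u) * exp (- A * Re (u\<^sup>2 / (of_real R - u)))" if "u \<noteq> of_real R" for u
      using that by (simp add: h_def norm_mult del: times_divide_eq_right)
    have R0: "R > 0" using R z by linarith
    have oS: "open S" unfolding S_def
      by (intro open_Int open_Collect_less continuous_intros)
    have cT: "closed T" unfolding T_def
      by (intro closed_Int closed_Collect_le continuous_intros)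
    have ST: "S \<subseteq> T" by (auto simp: S_def T_def)
    have clS: "closure S \<subseteq> T" using ST cT by (rule closure_minimal)
    have frS: "frontier S \<subseteq> T - S" using clS oS by (auto simp: frontier_def interior_open)
    have bT: "bounded T"
    proof (rule boundedI)
      fix u assume "u \<in> T"
      then have "\<bar>Re u\<bar> \<le> R" "\<bar>Im u\<bar> \<le> R" unfolding T_def by auto
      then show "norm u \<le> R + R" using cmod_le[of u] by linarith
    qed
    have "norm (h z) \<le> max K K'"
    proof (rule maximum_modulus_frontier[where f = h and S = S and \<xi> = z])
      have "(\<lambda>z. g z * exp (- of_real A * (z\<^sup>2 / (of_real R - z)))) holomorphic_on S"
        by (intro holomorphic_intros holomorphic_on_subset[OF hol]) (auto simp: S_def)
      then show "h holomorphic_on interior S"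
        unfolding interior_open[OF oS]
        by (rule holomorphic_transform) (auto simp: h_def S_def)
      show "bounded S" using bT ST bounded_subset by blast
      show "z \<in> S" using z R by (auto simp: S_def)
      have cg: "isCont (\<lambda>z. g z * exp (- of_real A * (z\<^sup>2 / (of_real R - z)))) u" if "u \<noteq> of_real R" for u
        using contg that by (intro continuous_intros) (auto simp: continuous_on_eq_continuous_at)
      have "continuous_on T h"
        unfolding continuous_on_eq_continuous_within
      proof
        fix u assume u: "u \<in> T"
        show "continuous (at u within T) h"
        proof (cases "u = of_real R")
          case False
          have ev: "\<forall>\<^sub>F v in nhds u. v \<noteq> of_real R"
            using False by (rule t1_space_nhds)
          have "\<forall>\<^sub>F v in nhds u. h v = g v * exp (- of_real A * (v\<^sup>2 / (of_real R - v)))"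
            using ev by eventually_elim (simp add: h_def)
          then have "isCont h u" using cg[OF False] by (rule isCont_cong[THEN iffD2])
          then show ?thesis by (rule continuous_at_imp_continuous_at_within)
        next
          case True
          have "compact (g ` T)" using cT bT contg
            by (intro compact_continuous_image) (auto simp: compact_eq_bounded_closed intro: continuous_on_subset)
          then obtain M where M: "\<And>v. v \<in> T \<Longrightarrow> norm (g v) \<le> M"
            using compact_imp_bounded[of "g ` T"] by (auto simp: bounded_iff)
          have M0: "M \<ge> 0" using M[OF u] norm_ge_zero[of "g u"] by linarith
          define k where "k = A * (3/4) * (R\<^sup>2 / 4)"
          have k0: "k > 0" using A R0 by (simp add: k_def)
          have "(h \<longlongrightarrow> 0) (at u within T)"
          proof (rule Lim_null_comparison)
            have lim: "((\<lambda>v. norm (v - of_real R)) \<longlongrightarrow> 0) (at u within T)"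
              unfolding True by (auto intro!: tendsto_eq_intros)
            have R2: "R / 2 > 0" using R0 by simp
            have "\<forall>\<^sub>F v in at u within T. norm (v - of_real R) < R / 2"
              using order_tendstoD(2)[OF lim R2] .
            moreover have "\<forall>\<^sub>F v in at u within T. v \<in> T \<and> v \<noteq> of_real R"
              unfolding True by (auto simp: eventually_at_filter)
            ultimately show "\<forall>\<^sub>F v in at u within T. norm (h v) \<le> M * (norm (v - of_real R) / k)"
            proof eventually_elim
              case (elim v)
              define d where "d = norm (v - of_real R)"
              have d0: "d > 0" using elim by (simp add: d_def)
              have "\<bar>Re v - R\<bar> \<le> d" unfolding d_def
                using abs_Re_le_cmod[of "v - of_real R"] by simp
              then have Rv: "R - Re v \<le> d" "R / 2 \<le> Re v" using elim unfolding d_def by linarith+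
              have vT: "4 * \<bar>Im v\<bar> \<le> Re v" "4 * \<bar>Im v\<bar> \<le> R - Re v" using elim by (auto simp: T_def)
              have kb: "3/4 * ((Re v)\<^sup>2 / (R - Re v)) \<le> Re (v\<^sup>2 / (of_real R - v))" "Re v < R"
                using kite_Re_bound[OF vT] elim by auto
              have "(R/2)\<^sup>2 / d \<le> (Re v)\<^sup>2 / (R - Re v)"
                using Rv R0 kb(2) by (intro frac_le power_mono) auto
              then have "3/4 * ((R/2)\<^sup>2 / d) \<le> Re (v\<^sup>2 / (of_real R - v))" using kb(1) by linarith
              then have "A * (3/4 * ((R/2)\<^sup>2 / d)) \<le> A * Re (v\<^sup>2 / (of_real R - v))"
                using A by (intro mult_left_mono) auto
              moreover have "A * (3/4 * ((R/2)\<^sup>2 / d)) = k / d" by (simp add: k_def power_divide)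
              ultimately have "- A * Re (v\<^sup>2 / (of_real R - v)) \<le> - (k / d)" by simp
              moreover have "exp (- (k / d)) \<le> d / k"
              proof -
                have "k / d \<le> exp (k / d)" using exp_ge_add_one_self[of "k / d"] by linarith
                then have "inverse (exp (k / d)) \<le> inverse (k / d)" using k0 d0 by (intro le_imp_inverse_le) auto
                then show ?thesis by (simp add: exp_minus)
              qed
              ultimately have "exp (- A * Re (v\<^sup>2 / (of_real R - v))) \<le> d / k"
                by (meson exp_le_cancel_iff order_trans)
              then have "norm (g v) * exp (- A * Re (v\<^sup>2 / (of_real R - v))) \<le> M * (d / k)"
                using M[of v] elim M0 by (intro mult_mono) auto
              then show ?case using nh[of v] elim by (simp add: d_def)
            qed
            have "((\<lambda>v. M * (norm (v - of_real R) / k)) \<longlongrightarrow> M * (0 / k)) (at u within T)"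
              using k0 by (intro tendsto_intros lim) auto
            then show "((\<lambda>v. M * (norm (v - of_real R) / k)) \<longlongrightarrow> 0) (at u within T)" by simp
          qed
          then show ?thesis using True by (simp add: continuous_within h_def)
        qed
      qed
      then show "continuous_on (closure S) h" using clS by (rule continuous_on_subset)
    next
      fix u assume "u \<in> frontier S"
      then have u: "u \<in> T - S" using frS by blast
      show "norm (h u) \<le> max K K'"
      proof (cases "u = of_real R")
        case True
        then show ?thesis using K'0 by (simp add: h_def)
      next
        case False
        have uT: "4 * \<bar>Im u\<bar> \<le> Re u" "4 * \<bar>Im u\<bar> \<le> R - Re u" using u by (auto simp: T_def)
        note kb = kite_Re_bound[OF uT False]
        have nn: "0 \<le> (Re u)\<^sup>2 / (R - Re u)" using kb(2) by simp
        have Re0: "0 \<le> Re (u\<^sup>2 / (of_real R - u))" using kb(1) nn by linarith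
        show ?thesis
        proof (cases "4 * \<bar>Im u\<bar> = Re u")
          case True
          have "norm (h u) \<le> norm (g u) * 1"
            unfolding nh[OF False] using Re0 A by (intro mult_left_mono) auto
          also have "\<dots> \<le> K" using bd[of u] True by auto
          finally show ?thesis by simp
        next
          case F2: False
          then have e: "4 * \<bar>Im u\<bar> = R - Re u" using u by (auto simp: S_def T_def)
          then have Im0: "Im u \<noteq> 0" using kb(2) by auto
          have "(norm u)\<^sup>2 = (Re u)\<^sup>2 + (Im u)\<^sup>2" by (rule cmod_power2)
          also have "(Im u)\<^sup>2 \<le> (Re u / 4)\<^sup>2"
            using uT(1) by (subst abs_le_square_iff[symmetric]) auto
          finally have "(norm u)\<^sup>2 \<le> 17/16 * (Re u)\<^sup>2" by (simp add: power_divide)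
          then have "(norm u)\<^sup>2 / \<bar>Im u\<bar> \<le> (17/16 * (Re u)\<^sup>2) / \<bar>Im u\<bar>"
            by (intro divide_right_mono) auto
          also have "\<dots> = (17/4 * (Re u)\<^sup>2) / (R - Re u)" using Im0 by (simp flip: e)
          also have "\<dots> = 17/4 * ((Re u)\<^sup>2 / (R - Re u))" by simp
          finally have "(norm u)\<^sup>2 / \<bar>Im u\<bar> \<le> 6 * Re (u\<^sup>2 / (of_real R - u))" using kb(1) nn by linarith
          then have "max C 1 * ((norm u)\<^sup>2 / \<bar>Im u\<bar>) \<le> max C 1 * (6 * Re (u\<^sup>2 / (of_real R - u)))"
            by (intro mult_left_mono) auto
          moreover have "C * ((norm u)\<^sup>2 / \<bar>Im u\<bar>) \<le> max C 1 * ((norm u)\<^sup>2 / \<bar>Im u\<bar>)"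
            by (intro mult_right_mono) auto
          ultimately have le: "C * ((norm u)\<^sup>2 / \<bar>Im u\<bar>) \<le> A * Re (u\<^sup>2 / (of_real R - u))"
            by (simp add: A_def mult.commute mult.left_commute)
          have "norm (h u) \<le> K' * exp (C * ((norm u)\<^sup>2 / \<bar>Im u\<bar>)) * exp (- A * Re (u\<^sup>2 / (of_real R - u)))"
            unfolding nh[OF False] using gr[OF Im0] by (intro mult_right_mono) auto
          also have "\<dots> = K' * exp (C * ((norm u)\<^sup>2 / \<bar>Im u\<bar>) - A * Re (u\<^sup>2 / (of_real R - u)))"
            by (simp add: mult.assoc flip: exp_add)
          also have "\<dots> \<le> K' * 1" using le K'0 by (intro mult_left_mono) auto
          finally show ?thesis by simp
        qed
      qed
    qed
    moreover have "z \<noteq> of_real R" using R by auto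
    ultimately have "norm (g z) * exp (- A * Re (z\<^sup>2 / (of_real R - z))) \<le> max K K'" using nh by simp
    then have "norm (g z) * exp (- A * Re (z\<^sup>2 / (of_real R - z))) * exp (A * Re (z\<^sup>2 / (of_real R - z)))
        \<le> max K K' * exp (A * Re (z\<^sup>2 / (of_real R - z)))" by (intro mult_right_mono) auto
    then show ?thesis by (simp add: mult.assoc flip: exp_add)
  qed
  show ?thesis
  proof (rule tendsto_lowerbound)
    have "filterlim (\<lambda>R. of_real R + (- z)) at_infinity at_top"
      by (rule tendsto_add_filterlim_at_infinity'[OF filterlim_of_real_at_infinity tendsto_const])
    then have "((\<lambda>R. z\<^sup>2 / (of_real R - z)) \<longlongrightarrow> 0) at_top"
      by (intro tendsto_divide_0[OF tendsto_const]) simp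
    then have "((\<lambda>R. Re (z\<^sup>2 / (of_real R - z))) \<longlongrightarrow> Re 0) at_top" by (rule tendsto_Re)
    then have "((\<lambda>R. max K K' * exp (A * Re (z\<^sup>2 / (of_real R - z)))) \<longlongrightarrow> max K K' * exp (A * Re 0)) at_top"
      by (intro tendsto_mult tendsto_const tendsto_exp)
    then show "((\<lambda>R. max K K' * exp (A * Re (z\<^sup>2 / (of_real R - z)))) \<longlongrightarrow> max K K') at_top" by simp
    show "\<forall>\<^sub>F R in at_top. norm (g z) \<le> max K K' * exp (A * Re (z\<^sup>2 / (of_real R - z)))"
      using eventually_gt_at_top[of "Re z + 4 * \<bar>Im z\<bar>"] by eventually_elim (rule main)
  qed simp
qed

lemma wedge_bounded:
  fixes g :: "complex \<Rightarrow> complex"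
  assumes hol: "g holomorphic_on UNIV"
    and bd: "\<And>z. \<bar>Re z\<bar> \<le> 4 * \<bar>Im z\<bar> \<Longrightarrow> norm (g z) \<le> K"
    and gr: "\<And>z. Im z \<noteq> 0 \<Longrightarrow> norm (g z) \<le> K' * exp (C * ((norm z)\<^sup>2 / \<bar>Im z\<bar>))"
  shows "norm (g z) \<le> max K K'"
proof -
  consider "4 * \<bar>Im z\<bar> < Re z" | "4 * \<bar>Im z\<bar> < Re (- z)" | "\<bar>Re z\<bar> \<le> 4 * \<bar>Im z\<bar>" by fastforce
  then show ?thesis
  proof cases
    case 1 then show ?thesis by (rule wedge_bound[OF hol bd gr, rotated -1])
  next
    case 2
    have "(g \<circ> uminus) holomorphic_on UNIV"
      by (rule holomorphic_on_compose_gen[OF _ hol]) (auto intro!: holomorphic_intros)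
    then have hol': "(\<lambda>z. g (- z)) holomorphic_on UNIV" by (simp add: o_def)
    have "norm ((\<lambda>z. g (- z)) (- z)) \<le> max K K'"
    proof (rule wedge_bound[OF hol', where C = C])
      show "norm (g (- u)) \<le> K" if "\<bar>Re u\<bar> \<le> 4 * \<bar>Im u\<bar>" for u using bd[of "- u"] that by simp
      show "norm (g (- u)) \<le> K' * exp (C * ((norm u)\<^sup>2 / \<bar>Im u\<bar>))" if "Im u \<noteq> 0" for u
        using gr[of "- u"] that by simp
    qed (use 2 in simp)
    then show ?thesis by simp
  next
    case 3 then show ?thesis using bd[of z] by auto
  qed
qed

section \<open>The harmonic majorant of the weight\<close>

text \<open>The fraction acts as a switch at scale \<open>t\<close>: its real part is never negative
  and at least \<open>1/4\<close> beyond the scale, while below the scale it is only of size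
  \<open>norm u / t\<close>. Weighted sums over dyadic scales form the majorant.\<close>

lemma Re_half_plane_fraction:
  assumes u: "0 \<le> Re u" and t: "0 < t"
  shows "0 \<le> Re (u / (of_real t + u))"
    and "t \<le> norm u \<Longrightarrow> 1/4 \<le> Re (u / (of_real t + u))"
    and "norm (u / (of_real t + u)) \<le> 1"
    and "norm (u / (of_real t + u)) \<le> norm u / t"
proof -
  define N where "N = (norm (of_real t + u))\<^sup>2"
  have "Re (of_real t + u) \<ge> t" using u by simp
  then have nt: "norm (of_real t + u) \<ge> t" using complex_Re_le_cmod[of "of_real t + u"] by linarith
  have "0 < norm (of_real t + u)" using nt t by linarith
  then have N0: "N > 0" unfolding N_def by (rule zero_less_power)
  have eq: "Re (u / (of_real t + u)) = (t * Re u + (norm u)\<^sup>2) / N"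
  proof -
    have "u / (of_real t + u) = u * cnj (of_real t + u) / of_real N"
      unfolding N_def by (rule complex_div_cnj)
    moreover have "Re (u * cnj (of_real t + u)) = t * Re u + (norm u)\<^sup>2"
      unfolding cmod_power2 by (simp add: power2_eq_square algebra_simps)
    ultimately show ?thesis by (simp only: Re_divide_of_real)
  qed
  show "0 \<le> Re (u / (of_real t + u))" unfolding eq using u t N0 by simp
  have Nexp: "N = t\<^sup>2 + 2 * (t * Re u) + (norm u)\<^sup>2"
    unfolding N_def cmod_power2 by (simp add: power2_eq_square algebra_simps)
  show "1/4 \<le> Re (u / (of_real t + u))" if tu: "t \<le> norm u"
  proof -
    have "t\<^sup>2 \<le> (norm u)\<^sup>2" using tu t by (intro power_mono) auto
    moreover have "0 \<le> t * Re u" using u t by simp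
    ultimately have "N \<le> 4 * (t * Re u + (norm u)\<^sup>2)" 
      unfolding Nexp using zero_le_power2[of "norm u"] by (simp only: distrib_left)
    then show ?thesis unfolding eq using N0 by (simp add: field_simps)
  qed
  have "(norm u)\<^sup>2 \<le> N" unfolding Nexp using u t by simp
  then have "norm u \<le> norm (of_real t + u)" unfolding N_def by (rule power2_le_imp_le) simp
  then show "norm (u / (of_real t + u)) \<le> 1" using nt t by (simp add: norm_divide divide_le_eq_1)
  show "norm (u / (of_real t + u)) \<le> norm u / t"
    unfolding norm_divide using nt t by (intro frac_le) auto
qed

locale weight_seqs =
  fixes w :: "real \<Rightarrow> real" and a :: ereal and r c :: "nat \<Rightarrow> real"
  assumes weight: "weight w"
    and c_inc: "incseq c" and c_pos: "\<And>k. 0 < c k" and c_less: "\<And>k. ereal (c k) < a"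
    and c_lim: "(\<lambda>k. ereal (c k)) \<longlonglongrightarrow> a"
    and r_inc: "incseq r" and r_pos: "\<And>k. 0 < r k" and r_less: "\<And>k. r k < 1"
    and r_lim: "r \<longlonglongrightarrow> 1"
begin

lemma w_nonneg: "0 \<le> x \<Longrightarrow> 0 \<le> w x"
  using weight unfolding weight_def by blast

lemma w_mono: "0 \<le> x \<Longrightarrow> x \<le> y \<Longrightarrow> w x \<le> w y"
  using weight unfolding weight_def mono_on_def by auto

lemma w_small: "e > 0 \<Longrightarrow> \<exists>C\<ge>0. \<forall>x\<ge>0. w x \<le> C + e * x"
proof -
  assume e: "e > 0"
  have "w \<in> o[at_top](\<lambda>x. x)" using weight unfolding weight_def by blast
  from landau_o.smallD[OF this e] obtain X where X: "\<And>x. x \<ge> X \<Longrightarrow> norm (w x) \<le> e * norm x"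
    by (auto simp: eventually_at_top_linorder)
  have "w x \<le> w (max X 0) + e * x" if x: "x \<ge> 0" for x
  proof (cases "x \<ge> X")
    case True
    then show ?thesis using X[of x] x w_nonneg[of "max X 0"] by simp
  next
    case False
    then have "w x \<le> w (max X 0)" using x by (intro w_mono) auto
    moreover have "0 \<le> e * x" using e x by simp
    ultimately show ?thesis by linarith
  qed
  then show ?thesis using w_nonneg[of "max X 0"] by (intro exI[of _ "w (max X 0)"]) auto
qed

text \<open>By convexity of \<open>w \<circ> exp\<close>, the slope of \<open>w\<close> at \<open>x\<close> is at most \<open>w (e x) / x\<close>, hence bounded.\<close>

lemma w_shift1: "\<exists>C\<ge>0. \<forall>x\<ge>0. w (x + 1) \<le> w x + C"
proof -
  obtain D where D: "D \<ge> 0" "\<And>x. x \<ge> 0 \<Longrightarrow> w x \<le> D + 1 * x" using w_small[of 1] by auto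
  have cv: "convex_on {0..} (\<lambda>t. w (exp t))" using weight unfolding weight_def by blast
  define C where "C = w 2 + (D + exp 1 * 2)"
  have "w (x + 1) \<le> w x + C" if x: "x \<ge> 0" for x
  proof (cases "x < 1")
    case True
    then have "w (x + 1) \<le> w 2" using x by (intro w_mono) auto
    moreover have "0 \<le> D + exp 1 * 2" using D by simp
    ultimately show ?thesis using w_nonneg[OF x] unfolding C_def by linarith
  next
    case False
    then have x1: "x \<ge> 1" by simp
    define s where "s = ln (x + 1) - ln x"
    have s: "s = ln (1 + 1 / x)"
    proof -
      have "(x + 1) / x = 1 + 1 / x" using x1 by (simp add: field_simps)
      moreover have "s = ln ((x + 1) / x)" using x1 by (simp add: s_def ln_div)
      ultimately show ?thesis by simp
    qed
    have s0: "0 \<le> s" using s x1 by simp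
    have s1: "s \<le> 1 / x" using s ln_add_one_self_le_self[of "1/x"] x1 by simp
    have sle: "s \<le> 1" using s1 x1 divide_le_eq_1_pos[of x 1] by linarith
    have lx: "ln x \<ge> 0" using x1 by simp
    have "w (exp ((1 - s) *\<^sub>R ln x + s *\<^sub>R (ln x + 1))) \<le> (1 - s) * w (exp (ln x)) + s * w (exp (ln x + 1))"
      using s0 sle lx by (intro convex_onD[OF cv]) auto
    moreover have "(1 - s) *\<^sub>R ln x + s *\<^sub>R (ln x + 1) = ln (x + 1)"
      by (simp add: s_def algebra_simps)
    ultimately have "w (x + 1) \<le> (1 - s) * w x + s * w (exp (ln x + 1))"
      using x1 by simp
    also have "exp (ln x + 1) = exp 1 * x" using x1 by (simp add: exp_add)
    also have "(1 - s) * w x \<le> w x"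
      using s0 w_nonneg[OF x] by (simp add: mult_left_le_one_le algebra_simps)
    also have "s * w (exp 1 * x) \<le> (1 / x) * (D + exp 1 * x)"
      using D(2)[of "exp 1 * x"] D(1) s0 s1 x1 w_nonneg[of "exp 1 * x"] by (intro mult_mono) auto
    also have "(1 / x) * (D + exp 1 * x) = D / x + exp 1" using x1 by (simp add: field_simps)
    also have "D / x + exp 1 \<le> C"
    proof -
      have "D / x \<le> D" using x1 D by (simp add: divide_le_eq mult_left_le_one_le mult_le_cancel_left1)
      then show ?thesis unfolding C_def using w_nonneg[of 2] exp_gt_zero[of "1::real"] by linarith
    qed
    finally show ?thesis by simp
  qed
  moreover have "C \<ge> 0" unfolding C_def using w_nonneg[of 2] D by (simp add: add_nonneg_nonneg)
  ultimately show ?thesis by blast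
qed

lemma w_shift: "\<exists>C\<ge>0. \<forall>x\<ge>0. \<forall>y\<ge>0. \<bar>x - y\<bar> \<le> 2 \<longrightarrow> w x \<le> w y + C"
proof -
  obtain C where C: "C \<ge> 0" "\<And>x. x \<ge> 0 \<Longrightarrow> w (x + 1) \<le> w x + C" using w_shift1 by blast
  have "w x \<le> w y + 2 * C" if "x \<ge> 0" "y \<ge> 0" "\<bar>x - y\<bar> \<le> 2" for x y
  proof -
    have "w x \<le> w (y + 1 + 1)" using that by (intro w_mono) auto
    then show ?thesis using C(2)[of "y + 1"] C(2)[of y] that by simp
  qed
  then show ?thesis using C by (intro exI[of _ "2 * C"]) auto
qed

text \<open>By monotonicity the integrand on the dyadic interval \<open>I n\<close> is at least
  \<open>k n\<close>, and \<open>k n\<close> integrates there to a quarter of the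
  \<open>n\<close>-th term.\<close>

lemma w_dyadic_summable: "summable (\<lambda>n. w (2 ^ n) / 2 ^ n)"
proof -
  define f where "f = (\<lambda>x. indicat_real {1..} x *\<^sub>R (w x / x\<^sup>2))"
  have int: "integrable lborel f"
    using weight unfolding weight_def set_integrable_def f_def by blast
  define I where "I = (\<lambda>n::nat. {2 ^ n..<2 ^ Suc n :: real})"
  define k where "k = (\<lambda>n. w (2 ^ n) / (2 ^ Suc n)\<^sup>2)"
  have intI: "integrable lborel (\<lambda>x. indicat_real (I n) x * k n)" for n
    unfolding I_def by (intro integrable_mult_left) (simp add: integrable_real_indicator)
  have val: "(\<integral>x. indicat_real (I n) x * k n \<partial>lborel) = w (2 ^ n) / 2 ^ n / 4" for n
  proof -
    have "(\<integral>x. indicat_real (I n) x * k n \<partial>lborel) = measure lborel (I n) * k n"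
      by (simp add: I_def)
    also have "measure lborel (I n) = 2 ^ n" by (simp add: I_def)
    finally show ?thesis by (simp add: k_def power2_eq_square)
  qed
  have f0: "f x \<ge> 0" for x by (simp add: f_def indicator_def w_nonneg)
  have disj: "n = m" if "x \<in> I n" "x \<in> I m" for x n m
  proof (rule ccontr)
    assume "n \<noteq> m"
    then consider "Suc n \<le> m" | "Suc m \<le> n" by linarith
    then show False
    proof cases
      case 1
      then have "(2::real) ^ Suc n \<le> 2 ^ m" by (intro power_increasing) auto
      then show False using that unfolding I_def by simp
    next
      case 2
      then have "(2::real) ^ Suc m \<le> 2 ^ n" by (intro power_increasing) auto
      then show False using that unfolding I_def by simp
    qed
  qed
  have le: "(\<Sum>n<N. indicat_real (I n) x * k n) \<le> f x" for N x
  proof (cases "\<exists>m<N. x \<in> I m")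
    case False
    then have "(\<Sum>n<N. indicat_real (I n) x * k n) = 0" by (intro sum.neutral) (auto simp: indicator_def)
    then show ?thesis using f0 by simp
  next
    case True
    then obtain m where m: "m < N" "x \<in> I m" by blast
    have "(\<Sum>n<N. indicat_real (I n) x * k n) = (\<Sum>n<N. if n = m then k m else 0)"
      using disj m by (intro sum.cong) (auto simp: indicator_def)
    also have "\<dots> = k m" using m by simp
    also have "\<dots> \<le> w x / x\<^sup>2" unfolding k_def
    proof (rule frac_le)
      have x: "2 ^ m \<le> x" "x < 2 ^ Suc m" using m by (auto simp: I_def)
      have "(0::real) < 2 ^ m" by simp
      then have "0 < x" using x by linarith
      then show "0 < x\<^sup>2" "0 \<le> w x" using w_nonneg[of x] by auto
      show "w (2 ^ m) \<le> w x" using x by (intro w_mono) auto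
      show "x\<^sup>2 \<le> (2 ^ Suc m)\<^sup>2" using x \<open>0 < x\<close> by (intro power_mono) auto
    qed
    also have "\<dots> = f x"
    proof -
      have "(1::real) \<le> 2 ^ m" by simp
      moreover have "2 ^ m \<le> x" using m by (simp add: I_def)
      ultimately have "1 \<le> x" by linarith
      then show ?thesis by (simp add: f_def)
    qed
    finally show ?thesis .
  qed
  have "summable (\<lambda>n. w (2 ^ n) / 2 ^ n / 4)"
  proof (rule summableI_nonneg_bounded)
    show "0 \<le> w (2 ^ n) / 2 ^ n / 4" for n using w_nonneg[of "2 ^ n"] by simp
    fix N
    have "(\<Sum>n<N. w (2 ^ n) / 2 ^ n / 4) = (\<Sum>n<N. (\<integral>x. indicat_real (I n) x * k n \<partial>lborel))"
      by (simp only: val)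
    also have "\<dots> = (\<integral>x. (\<Sum>n<N. indicat_real (I n) x * k n) \<partial>lborel)"
      by (rule Bochner_Integration.integral_sum[symmetric]) (rule intI)
    also have "\<dots> \<le> (\<integral>x. f x \<partial>lborel)"
      by (rule integral_mono[OF Bochner_Integration.integrable_sum[OF intI] int le])
    finally show "(\<Sum>n<N. w (2 ^ n) / 2 ^ n / 4) \<le> (\<integral>x. f x \<partial>lborel)" .
  qed
  from summable_mult[OF this, of 4] show ?thesis by simp
qed

text \<open>The real parts of the terms are nonnegative on the upper half plane, and the term of the dyadic
  scale just below \<open>norm z\<close> alone already dominates \<open>w (norm z)\<close>.\<close>

definition maj_coeff :: "nat \<Rightarrow> real" where
  "maj_coeff n = 4 * w (2 ^ Suc n)"

definition maj_term :: "nat \<Rightarrow> complex \<Rightarrow> complex" where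
  "maj_term n z = of_real (maj_coeff n) * ((- \<i> * z) / (of_real (2 ^ n) + (- \<i> * z)))"

definition maj :: "complex \<Rightarrow> complex" where
  "maj z = (\<Sum>n. maj_term n z)"

lemma maj_coeff_nonneg: "0 \<le> maj_coeff n"
  using w_nonneg[of "2 ^ Suc n"] by (simp add: maj_coeff_def)

lemma maj_coeff_summable: "summable (\<lambda>n. maj_coeff n / 2 ^ n)"
proof -
  have "summable (\<lambda>n. w (2 ^ Suc n) / 2 ^ Suc n)"
    using w_dyadic_summable by (subst summable_Suc_iff)
  from summable_mult[OF this, of 8] show ?thesis by (simp add: maj_coeff_def)
qed

text \<open>The rotation \<open>- \<i> * z\<close> turns the upper half plane into the right one,
  where \<open>Re_half_plane_fraction\<close> applies. The factor \<open>4\<close> in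
  \<open>maj_coeff\<close> cancels the lower bound \<open>1/4\<close>.\<close>

lemma norm_maj_term_le:
  assumes "0 \<le> Im z"
  shows "norm (maj_term n z) \<le> maj_coeff n / 2 ^ n * norm z"
    and "norm (maj_term n z) \<le> maj_coeff n"
    and "0 \<le> Re (maj_term n z)"
    and "2 ^ n \<le> norm z \<Longrightarrow> w (2 ^ Suc n) \<le> Re (maj_term n z)"
proof -
  have u: "0 \<le> Re (- \<i> * z)" using assms by simp
  have t: "(0::real) < 2 ^ n" by simp
  note b = Re_half_plane_fraction[OF u t]
  have nu: "norm (- \<i> * z) = norm z" by (simp add: norm_mult)
  have "norm (maj_term n z) = maj_coeff n * norm ((- \<i> * z) / (of_real (2 ^ n) + (- \<i> * z)))"
    unfolding maj_term_def norm_mult using maj_coeff_nonneg[of n] by simp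
  moreover have "maj_coeff n * norm ((- \<i> * z) / (of_real (2 ^ n) + (- \<i> * z))) \<le> maj_coeff n * (norm z / 2 ^ n)"
    using b(4) maj_coeff_nonneg[of n] unfolding nu by (intro mult_left_mono)
  moreover have "maj_coeff n * norm ((- \<i> * z) / (of_real (2 ^ n) + (- \<i> * z))) \<le> maj_coeff n * 1"
    using b(3) maj_coeff_nonneg[of n] by (intro mult_left_mono)
  ultimately show "norm (maj_term n z) \<le> maj_coeff n / 2 ^ n * norm z" "norm (maj_term n z) \<le> maj_coeff n"
    by simp_all
  have Re: "Re (maj_term n z) = maj_coeff n * Re ((- \<i> * z) / (of_real (2 ^ n) + (- \<i> * z)))"
    unfolding maj_term_def by (simp only: Re_complex_of_real Im_complex_of_real times_complex.simps mult_zero_left diff_zero)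
  show "0 \<le> Re (maj_term n z)" unfolding Re using b(1) maj_coeff_nonneg[of n] by (rule mult_nonneg_nonneg[rotated])
  show "w (2 ^ Suc n) \<le> Re (maj_term n z)" if "2 ^ n \<le> norm z"
  proof -
    have "maj_coeff n * (1/4) \<le> maj_coeff n * Re ((- \<i> * z) / (of_real (2 ^ n) + (- \<i> * z)))"
      using b(2) maj_coeff_nonneg[of n] that unfolding nu by (intro mult_left_mono)
    then show ?thesis unfolding Re by (simp add: maj_coeff_def)
  qed
qed

lemma maj_term_summable:
  assumes "0 \<le> Im z" shows "summable (\<lambda>n. maj_term n z)"
proof (rule summable_comparison_test)
  show "\<exists>N. \<forall>n\<ge>N. norm (maj_term n z) \<le> maj_coeff n / 2 ^ n * norm z"
    using norm_maj_term_le(1)[OF assms] by blast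
  show "summable (\<lambda>n. maj_coeff n / 2 ^ n * norm z)"
    by (rule summable_mult2[OF maj_coeff_summable])
qed

lemma Re_maj_sums:
  assumes "0 \<le> Im z"
  shows "summable (\<lambda>n. Re (maj_term n z))" "Re (maj z) = (\<Sum>n. Re (maj_term n z))"
  using maj_term_summable[OF assms] unfolding maj_def
  by (auto intro: summable_Re Re_suminf)

lemma Re_maj_nonneg: "0 \<le> Im z \<Longrightarrow> 0 \<le> Re (maj z)"
  using Re_maj_sums norm_maj_term_le(3) by (simp add: suminf_nonneg)

lemma w_le_maj:
  assumes z: "0 \<le> Im z"
  shows "w (norm z) \<le> w 1 + Re (maj z)"
proof (cases "norm z < 1")
  case True
  then have "w (norm z) \<le> w 1" by (intro w_mono) auto
  then show ?thesis using Re_maj_nonneg[OF z] by simp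
next
  case False
  obtain k where "norm z < 2 ^ k" using real_arch_pow[of 2 "norm z"] by auto
  then have k: "norm z < 2 ^ (LEAST k. norm z < 2 ^ k)" by (rule LeastI)
  then have "(LEAST k. norm z < 2 ^ k) \<noteq> 0" using False by (metis power_0)
  then obtain n where Suc: "(LEAST k. norm z < 2 ^ k) = Suc n" using not0_implies_Suc by blast
  then have n: "2 ^ n \<le> norm z" "norm z < 2 ^ Suc n"
    using k not_less_Least[of n "\<lambda>k. norm z < 2 ^ k"] by auto
  have "w (norm z) \<le> w (2 ^ Suc n)" using n by (intro w_mono) auto
  also have "\<dots> \<le> Re (maj_term n z)" by (rule norm_maj_term_le(4)[OF z n(1)])
  also have "\<dots> = (\<Sum>m\<in>{n}. Re (maj_term m z))" by simp
  also have "\<dots> \<le> Re (maj z)" unfolding Re_maj_sums(2)[OF z]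
    by (rule sum_le_suminf[OF Re_maj_sums(1)[OF z]]) (auto intro: norm_maj_term_le(3)[OF z])
  finally show ?thesis using w_nonneg[of 1] by simp
qed

text \<open>Finitely many terms are bounded, and the tail grows at most like its coefficient sum
  times \<open>norm z\<close>. Here the convergence of the integral of the weight enters, through
  the summability of the coefficients.\<close>

lemma Re_maj_small:
  assumes e: "e > 0"
  shows "\<exists>C. \<forall>z. 0 \<le> Im z \<longrightarrow> Re (maj z) \<le> C + e * norm z"
proof -
  obtain N where N: "norm (\<Sum>n. maj_coeff (n + N) / 2 ^ (n + N)) < e"
    using suminf_exist_split[OF e maj_coeff_summable] by auto
  define C where "C = (\<Sum>n<N. maj_coeff n)"
  have "Re (maj z) \<le> C + e * norm z" if z: "0 \<le> Im z" for z
  proof -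
    have "Re (maj z) = (\<Sum>n. Re (maj_term (n + N) z)) + (\<Sum>n<N. Re (maj_term n z))"
      unfolding Re_maj_sums(2)[OF z] by (rule suminf_split_initial_segment[OF Re_maj_sums(1)[OF z]])
    moreover have "(\<Sum>n<N. Re (maj_term n z)) \<le> C"
      unfolding C_def
      by (rule sum_mono) (use norm_maj_term_le(2)[OF z] complex_Re_le_cmod order_trans in blast)
    moreover have "(\<Sum>n. Re (maj_term (n + N) z)) \<le> (\<Sum>n. maj_coeff (n + N) / 2 ^ (n + N) * norm z)"
    proof (rule suminf_le)
      show "Re (maj_term (n + N) z) \<le> maj_coeff (n + N) / 2 ^ (n + N) * norm z" for n
        using norm_maj_term_le(1)[OF z, of "n + N"] complex_Re_le_cmod[of "maj_term (n + N) z"] by linarith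
      show "summable (\<lambda>n. Re (maj_term (n + N) z))" using Re_maj_sums(1)[OF z] by (rule summable_ignore_initial_segment)
      show "summable (\<lambda>n. maj_coeff (n + N) / 2 ^ (n + N) * norm z)"
        using summable_ignore_initial_segment[OF maj_coeff_summable] by (rule summable_mult2)
    qed
    moreover have "(\<Sum>n. maj_coeff (n + N) / 2 ^ (n + N) * norm z) = (\<Sum>n. maj_coeff (n + N) / 2 ^ (n + N)) * norm z"
      using summable_ignore_initial_segment[OF maj_coeff_summable] by (rule suminf_mult2[symmetric])
    moreover have "(\<Sum>n. maj_coeff (n + N) / 2 ^ (n + N)) * norm z \<le> e * norm z"
      using N by (intro mult_right_mono) auto
    ultimately show ?thesis by linarith
  qed
  then show ?thesis by blast
qed

text \<open>The poles of the terms are the points \<open>- \<i> * 2 ^ n\<close>. A half plane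
  slightly larger than the upper one avoids them all, so that \<open>maj\<close> is continuous up to
  the real line.\<close>

lemma maj_holomorphic: "maj holomorphic_on {z. - (1/2) < Im z}"
proof (rule holomorphic_uniform_sequence)
  show op: "open {z. - (1/2) < Im z}" by (intro open_Collect_less continuous_intros)
  have ne: "norm (of_real (2 ^ n) + (- \<i> * z)) \<ge> 2 ^ n / 2" if "- (1/2) < Im z" for n z
  proof -
    have "(1::real) \<le> 2 ^ n" by simp
    moreover have "Re (of_real (2 ^ n) + (- \<i> * z)) = 2 ^ n + Im z" by simp
    ultimately have "2 ^ n / 2 \<le> Re (of_real (2 ^ n) + (- \<i> * z))" using that by linarith
    then show ?thesis using complex_Re_le_cmod order_trans by blast
  qed
  have nz: "of_real (2 ^ n) + (- \<i> * z) \<noteq> 0" if "- (1/2) < Im z" for n z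
    using ne[OF that, of n] by (metis half_gt_zero norm_zero not_less zero_less_numeral zero_less_power)
  show "(\<lambda>z. \<Sum>n<N. maj_term n z) holomorphic_on {z. - (1/2) < Im z}" for N
    unfolding maj_term_def by (intro holomorphic_intros) (use nz in blast)
  fix x :: complex assume "x \<in> {z. - (1/2) < Im z}"
  then obtain d where d: "d > 0" "cball x d \<subseteq> {z. - (1/2) < Im z}"
    using op open_contains_cball by blast
  have "uniform_limit (cball x d) (\<lambda>N z. \<Sum>n<N. maj_term n z) (\<lambda>z. \<Sum>n. maj_term n z) sequentially"
  proof (rule Weierstrass_m_test)
    fix n z assume z: "z \<in> cball x d"
    have Im: "- (1/2) < Im z" using d z by auto
    have "norm z \<le> norm x + d" using z norm_triangle_ineq2[of z x]
      by (simp add: dist_norm norm_minus_commute)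
    then have "norm ((- \<i> * z) / (of_real (2 ^ n) + (- \<i> * z))) \<le> (norm x + d) / (2 ^ n / 2)"
      unfolding norm_divide using ne[OF Im, of n] d by (intro frac_le) (auto simp: norm_mult)
    then have "maj_coeff n * norm ((- \<i> * z) / (of_real (2 ^ n) + (- \<i> * z))) \<le> maj_coeff n * ((norm x + d) / (2 ^ n / 2))"
      using maj_coeff_nonneg[of n] by (rule mult_left_mono)
    moreover have "norm (maj_term n z) = maj_coeff n * norm ((- \<i> * z) / (of_real (2 ^ n) + (- \<i> * z)))"
      unfolding maj_term_def norm_mult using maj_coeff_nonneg[of n] by simp
    ultimately have "norm (maj_term n z) \<le> maj_coeff n * ((norm x + d) / (2 ^ n / 2))" by linarith
    also have "\<dots> = maj_coeff n / 2 ^ n * (2 * (norm x + d))" by simp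
    finally show "norm (maj_term n z) \<le> maj_coeff n / 2 ^ n * (2 * (norm x + d))" .
  next
    show "summable (\<lambda>n. maj_coeff n / 2 ^ n * (2 * (norm x + d)))"
      by (rule summable_mult2[OF maj_coeff_summable])
  qed
  then show "\<exists>d>0. cball x d \<subseteq> {z. - (1/2) < Im z} \<and>
      uniform_limit (cball x d) (\<lambda>N z. \<Sum>n<N. maj_term n z) maj sequentially"
    using d unfolding maj_def by blast
qed

end

lemma entire_zero_of_zero_on_open:
  fixes f :: "complex \<Rightarrow> complex"
  assumes "f holomorphic_on UNIV" "open S" "u \<in> S" "\<And>z. z \<in> S \<Longrightarrow> f z = 0"
  shows "f z = 0"
  by (rule analytic_continuation_open[of S UNIV f "\<lambda>_. 0"]) (use assms in auto)

section \<open>Half-plane growth of the functions in one step of the space\<close>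

context weight_seqs
begin

definition W :: "nat \<Rightarrow> complex \<Rightarrow> real" where
  "W k z = exp (r k * w (norm z) + c k * \<bar>Im z\<bar>)"

definition entire_le :: "nat \<Rightarrow> real \<Rightarrow> (complex \<Rightarrow> complex) \<Rightarrow> bool" where
  "entire_le k M f \<longleftrightarrow> f holomorphic_on UNIV \<and> (\<forall>z. norm (f z) \<le> M * W k z)"

lemma entire_leD: "entire_le k M f \<Longrightarrow> f holomorphic_on UNIV" "entire_le k M f \<Longrightarrow> norm (f z) \<le> M * W k z"
  by (auto simp: entire_le_def)

lemma W_pos [simp]: "0 < W k z" by (simp add: W_def)

lemma W_ge_1: "1 \<le> W k z"
  unfolding W_def using r_pos[of k] c_pos[of k] w_nonneg[of "norm z"] by simp

lemma entire_le_nonneg: "entire_le k M f \<Longrightarrow> 0 \<le> M"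
  using entire_leD(2)[of k M f 0] W_pos[of k 0] norm_ge_zero[of "f 0"]
  by (meson order_trans zero_le_mult_iff not_less)

lemma W_mono: "k \<le> k' \<Longrightarrow> W k z \<le> W k' z"
  unfolding W_def exp_le_cancel_iff
  using incseqD[OF r_inc, of k k'] incseqD[OF c_inc, of k k'] w_nonneg[of "norm z"]
  by (intro add_mono mult_right_mono) auto

lemma entire_le_mono: "entire_le k M f \<Longrightarrow> k \<le> k' \<Longrightarrow> M \<le> M' \<Longrightarrow> entire_le k' M' f"
  using entire_le_nonneg[of k M f] W_mono[of k k'] W_pos[THEN less_imp_le]
  unfolding entire_le_def by (meson mult_mono order_trans)

text \<open>That the weight varies by a bounded factor over distance \<open>2\<close>, uniformly in
  the plane, is what makes division by a linear factor harmless in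
  \<open>diff_quot_le\<close>.\<close>

lemma W_shift: "\<exists>C\<ge>1. \<forall>u z. norm (u - z) \<le> 2 \<longrightarrow> W k u \<le> C * W k z"
proof -
  obtain D where D: "D \<ge> 0" "\<And>x y. x \<ge> 0 \<Longrightarrow> y \<ge> 0 \<Longrightarrow> \<bar>x - y\<bar> \<le> 2 \<Longrightarrow> w x \<le> w y + D"
    using w_shift by blast
  define C where "C = exp (r k * D + c k * 2)"
  have "C \<ge> 1" using r_pos[of k] c_pos[of k] D by (simp add: C_def)
  moreover have "W k u \<le> C * W k z" if uz: "norm (u - z) \<le> 2" for u z
  proof -
    have "\<bar>norm u - norm z\<bar> \<le> 2" using norm_triangle_ineq3[of u z] uz by linarith
    then have "r k * w (norm u) \<le> r k * (w (norm z) + D)" using D(2) r_pos[of k] by (intro mult_left_mono) auto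
    moreover have "\<bar>Im u - Im z\<bar> \<le> 2" using abs_Im_le_cmod[of "u - z"] uz by simp
    then have "c k * \<bar>Im u\<bar> \<le> c k * (\<bar>Im z\<bar> + 2)" using c_pos[of k] by (intro mult_left_mono) auto
    ultimately have "r k * w (norm u) + c k * \<bar>Im u\<bar> \<le> (r k * D + c k * 2) + (r k * w (norm z) + c k * \<bar>Im z\<bar>)"
      by (simp add: distrib_left)
    then show ?thesis unfolding W_def C_def by (simp flip: exp_add)
  qed
  ultimately show ?thesis by blast
qed

lemma W_exp_type: "\<exists>A\<ge>0. \<forall>z. W k z \<le> A * exp ((1 + c k) * norm z)"
proof -
  obtain D where D: "D \<ge> 0" "\<And>x. x \<ge> 0 \<Longrightarrow> w x \<le> D + 1 * x" using w_small[of 1] by auto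
  have "W k z \<le> exp D * exp ((1 + c k) * norm z)" for z
  proof -
    have "r k * w (norm z) \<le> 1 * w (norm z)" using r_less[of k] w_nonneg[of "norm z"] by (intro mult_right_mono) auto
    moreover have "c k * \<bar>Im z\<bar> \<le> c k * norm z" using c_pos[of k] abs_Im_le_cmod[of z] by (intro mult_left_mono) auto
    ultimately show ?thesis using D(2)[of "norm z"] unfolding W_def by (simp add: distrib_right flip: exp_add)
  qed
  then show ?thesis by (intro exI[of _ "exp D"]) auto
qed

lemma W_real_le:
  assumes "Im z = 0" shows "W k z \<le> exp (w 1) * exp (Re (maj z))"
proof -
  have "r k * w (norm z) \<le> 1 * w (norm z)" using r_less[of k] w_nonneg[of "norm z"] by (intro mult_right_mono) auto
  then show ?thesis using w_le_maj[of z] assms unfolding W_def by (simp flip: exp_add)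
qed

text \<open>After multiplication by \<open>exp (- maj z + \<i> * h * z)\<close> the function is
  bounded on the real line by the majorant property and on the imaginary half axis by its type, so
  the half-plane principle applies. The resulting constant does not involve
  \<open>A\<close>.\<close>

lemma half_plane_bound:
  assumes f: "entire_le k M f" and im: "\<And>y. 0 \<le> y \<Longrightarrow> norm (f (\<i> * of_real y)) \<le> A * exp (h * y)"
    and z: "0 \<le> Im z"
  shows "norm (f z) \<le> M * exp (w 1) * exp (Re (maj z) + h * Im z)"
proof -
  define g where "g = (\<lambda>z. f z * exp (- maj z + \<i> * of_real h * z))"
  have ng: "norm (g u) = norm (f u) * exp (- (Re (maj u) + h * Im u))" for u
    by (simp add: g_def norm_mult)
  have M0: "M \<ge> 0" using entire_le_nonneg[OF f] .
  have holmaj: "maj holomorphic_on {z. 0 \<le> Im z}"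
    by (rule holomorphic_on_subset[OF maj_holomorphic]) auto
  have holg: "g holomorphic_on {z. 0 \<le> Im z}" unfolding g_def
    by (intro holomorphic_intros holmaj holomorphic_on_subset[OF entire_leD(1)[OF f]]) auto
  obtain B where B: "B \<ge> 0" "\<And>z. W k z \<le> B * exp ((1 + c k) * norm z)" using W_exp_type by blast
  have "norm (g z) \<le> M * exp (w 1)"
  proof (rule Phragmen_Lindelof_half_plane[where f = g and z = z and K = "M * exp (w 1)" and M = A and A = "M * B" and B = "1 + c k + \<bar>h\<bar>"])
    show "continuous_on {z. 0 \<le> Im z} g" using holg by (rule holomorphic_on_imp_continuous_on)
    show "g holomorphic_on {z. 0 < Im z}" by (rule holomorphic_on_subset[OF holg]) auto
  next
    fix u :: complex assume u: "Im u = 0"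
    have "norm (f u) \<le> M * W k u" using entire_leD(2)[OF f] .
    also have "\<dots> \<le> M * (exp (w 1) * exp (Re (maj u)))" using W_real_le[OF u] M0 by (rule mult_left_mono)
    finally have "norm (g u) \<le> M * (exp (w 1) * exp (Re (maj u))) * exp (- (Re (maj u) + h * Im u))"
      unfolding ng by (rule mult_right_mono) simp
    also have "\<dots> = M * exp (w 1)" using u by (simp add: exp_minus)
    finally show "norm (g u) \<le> M * exp (w 1)" .
  next
    fix u :: complex assume u: "Re u = 0" "0 \<le> Im u"
    have "u = \<i> * of_real (Im u)" using u by (simp add: complex_eq_iff)
    then have fu: "norm (f u) \<le> A * exp (h * Im u)" using im[OF u(2)] by simp
    have "0 \<le> A * exp (h * Im u)" using order_trans[OF norm_ge_zero fu] .
    then have "norm (g u) \<le> A * exp (h * Im u) * exp (- (h * Im u))"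
      unfolding ng using fu Re_maj_nonneg[OF u(2)] by (intro mult_mono) auto
    then show "norm (g u) \<le> A" by (simp add: mult.assoc flip: exp_add)
  next
    fix u :: complex assume u: "0 \<le> Im u"
    have "norm (f u) \<le> M * W k u" using entire_leD(2)[OF f] .
    also have "\<dots> \<le> M * (B * exp ((1 + c k) * norm u))" using B(2) M0 by (rule mult_left_mono)
    finally have 1: "norm (f u) \<le> M * B * exp ((1 + c k) * norm u)" by simp
    have "- (h * Im u) \<le> \<bar>h\<bar> * norm u"
    proof -
      have "- (h * Im u) \<le> \<bar>h * Im u\<bar>" by linarith
      also have "\<dots> \<le> \<bar>h\<bar> * norm u" unfolding abs_mult using abs_Im_le_cmod[of u] by (intro mult_left_mono) auto
      finally show ?thesis .
    qed
    then have "exp (- (Re (maj u) + h * Im u)) \<le> exp (\<bar>h\<bar> * norm u)" using Re_maj_nonneg[OF u] by simp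
    then have "norm (g u) \<le> M * B * exp ((1 + c k) * norm u) * exp (\<bar>h\<bar> * norm u)"
      unfolding ng using 1 M0 B(1) by (intro mult_mono) auto
    then show "norm (g u) \<le> M * B * exp ((1 + c k + \<bar>h\<bar>) * norm u)"
      by (simp add: mult.assoc distrib_right flip: exp_add)
  qed (use z in auto)
  then have "norm (g z) * exp (Re (maj z) + h * Im z) \<le> M * exp (w 1) * exp (Re (maj z) + h * Im z)"
    by (rule mult_right_mono) simp
  then show ?thesis unfolding ng by (simp add: mult.assoc flip: exp_add)
qed

text \<open>Since the constant in \<open>half_plane_bound\<close> is independent of
  \<open>A\<close>, \<open>h\<close> can be sent to minus infinity in that bound.\<close>

lemma eq_zero_of_fast_decay:
  assumes f: "entire_le k M f"
    and im: "\<And>h. \<exists>A. \<forall>y\<ge>0. norm (f (\<i> * of_real y)) \<le> A * exp (h * y)"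
  shows "f z = 0"
proof (rule entire_zero_of_zero_on_open[OF entire_leD(1)[OF f], of "{z. 0 < Im z}" \<i>])
  fix u :: complex assume "u \<in> {z. 0 < Im z}"
  then have u: "0 < Im u" by simp
  have le: "norm (f u) \<le> M * exp (w 1) * exp (Re (maj u) + h * Im u)" for h
    using half_plane_bound[OF f, of _ h u] im[of h] u by auto
  have "((\<lambda>h. M * exp (w 1) * exp (Re (maj u) + h * Im u)) \<longlongrightarrow> M * exp (w 1) * 0) at_bot"
  proof (intro tendsto_mult tendsto_const)
    have "((\<lambda>h. exp (p + h * q)) \<longlongrightarrow> 0) at_bot" if "q > 0" for p q :: real
      using that by real_asymp
    then show "((\<lambda>h. exp (Re (maj u) + h * Im u)) \<longlongrightarrow> 0) at_bot" using u .
  qed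
  then have "norm (f u) \<le> M * exp (w 1) * 0"
    by (rule tendsto_lowerbound) (auto simp: le trivial_limit_at_bot_linorder)
  then show "f u = 0" by simp
qed (auto intro!: open_Collect_less continuous_intros)

text \<open>Dividing \<open>F\<close> and \<open>f\<close> by the common majorant makes both bounded
  by \<open>1\<close>, and a single point of the imaginary axis where \<open>f\<close> is large
  feeds \<open>half_plane_quotient\<close>. The height \<open>y\<close> cancels from the exponent;
  \<open>norm (z + \<i> * y)\<close> is at most \<open>2 * norm z\<close> outside the disc of radius
  \<open>y\<close>, which gives \<open>16 = 4 * 4\<close>, and inside the disc compactness
  suffices.\<close>

lemma quotient_growth:
  assumes e: "e > 0" and hol: "F holomorphic_on UNIV" "f holomorphic_on UNIV" "g holomorphic_on UNIV"
    and eq: "\<And>z. F z = f z * g z"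
    and bd: "\<And>z. 0 \<le> Im z \<Longrightarrow> norm (F z) \<le> A * exp (Re (maj z) + (h + e) * Im z)"
      "\<And>z. 0 \<le> Im z \<Longrightarrow> norm (f z) \<le> A * exp (Re (maj z) + (h + e) * Im z)"
    and big: "\<And>Y. \<exists>y\<ge>Y. exp ((h - e) * y) \<le> norm (f (\<i> * of_real y))"
  shows "\<exists>K. \<forall>z. 0 < Im z \<longrightarrow> norm (g z) \<le> K * exp (16 * e * ((norm z)\<^sup>2 / Im z))"
proof -
  have A0: "A > 0"
  proof -
    obtain y where y: "y \<ge> 0" "exp ((h - e) * y) \<le> norm (f (\<i> * of_real y))" using big[of 0] by blast
    have "0 < norm (f (\<i> * of_real y))" using y(2) exp_gt_zero[of "(h - e) * y"] by linarith
    also have "\<dots> \<le> A * exp (Re (maj (\<i> * of_real y)) + (h + e) * Im (\<i> * of_real y))" using y(1) by (intro bd) simp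
    finally show ?thesis by (simp add: zero_less_mult_iff)
  qed
  obtain D where D: "\<And>z. 0 \<le> Im z \<Longrightarrow> Re (maj z) \<le> D + e * norm z" using Re_maj_small[OF e] by blast
  \<comment> \<open>Beyond \<open>Y\<close> the majorant and the constant \<open>A\<close> together
    cost at most \<open>2 * e * y\<close>. The gap between \<open>h - e\<close> and
    \<open>h + e\<close> costs as much again, which explains \<open>4 * e * y\<close> below.\<close>
  define Y where "Y = max 1 ((D + ln A) / e)"
  obtain y where y: "y \<ge> Y" "exp ((h - e) * y) \<le> norm (f (\<i> * of_real y))" using big[of Y] by blast
  have y1: "y \<ge> 1" "(D + ln A) / e \<le> y" using y(1) by (auto simp: Y_def)
  then have Dy: "D + ln A \<le> e * y" using e by (simp add: divide_le_eq mult.commute)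
  define q where "q = (\<lambda>z. exp (- maj z + \<i> * of_real (h + e) * z - of_real (ln A)))"
  have nq: "norm (q u) = exp (- (Re (maj u) + (h + e) * Im u)) / A" for u
  proof -
    have "Re (- maj u + \<i> * of_real (h + e) * u - of_real (ln A)) = - (Re (maj u) + (h + e) * Im u) - ln A"
      by simp
    then show ?thesis using A0 unfolding q_def norm_exp_eq_Re by (simp only: exp_diff exp_ln)
  qed
  have holq: "q holomorphic_on {z. 0 < Im z}" unfolding q_def
    by (intro holomorphic_intros holomorphic_on_subset[OF maj_holomorphic]) auto
  have n1: "norm (F' u * q u) \<le> 1" if "norm (F' u) \<le> A * exp (Re (maj u) + (h + e) * Im u)" for F' u
  proof -
    have "norm (F' u * q u) \<le> A * exp (Re (maj u) + (h + e) * Im u) * (exp (- (Re (maj u) + (h + e) * Im u)) / A)"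
      unfolding norm_mult nq using that A0 by (intro mult_right_mono) auto
    also have "\<dots> = 1" using A0 by (simp flip: exp_add)
    finally show ?thesis .
  qed
  have fy: "exp (- (4 * e * y)) \<le> norm ((\<lambda>z. f z * q z) (\<i> * of_real y))"
  proof -
    have "Re (maj (\<i> * of_real y)) \<le> D + e * y" using D[of "\<i> * of_real y"] y1 by (simp add: norm_mult)
    then have "- (4 * e * y) \<le> (h - e) * y + (- (Re (maj (\<i> * of_real y)) + (h + e) * y)) - ln A"
      using Dy by (simp add: algebra_simps)
    then have "exp (- (4 * e * y)) \<le> exp ((h - e) * y + (- (Re (maj (\<i> * of_real y)) + (h + e) * y)) - ln A)" by simp
    also have "\<dots> = exp ((h - e) * y) * (exp (- (Re (maj (\<i> * of_real y)) + (h + e) * y)) / A)"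
      using A0 by (simp only: exp_diff exp_add) simp
    also have "\<dots> \<le> norm (f (\<i> * of_real y)) * (exp (- (Re (maj (\<i> * of_real y)) + (h + e) * y)) / A)"
      using y(2) A0 by (intro mult_right_mono) auto
    also have "\<dots> = norm ((\<lambda>z. f z * q z) (\<i> * of_real y))" by (simp add: norm_mult nq)
    finally show ?thesis .
  qed
  have up: "norm (g z) \<le> exp (4 * e * y * ((norm (z + \<i> * of_real y))\<^sup>2 / (Im z * y)))" if z: "0 < Im z" for z
  proof (rule half_plane_quotient[where F = "\<lambda>z. F z * q z" and f = "\<lambda>z. f z * q z"])
    show "(\<lambda>z. F z * q z) holomorphic_on {z. 0 < Im z}" "(\<lambda>z. f z * q z) holomorphic_on {z. 0 < Im z}"
      "g holomorphic_on {z. 0 < Im z}"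
      using hol holq by (auto intro!: holomorphic_intros intro: holomorphic_on_subset)
    show "norm (F z * q z) \<le> 1" if "0 < Im z" for z using n1[of F z, OF bd(1)] that by simp
    show "norm (f z * q z) \<le> 1" if "0 < Im z" for z using n1[of f z, OF bd(2)] that by simp
    show "F z * q z = f z * q z * g z" for z by (simp add: eq)
  qed (use y1 e z fy in auto)
  obtain B where B: "\<And>z. norm z \<le> y \<Longrightarrow> norm (g z) \<le> B"
  proof -
    have "compact (g ` cball 0 y)" using hol(3)
      by (intro compact_continuous_image) (auto intro: holomorphic_on_imp_continuous_on holomorphic_on_subset)
    then obtain B where "\<forall>x\<in>g ` cball 0 y. norm x \<le> B"
      using compact_imp_bounded bounded_iff by metis
    then show ?thesis by (intro that[of B]) auto
  qed
  have B0: "B \<ge> 0" using order_trans[OF norm_ge_zero B[of 0]] y1 by simp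
  have "norm (g z) \<le> (B + 1) * exp (16 * e * ((norm z)\<^sup>2 / Im z))" if z: "0 < Im z" for z
  proof (cases "norm z \<le> y")
    case True
    have "0 \<le> 16 * e * ((norm z)\<^sup>2 / Im z)" using z e by simp
    then have "1 \<le> exp (16 * e * ((norm z)\<^sup>2 / Im z))" by simp
    then have "(B + 1) * 1 \<le> (B + 1) * exp (16 * e * ((norm z)\<^sup>2 / Im z))" using B0 by (intro mult_left_mono) auto
    moreover have "norm (g z) \<le> (B + 1) * 1" using B[OF True] by simp
    ultimately show ?thesis by (rule order_trans[rotated])
  next
    case False
    have "norm (z + \<i> * of_real y) \<le> norm z + y" using norm_triangle_ineq[of z "\<i> * of_real y"] y1 by (simp add: norm_mult)
    also have "\<dots> \<le> 2 * norm z" using False by simp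
    finally have "(norm (z + \<i> * of_real y))\<^sup>2 \<le> (2 * norm z)\<^sup>2" by (intro power_mono) auto
    then have "4 * e / Im z * (norm (z + \<i> * of_real y))\<^sup>2 \<le> 4 * e / Im z * (2 * norm z)\<^sup>2"
      using e z by (intro mult_left_mono) auto
    moreover have "4 * e * y * ((norm (z + \<i> * of_real y))\<^sup>2 / (Im z * y)) = 4 * e / Im z * (norm (z + \<i> * of_real y))\<^sup>2"
      using y1 by simp
    moreover have "4 * e / Im z * (2 * norm z)\<^sup>2 = 16 * e * ((norm z)\<^sup>2 / Im z)" by (simp add: power2_eq_square)
    ultimately have "4 * e * y * ((norm (z + \<i> * of_real y))\<^sup>2 / (Im z * y)) \<le> 16 * e * ((norm z)\<^sup>2 / Im z)"
      by (simp only:)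
    then have "exp (4 * e * y * ((norm (z + \<i> * of_real y))\<^sup>2 / (Im z * y))) \<le> exp (16 * e * ((norm z)\<^sup>2 / Im z))"
      by (simp only: exp_le_cancel_iff)
    with up[OF z] have "norm (g z) \<le> exp (16 * e * ((norm z)\<^sup>2 / Im z))" by (rule order_trans)
    also have "\<dots> \<le> (B + 1) * exp (16 * e * ((norm z)\<^sup>2 / Im z))" using B0 by simp
    finally show ?thesis .
  qed
  then show ?thesis by blast
qed

end

section \<open>Separation by functionals\<close>

definition real_subspace :: "('b \<Rightarrow> complex) set \<Rightarrow> bool" where
  "real_subspace E \<longleftrightarrow> (\<lambda>_. 0) \<in> E \<and> (\<forall>x\<in>E. \<forall>y\<in>E. (\<lambda>z. x z + y z) \<in> E) \<and>
     (\<forall>x\<in>E. \<forall>t::real. (\<lambda>z. of_real t * x z) \<in> E)"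

definition sublinear_on :: "('b \<Rightarrow> complex) set \<Rightarrow> (('b \<Rightarrow> complex) \<Rightarrow> real) \<Rightarrow> bool" where
  "sublinear_on E q \<longleftrightarrow> (\<forall>x\<in>E. \<forall>y\<in>E. q (\<lambda>z. x z + y z) \<le> q x + q y) \<and>
     (\<forall>x\<in>E. \<forall>t>0. q (\<lambda>z. of_real t * x z) = t * q x) \<and> q (\<lambda>_. 0) = 0"

lemma real_subspaceD:
  assumes "real_subspace E"
  shows "(\<lambda>_. 0) \<in> E" "x \<in> E \<Longrightarrow> y \<in> E \<Longrightarrow> (\<lambda>z. x z + y z) \<in> E"
    "x \<in> E \<Longrightarrow> (\<lambda>z. of_real t * x z) \<in> E" "x \<in> E \<Longrightarrow> (\<lambda>z. - x z) \<in> E"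
proof -
  show "x \<in> E \<Longrightarrow> (\<lambda>z. of_real t * x z) \<in> E" for t x using assms by (auto simp: real_subspace_def)
  from this[of x "-1"] show "x \<in> E \<Longrightarrow> (\<lambda>z. - x z) \<in> E" by simp
qed (use assms in \<open>auto simp: real_subspace_def\<close>)

lemma sublinear_onD:
  assumes "sublinear_on E q"
  shows "x \<in> E \<Longrightarrow> y \<in> E \<Longrightarrow> q (\<lambda>z. x z + y z) \<le> q x + q y"
    "x \<in> E \<Longrightarrow> t > 0 \<Longrightarrow> q (\<lambda>z. of_real t * x z) = t * q x" "q (\<lambda>_. 0) = 0"
  using assms by (auto simp: sublinear_on_def)

lemma sublinear_on_minus:
  assumes "sublinear_on E q" "real_subspace E" "x \<in> E"
  shows "- q (\<lambda>z. - x z) \<le> q x"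
  using sublinear_onD(1)[OF assms(1,3) real_subspaceD(4)[OF assms(2,3)]] sublinear_onD(3)[OF assms(1)]
  by simp

text \<open>The infimum over a convex cone of pairs lowers \<open>q\<close> just enough to respect
  all constraints \<open>(k, s)\<close>; the condition \<open>s \<le> q k\<close> keeps it finite.
  One choice of cone makes minimal functionals additive, another imposes the values in the
  separation theorem.\<close>

lemma sublinear_on_cone_Inf:
  fixes q :: "('b \<Rightarrow> complex) \<Rightarrow> real"
  assumes E: "real_subspace E" and q: "sublinear_on E q"
    and K: "\<And>k s. (k, s) \<in> K \<Longrightarrow> k \<in> E \<and> s \<le> q k" and K0: "((\<lambda>_. 0), 0) \<in> K"
    and Kadd: "\<And>k s k' s'. (k, s) \<in> K \<Longrightarrow> (k', s') \<in> K \<Longrightarrow> ((\<lambda>z. k z + k' z), s + s') \<in> K"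
    and Kscale: "\<And>k s t. (k, s) \<in> K \<Longrightarrow> t > 0 \<Longrightarrow> ((\<lambda>z. of_real t * k z), t * s) \<in> K"
  obtains q' where "sublinear_on E q'" "\<And>x. x \<in> E \<Longrightarrow> q' x \<le> q x"
    "\<And>x k s. x \<in> E \<Longrightarrow> (k, s) \<in> K \<Longrightarrow> q' x \<le> q (\<lambda>z. x z + k z) - s"
proof -
  define v where "v = (\<lambda>x (k, s). q (\<lambda>z. x z + k z) - s)"
  define q' where "q' = (\<lambda>x. INF p\<in>K. v x p)"
  have lower: "- q (\<lambda>z. - x z) \<le> v x p" if x: "x \<in> E" and p: "p \<in> K" for x p
  proof (cases p)
    case (Pair k s)
    have k: "k \<in> E" "s \<le> q k" using K p Pair by auto
    have "q (\<lambda>z. (x z + k z) + - x z) \<le> q (\<lambda>z. x z + k z) + q (\<lambda>z. - x z)"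
      by (rule sublinear_onD(1)[OF q]) (use real_subspaceD[OF E] x k in auto)
    then show ?thesis using k by (simp add: v_def Pair)
  qed
  have bdd: "bdd_below (v x ` K)" if "x \<in> E" for x
    using lower[OF that] by (intro bdd_belowI[of _ "- q (\<lambda>z. - x z)"]) auto
  have ne: "K \<noteq> {}" using K0 by blast
  have up: "q' x \<le> v x p" if "x \<in> E" "p \<in> K" for x p
    unfolding q'_def by (rule cINF_lower[OF bdd]) (use that in auto)
  have great: "u \<le> q' x" if "\<And>p. p \<in> K \<Longrightarrow> u \<le> v x p" for u x
    unfolding q'_def by (rule cINF_greatest[OF ne that])
  have add: "q' (\<lambda>z. x z + y z) \<le> q' x + q' y" if x: "x \<in> E" and y: "y \<in> E" for x y
  proof -
    have 1: "q' (\<lambda>z. x z + y z) \<le> v x p + v y p'" if p: "p \<in> K" and p': "p' \<in> K" for p p'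
    proof (cases p, cases p')
      fix k s k' s' assume eq: "p = (k, s)" "p' = (k', s')"
      have k: "k \<in> E" "k' \<in> E" using K p p' eq by auto
      have "q' (\<lambda>z. x z + y z) \<le> v (\<lambda>z. x z + y z) ((\<lambda>z. k z + k' z), s + s')"
        by (rule up) (use real_subspaceD[OF E] x y Kadd p p' eq in auto)
      also have "\<dots> = q (\<lambda>z. (x z + k z) + (y z + k' z)) - (s + s')" by (simp add: v_def algebra_simps)
      also have "\<dots> \<le> q (\<lambda>z. x z + k z) + q (\<lambda>z. y z + k' z) - (s + s')"
        using sublinear_onD(1)[OF q, of "\<lambda>z. x z + k z" "\<lambda>z. y z + k' z"] real_subspaceD(2)[OF E] x y k by auto
      finally show ?thesis by (simp add: v_def eq)
    qed
    have 2: "q' (\<lambda>z. x z + y z) - v y p' \<le> q' x" if "p' \<in> K" for p'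
    proof (rule great)
      fix p assume "p \<in> K"
      from 1[OF this that] show "q' (\<lambda>z. x z + y z) - v y p' \<le> v x p" by linarith
    qed
    have "q' (\<lambda>z. x z + y z) - q' x \<le> q' y"
    proof (rule great)
      fix p assume "p \<in> K"
      from 2[OF this] show "q' (\<lambda>z. x z + y z) - q' x \<le> v y p" by linarith
    qed
    then show ?thesis by simp
  qed
  have scale1: "q' (\<lambda>z. of_real t * x z) \<le> t * q' x" if x: "x \<in> E" and t: "t > 0" for x t
  proof -
    have "q' (\<lambda>z. of_real t * x z) / t \<le> q' x"
    proof (rule great)
      fix p assume p: "p \<in> K"
      obtain k s where eq: "p = (k, s)" by (cases p)
      have k: "k \<in> E" using K p eq by auto
      have "q' (\<lambda>z. of_real t * x z) \<le> v (\<lambda>z. of_real t * x z) ((\<lambda>z. of_real t * k z), t * s)"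
        by (rule up) (use real_subspaceD[OF E] x Kscale p t eq in auto)
      also have "\<dots> = q (\<lambda>z. of_real t * (x z + k z)) - t * s" by (simp add: v_def algebra_simps)
      also have "\<dots> = t * v x p"
        using sublinear_onD(2)[OF q, of "\<lambda>z. x z + k z" t] real_subspaceD(2)[OF E] x k t
        by (simp add: v_def eq algebra_simps)
      finally show "q' (\<lambda>z. of_real t * x z) / t \<le> v x p" using t by (simp add: divide_le_eq mult.commute)
    qed
    then show ?thesis using t by (simp add: divide_le_eq mult.commute)
  qed
  have scale: "q' (\<lambda>z. of_real t * x z) = t * q' x" if x: "x \<in> E" and t: "t > 0" for x t
  proof (rule antisym[OF scale1[OF x t]])
    have "q' (\<lambda>z. of_real (1/t) * (of_real t * x z)) \<le> (1/t) * q' (\<lambda>z. of_real t * x z)"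
      by (rule scale1) (use real_subspaceD[OF E] x t in auto)
    moreover have "(\<lambda>z. of_real (1/t) * (of_real t * x z)) = x" using t by (auto simp: fun_eq_iff)
    ultimately show "t * q' x \<le> q' (\<lambda>z. of_real t * x z)" using t by (simp add: field_simps)
  qed
  have zero: "q' (\<lambda>_. 0) = 0"
  proof (rule antisym)
    show "q' (\<lambda>_. 0) \<le> 0" using up[OF real_subspaceD(1)[OF E] K0] sublinear_onD(3)[OF q] by (simp add: v_def)
    show "0 \<le> q' (\<lambda>_. 0)" by (rule great) (use lower[OF real_subspaceD(1)[OF E]] sublinear_onD(3)[OF q] in auto)
  qed
  show ?thesis
  proof (rule that[of q'])
    show "sublinear_on E q'" unfolding sublinear_on_def using add scale zero by blast
    show "q' x \<le> q x" if "x \<in> E" for x using up[OF that K0] by (simp add: v_def)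
    show "q' x \<le> q (\<lambda>z. x z + k z) - s" if "x \<in> E" "(k, s) \<in> K" for x k s
      using up[OF that] by (simp add: v_def)
  qed
qed

text \<open>Zorn's lemma applied downwards: along a chain the pointwise infimum stays above
  \<open>- p (\<lambda>z. - x z)\<close>, so it is finite, and it inherits sublinearity because any
  two members are comparable.\<close>

lemma minimal_sublinear:
  fixes p :: "('b \<Rightarrow> complex) \<Rightarrow> real"
  assumes E: "real_subspace E" and p: "sublinear_on E p"
  obtains q where "sublinear_on E q" "\<And>x. x \<in> E \<Longrightarrow> q x \<le> p x"
    "\<And>q' x. sublinear_on E q' \<Longrightarrow> (\<And>x. x \<in> E \<Longrightarrow> q' x \<le> q x) \<Longrightarrow> x \<in> E \<Longrightarrow> q' x = q x"
proof -
  define A where "A = {q. sublinear_on E q \<and> (\<forall>x\<in>E. q x \<le> p x) \<and> (\<forall>x. x \<notin> E \<longrightarrow> q x = 0)}"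
  define P where "P = (\<lambda>q q' :: ('b \<Rightarrow> complex) \<Rightarrow> real. \<forall>x. q' x \<le> q x)"
  \<comment> \<open>Values outside \<open>E\<close> are set to \<open>0\<close>, so that the
    pointwise order on \<open>A\<close> is antisymmetric.\<close>
  define ext where "ext = (\<lambda>(q :: ('b \<Rightarrow> complex) \<Rightarrow> real) x. if x \<in> E then q x else 0)"
  have ext_sub: "sublinear_on E (ext q)" if "sublinear_on E q" for q
    using that real_subspaceD[OF E] unfolding sublinear_on_def ext_def by auto
  have ext_A: "ext q \<in> A" if "sublinear_on E q" "\<And>x. x \<in> E \<Longrightarrow> q x \<le> p x" for q
    using ext_sub[OF that(1)] that(2) by (auto simp: A_def ext_def)
  have "\<exists>m\<in>A. \<forall>a\<in>A. P m a \<longrightarrow> a = m"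
  proof (rule predicate_Zorn)
    show "partial_order_on A (relation_of P A)"
      by (rule partial_order_on_relation_ofI) (auto simp: P_def fun_eq_iff intro: order_trans antisym)
    fix C assume C: "C \<in> Chains (relation_of P A)"
    have CA: "C \<subseteq> A" using C by (auto simp: Chains_def relation_of_def)
    have ch: "P q q' \<or> P q' q" if "q \<in> C" "q' \<in> C" for q q'
      using C that by (auto simp: Chains_def relation_of_def)
    show "\<exists>u\<in>A. \<forall>a\<in>C. P a u"
    proof (cases "C = {}")
      case True
      then show ?thesis using ext_A[OF p] by auto
    next
      case ne: False
      define u where "u = (\<lambda>x. INF q\<in>C. q x)"
      have sub: "sublinear_on E q" if "q \<in> C" for q using that CA by (auto simp: A_def)
      have lower: "- p (\<lambda>z. - x z) \<le> q x" if "q \<in> C" "x \<in> E" for q x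
      proof -
        have "q (\<lambda>z. - x z) \<le> p (\<lambda>z. - x z)" using that CA real_subspaceD(4)[OF E] by (auto simp: A_def)
        then show ?thesis using sublinear_on_minus[OF sub[OF that(1)] E that(2)] by linarith
      qed
      have up: "u x \<le> q x" if "q \<in> C" "x \<in> E" for q x unfolding u_def
        by (rule cINF_lower[OF bdd_belowI[of _ "- p (\<lambda>z. - x z)"]]) (use lower that in auto)
      have great: "t \<le> u x" if "\<And>q. q \<in> C \<Longrightarrow> t \<le> q x" for t x
        unfolding u_def by (rule cINF_greatest[OF ne that])
      have usub: "sublinear_on E u" unfolding sublinear_on_def
      proof (intro conjI ballI allI impI)
        fix x y assume x: "x \<in> E" and y: "y \<in> E"
        have 1: "u (\<lambda>z. x z + y z) \<le> q x + q' y" if qq: "q \<in> C" "q' \<in> C" for q q'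
        proof -
          obtain q'' where q'': "q'' \<in> C" "q'' x \<le> q x" "q'' y \<le> q' y"
            using ch[OF qq] qq unfolding P_def by blast
          have "u (\<lambda>z. x z + y z) \<le> q'' (\<lambda>z. x z + y z)" using up[OF q''(1)] real_subspaceD(2)[OF E x y] by blast
          also have "\<dots> \<le> q'' x + q'' y" using sublinear_onD(1)[OF sub[OF q''(1)] x y] .
          finally show ?thesis using q'' by simp
        qed
        have 2: "u (\<lambda>z. x z + y z) - q' y \<le> u x" if "q' \<in> C" for q'
        proof (rule great)
          fix q assume "q \<in> C"
          from 1[OF this that] show "u (\<lambda>z. x z + y z) - q' y \<le> q x" by linarith
        qed
        have "u (\<lambda>z. x z + y z) - u x \<le> u y"
        proof (rule great)
          fix q assume "q \<in> C"
          from 2[OF this] show "u (\<lambda>z. x z + y z) - u x \<le> q y" by linarith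
        qed
        then show "u (\<lambda>z. x z + y z) \<le> u x + u y" by simp
      next
        fix x and t :: real assume x: "x \<in> E" and t: "t > 0"
        have tx: "(\<lambda>z. of_real t * x z) \<in> E" using real_subspaceD(3)[OF E x] .
        show "u (\<lambda>z. of_real t * x z) = t * u x"
        proof (rule antisym)
          have "u (\<lambda>z. of_real t * x z) / t \<le> u x"
          proof (rule great)
            fix q assume q: "q \<in> C"
            show "u (\<lambda>z. of_real t * x z) / t \<le> q x"
              using up[OF q tx] sublinear_onD(2)[OF sub[OF q] x t] t by (simp add: divide_le_eq mult.commute)
          qed
          then show "u (\<lambda>z. of_real t * x z) \<le> t * u x" using t by (simp add: divide_le_eq mult.commute)
          show "t * u x \<le> u (\<lambda>z. of_real t * x z)"
          proof (rule great)
            fix q assume q: "q \<in> C"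
            show "t * u x \<le> q (\<lambda>z. of_real t * x z)"
              using up[OF q x] sublinear_onD(2)[OF sub[OF q] x t] t by simp
          qed
        qed
      next
        show "u (\<lambda>_. 0) = 0"
        proof (rule antisym)
          obtain q where "q \<in> C" using ne by blast
          then show "u (\<lambda>_. 0) \<le> 0"
            using up[of q "\<lambda>_. 0"] real_subspaceD(1)[OF E] sublinear_onD(3)[OF sub[of q]] by simp
          show "0 \<le> u (\<lambda>_. 0)" by (rule great, subst sublinear_onD(3)[OF sub]) auto
        qed
      qed
      obtain q0 where q0: "q0 \<in> C" using ne by blast
      have "u x \<le> p x" if "x \<in> E" for x
        using up[OF q0 that] q0 CA that by (force simp: A_def)
      then have "ext u \<in> A" using ext_A[OF usub] by blast
      moreover have "P q (ext u)" if "q \<in> C" for q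
        unfolding P_def ext_def using up[OF that] that CA by (auto simp: A_def)
      ultimately show ?thesis by blast
    qed
  qed
  then obtain m where m: "m \<in> A" "\<And>a. a \<in> A \<Longrightarrow> P m a \<Longrightarrow> a = m" by blast
  show ?thesis
  proof (rule that[of m])
    show "sublinear_on E m" "\<And>x. x \<in> E \<Longrightarrow> m x \<le> p x" using m(1) by (auto simp: A_def)
    fix q' x assume q': "sublinear_on E q'" "\<And>x. x \<in> E \<Longrightarrow> q' x \<le> m x" "x \<in> E"
    have "ext q' \<in> A" using q' m(1) by (intro ext_A) (auto simp: A_def intro: order_trans)
    moreover have "P m (ext q')" using q'(2) m(1) unfolding P_def ext_def by (auto simp: A_def)
    ultimately have "ext q' = m" by (rule m(2))
    then show "q' x = m x" using q'(3) by (metis ext_def)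
  qed
qed

text \<open>Lowering \<open>q\<close> along the ray spanned by \<open>v\<close> produces a sublinear
  functional below \<open>q\<close>, hence \<open>q\<close> itself; the parameter
  \<open>t = 1\<close> then reverses the triangle inequality.\<close>

lemma minimal_sublinear_additive:
  fixes q :: "('b \<Rightarrow> complex) \<Rightarrow> real"
  assumes E: "real_subspace E" and q: "sublinear_on E q"
    and min: "\<And>q' x. sublinear_on E q' \<Longrightarrow> (\<And>x. x \<in> E \<Longrightarrow> q' x \<le> q x) \<Longrightarrow> x \<in> E \<Longrightarrow> q' x = q x"
    and x: "x \<in> E" and v: "v \<in> E"
  shows "q (\<lambda>z. x z + v z) = q x + q v"
proof -
  define K where "K = {((\<lambda>z. of_real t * v z), t * q v) |t::real. t \<ge> 0}"
  have Kc: "((\<lambda>z. of_real t * v z), t * q v) \<in> K" if "t \<ge> 0" for t using that by (auto simp: K_def)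
  obtain q' where q': "sublinear_on E q'" "\<And>x. x \<in> E \<Longrightarrow> q' x \<le> q x"
    "\<And>x k s. x \<in> E \<Longrightarrow> (k, s) \<in> K \<Longrightarrow> q' x \<le> q (\<lambda>z. x z + k z) - s"
  proof (rule sublinear_on_cone_Inf[OF E q, of K])
    fix k s assume "(k, s) \<in> K"
    then obtain t where t: "t \<ge> 0" "k = (\<lambda>z. of_real t * v z)" "s = t * q v" by (auto simp: K_def)
    then show "k \<in> E \<and> s \<le> q k"
      using real_subspaceD(1)[OF E] real_subspaceD(3)[OF E v] sublinear_onD(2)[OF q v] sublinear_onD(3)[OF q] by (cases "t = 0") auto
  next
    show "((\<lambda>_. 0), 0) \<in> K" using Kc[of 0] by simp
  next
    fix k s k' s' assume "(k, s) \<in> K" "(k', s') \<in> K"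
    then obtain t t' where "t \<ge> 0" "k = (\<lambda>z. of_real t * v z)" "s = t * q v"
      "t' \<ge> 0" "k' = (\<lambda>z. of_real t' * v z)" "s' = t' * q v" by (auto simp: K_def)
    then show "((\<lambda>z. k z + k' z), s + s') \<in> K" using Kc[of "t + t'"] by (simp add: distrib_right)
  next
    fix k s and u :: real assume "(k, s) \<in> K" "u > 0"
    then obtain t where "t \<ge> 0" "k = (\<lambda>z. of_real t * v z)" "s = t * q v" by (auto simp: K_def)
    then show "((\<lambda>z. of_real u * k z), u * s) \<in> K" using Kc[of "u * t"] \<open>u > 0\<close> by (simp add: mult.assoc)
  qed blast
  have "q x = q' x" using min[OF q'(1,2) x] by simp
  also have "\<dots> \<le> q (\<lambda>z. x z + v z) - q v" using q'(3)[OF x Kc[of 1]] by simp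
  finally show ?thesis using sublinear_onD(1)[OF q x v] by linarith
qed

definition complex_subspace :: "('b \<Rightarrow> complex) set \<Rightarrow> bool" where
  "complex_subspace E \<longleftrightarrow> (\<lambda>_. 0) \<in> E \<and> (\<forall>x\<in>E. \<forall>y\<in>E. \<forall>\<alpha> \<beta>. (\<lambda>z. \<alpha> * x z + \<beta> * y z) \<in> E)"

lemma complex_subspaceD:
  assumes "complex_subspace E"
  shows "(\<lambda>_. 0) \<in> E" "x \<in> E \<Longrightarrow> y \<in> E \<Longrightarrow> (\<lambda>z. \<alpha> * x z + \<beta> * y z) \<in> E"
    "x \<in> E \<Longrightarrow> (\<lambda>z. \<alpha> * x z) \<in> E" "x \<in> E \<Longrightarrow> y \<in> E \<Longrightarrow> (\<lambda>z. x z + y z) \<in> E"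
    "x \<in> E \<Longrightarrow> y \<in> E \<Longrightarrow> (\<lambda>z. x z - y z) \<in> E"
proof -
  show g: "x \<in> E \<Longrightarrow> y \<in> E \<Longrightarrow> (\<lambda>z. \<alpha> * x z + \<beta> * y z) \<in> E" for x y \<alpha> \<beta>
    using assms by (auto simp: complex_subspace_def)
  show "x \<in> E \<Longrightarrow> (\<lambda>z. \<alpha> * x z) \<in> E" using g[of x x \<alpha> 0] by simp
  show "x \<in> E \<Longrightarrow> y \<in> E \<Longrightarrow> (\<lambda>z. x z + y z) \<in> E" using g[of x y 1 1] by simp
  show "x \<in> E \<Longrightarrow> y \<in> E \<Longrightarrow> (\<lambda>z. x z - y z) \<in> E" using g[of x y 1 "-1"] by simp
qed (use assms in \<open>auto simp: complex_subspace_def\<close>)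

lemma complex_subspace_imp_real: "complex_subspace E \<Longrightarrow> real_subspace E"
  unfolding real_subspace_def using complex_subspaceD by blast

definition seminorm_on :: "('b \<Rightarrow> complex) set \<Rightarrow> (('b \<Rightarrow> complex) \<Rightarrow> real) \<Rightarrow> bool" where
  "seminorm_on E p \<longleftrightarrow> (\<forall>x\<in>E. \<forall>y\<in>E. p (\<lambda>z. x z + y z) \<le> p x + p y) \<and>
     (\<forall>x\<in>E. \<forall>\<alpha>. p (\<lambda>z. \<alpha> * x z) = norm \<alpha> * p x)"

definition linear_functional_on :: "('b \<Rightarrow> complex) set \<Rightarrow> (('b \<Rightarrow> complex) \<Rightarrow> complex) \<Rightarrow> bool" where
  "linear_functional_on E S \<longleftrightarrow> (\<forall>x\<in>E. \<forall>y\<in>E. \<forall>\<alpha> \<beta>. S (\<lambda>z. \<alpha> * x z + \<beta> * y z) = \<alpha> * S x + \<beta> * S y)"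

text \<open>The argument type is left open because the theorem serves twice: for entire functions
  and for smooth functions on an interval.\<close>

theorem Hahn_Banach_separation:
  fixes p :: "('b \<Rightarrow> complex) \<Rightarrow> real"
  assumes E: "complex_subspace E" and M: "complex_subspace M" "M \<subseteq> E" and p: "seminorm_on E p"
    and v: "v \<in> E" and dist: "\<And>m. m \<in> M \<Longrightarrow> 1 \<le> p (\<lambda>z. v z - m z)"
  obtains S where "linear_functional_on E S" "\<And>m. m \<in> M \<Longrightarrow> S m = 0" "S v \<noteq> 0"
    "\<And>x. x \<in> E \<Longrightarrow> norm (S x) \<le> 2 * p x"
proof -
  note E' = complex_subspace_imp_real[OF E]
  have padd: "p (\<lambda>z. x z + y z) \<le> p x + p y" if "x \<in> E" "y \<in> E" for x y
    using p that by (auto simp: seminorm_on_def)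
  have pscale: "p (\<lambda>z. \<alpha> * x z) = norm \<alpha> * p x" if "x \<in> E" for x \<alpha>
    using p that by (auto simp: seminorm_on_def)
  have p0: "p (\<lambda>_. 0) = 0" using pscale[OF complex_subspaceD(1)[OF E], of 0] by simp
  have pminus: "p (\<lambda>z. - x z) = p x" if "x \<in> E" for x using pscale[OF that, of "-1"] by simp
  have psub: "sublinear_on E p" unfolding sublinear_on_def using padd pscale p0 by auto
  have pnn: "0 \<le> p x" if "x \<in> E" for x
    using sublinear_on_minus[OF psub E' that] pminus[OF that] by simp
  \<comment> \<open>The pairs with \<open>t = 0\<close> force the lowered functional to be
    nonpositive on \<open>M\<close>, and the pair for \<open>m = 0\<close>, \<open>t = 1\<close>
    forces its value at \<open>v\<close> to be at most \<open>-1\<close>. A linear functional below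
    it therefore vanishes on \<open>M\<close> but not at \<open>v\<close>.\<close>
  define K where "K = {((\<lambda>z. m z - of_real t * v z), t) |t m. t \<ge> 0 \<and> m \<in> M}"
  have Kc: "((\<lambda>z. m z - of_real t * v z), t) \<in> K" if "t \<ge> 0" "m \<in> M" for t m
    using that by (auto simp: K_def)
  obtain p1 where p1: "sublinear_on E p1" "\<And>x. x \<in> E \<Longrightarrow> p1 x \<le> p x"
    "\<And>x k s. x \<in> E \<Longrightarrow> (k, s) \<in> K \<Longrightarrow> p1 x \<le> p (\<lambda>z. x z + k z) - s"
  proof (rule sublinear_on_cone_Inf[OF E' psub, of K])
    fix k s assume "(k, s) \<in> K"
    then obtain m where t: "s \<ge> 0" "m \<in> M" "k = (\<lambda>z. m z - of_real s * v z)" by (auto simp: K_def)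
    have mE: "m \<in> E" using t M by blast
    have "k \<in> E" using complex_subspaceD(2)[OF E mE v, of 1 "- of_real s"] by (simp add: t)
    moreover have "s \<le> p k"
    proof (cases "s = 0")
      case False
      then have s: "s > 0" using t by simp
      have m': "(\<lambda>z. of_real (1/s) * m z) \<in> M" using complex_subspaceD(3)[OF M(1) t(2)] .
      have vm: "(\<lambda>z. v z - of_real (1/s) * m z) \<in> E"
        using complex_subspaceD(2)[OF E v mE, of 1 "- of_real (1/s)"] by simp
      have "k = (\<lambda>z. of_real (- s) * (v z - of_real (1/s) * m z))"
        using s by (auto simp: t fun_eq_iff algebra_simps)
      then have "p k = norm (of_real (- s) :: complex) * p (\<lambda>z. v z - of_real (1/s) * m z)"
        by (simp only: pscale[OF vm])
      also have "norm (of_real (- s) :: complex) = s" using s by simp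
      finally have "p k = s * p (\<lambda>z. v z - of_real (1/s) * m z)" .
      moreover have "s * 1 \<le> s * p (\<lambda>z. v z - of_real (1/s) * m z)"
        using dist[OF m'] s by (intro mult_left_mono) auto
      ultimately show ?thesis by simp
    qed (use pnn \<open>k \<in> E\<close> in auto)
    ultimately show "k \<in> E \<and> s \<le> p k" by blast
  next
    show "((\<lambda>_. 0), 0) \<in> K" using Kc[of 0 "\<lambda>_. 0"] complex_subspaceD(1)[OF M(1)] by simp
  next
    fix k s k' s' assume "(k, s) \<in> K" "(k', s') \<in> K"
    then obtain m m' where t: "s \<ge> 0" "m \<in> M" "k = (\<lambda>z. m z - of_real s * v z)"
      "s' \<ge> 0" "m' \<in> M" "k' = (\<lambda>z. m' z - of_real s' * v z)" by (auto simp: K_def)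
    then show "((\<lambda>z. k z + k' z), s + s') \<in> K"
      using Kc[of "s + s'" "\<lambda>z. m z + m' z"] complex_subspaceD(4)[OF M(1)] by (simp add: algebra_simps)
  next
    fix k s and u :: real assume u: "(k, s) \<in> K" "u > 0"
    then obtain m where t: "s \<ge> 0" "m \<in> M" "k = (\<lambda>z. m z - of_real s * v z)" by (auto simp: K_def)
    then show "((\<lambda>z. of_real u * k z), u * s) \<in> K"
      using Kc[of "u * s" "\<lambda>z. of_real u * m z"] complex_subspaceD(3)[OF M(1)] u(2) by (simp add: algebra_simps)
  qed blast
  obtain q where q: "sublinear_on E q" "\<And>x. x \<in> E \<Longrightarrow> q x \<le> p1 x"
    "\<And>q' x. sublinear_on E q' \<Longrightarrow> (\<And>x. x \<in> E \<Longrightarrow> q' x \<le> q x) \<Longrightarrow> x \<in> E \<Longrightarrow> q' x = q x"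
    using minimal_sublinear[OF E' p1(1)] by blast
  have qadd: "q (\<lambda>z. x z + y z) = q x + q y" if "x \<in> E" "y \<in> E" for x y
    by (rule minimal_sublinear_additive[where q = q, OF E' q(1) _ that]) (rule q(3))
  have q0: "q (\<lambda>_. 0) = 0" using sublinear_onD(3)[OF q(1)] .
  have qminus: "q (\<lambda>z. - x z) = - q x" if "x \<in> E" for x
    using qadd[OF that real_subspaceD(4)[OF E' that]] q0 by simp
  have qscale: "q (\<lambda>z. of_real t * x z) = t * q x" if x: "x \<in> E" for x t
  proof -
    consider "t > 0" | "t = 0" | "t < 0" by linarith
    then show ?thesis
    proof cases
      case 1 then show ?thesis using sublinear_onD(2)[OF q(1) x] by blast
    next
      case 2 then show ?thesis by (simp add: q0)
    next
      case 3
      have "q (\<lambda>z. of_real (- t) * (- x z)) = (- t) * q (\<lambda>z. - x z)"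
        by (rule sublinear_onD(2)[OF q(1) real_subspaceD(4)[OF E' x]]) (use 3 in simp)
      then show ?thesis using qminus[OF x] by simp
    qed
  qed
  have qle: "\<bar>q x\<bar> \<le> p x" if x: "x \<in> E" for x
  proof -
    have "q x \<le> p x" "q (\<lambda>z. - x z) \<le> p (\<lambda>z. - x z)"
      using q(2) p1(2) x real_subspaceD(4)[OF E' x] by (meson order_trans)+
    then show ?thesis using qminus[OF x] pminus[OF x] by linarith
  qed
  have qM: "q m = 0" if m: "m \<in> M" for m
  proof -
    have le: "q m \<le> 0" if m: "m \<in> M" for m
    proof -
      have mE: "m \<in> E" using m M by blast
      have m': "(\<lambda>z. - m z) \<in> M" using complex_subspaceD(3)[OF M(1) m, of "-1"] by simp
      have "((\<lambda>z. - m z), 0) \<in> K" using Kc[of 0, OF _ m'] by simp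
      from p1(3)[OF mE this] have "p1 m \<le> 0" using p0 by simp
      then show ?thesis using q(2)[OF mE] by linarith
    qed
    have mE: "m \<in> E" using m M by blast
    have "(\<lambda>z. - m z) \<in> M" using complex_subspaceD(3)[OF M(1) m, of "-1"] by simp
    from le[OF this] le[OF m] show ?thesis using qminus[OF mE] by simp
  qed
  have qv: "q v \<le> -1"
  proof -
    have "((\<lambda>z. - v z), 1) \<in> K" using Kc[of 1 "\<lambda>_. 0"] complex_subspaceD(1)[OF M(1)] by simp
    from p1(3)[OF v this] have "p1 v \<le> -1" using p0 by simp
    then show ?thesis using q(2)[OF v] by linarith
  qed
  \<comment> \<open>This is the usual complexification of a real functional; bounding both parts
    separately costs the factor \<open>2\<close>.\<close>
  define S where "S = (\<lambda>x. Complex (q x) (- q (\<lambda>z. \<i> * x z)))"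
  have iE: "(\<lambda>z. \<alpha> * x z) \<in> E" if "x \<in> E" for x \<alpha> using complex_subspaceD(3)[OF E that] .
  have qcomp: "q (\<lambda>z. \<alpha> * x z) = Re \<alpha> * q x + Im \<alpha> * q (\<lambda>z. \<i> * x z)" if x: "x \<in> E" for x \<alpha>
  proof -
    have eq: "(\<lambda>z. \<alpha> * x z) = (\<lambda>z. of_real (Re \<alpha>) * x z + of_real (Im \<alpha>) * (\<i> * x z))"
      by (rule ext, subst complex_eq[of \<alpha>]) (simp add: algebra_simps)
    show ?thesis unfolding eq
      using qadd[OF iE[OF x] iE[OF iE[OF x]], of "of_real (Re \<alpha>)" "of_real (Im \<alpha>)" \<i>]
        qscale[OF x] qscale[OF iE[OF x]] by simp
  qed
  have Sscale: "S (\<lambda>z. \<alpha> * x z) = \<alpha> * S x" if x: "x \<in> E" for x \<alpha>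
  proof -
    have "q (\<lambda>z. \<i> * (\<alpha> * x z)) = Re (\<i> * \<alpha>) * q x + Im (\<i> * \<alpha>) * q (\<lambda>z. \<i> * x z)"
      using qcomp[OF x, of "\<i> * \<alpha>"] by (simp add: mult.assoc)
    then show ?thesis using qcomp[OF x, of \<alpha>] by (simp add: S_def complex_eq_iff)
  qed
  have Sadd: "S (\<lambda>z. x z + y z) = S x + S y" if x: "x \<in> E" and y: "y \<in> E" for x y
    using qadd[OF x y] qadd[OF iE[OF x] iE[OF y], of \<i> \<i>] by (simp add: S_def complex_eq_iff distrib_left)
  show ?thesis
  proof (rule that[of S])
    show "linear_functional_on E S" unfolding linear_functional_on_def
      using Sadd[OF iE iE] Sscale by simp
    show "S m = 0" if m: "m \<in> M" for m
      using qM[OF m] qM[OF complex_subspaceD(3)[OF M(1) m]] by (simp add: S_def complex_eq_iff)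
    show "S v \<noteq> 0" using qv by (auto simp: S_def complex_eq_iff)
    show "norm (S x) \<le> 2 * p x" if x: "x \<in> E" for x
    proof -
      have "norm (S x) \<le> \<bar>q x\<bar> + \<bar>q (\<lambda>z. \<i> * x z)\<bar>" using cmod_le[of "S x"] by (simp add: S_def)
      moreover have "p (\<lambda>z. \<i> * x z) = p x" using pscale[OF x, of \<i>] by simp
      ultimately show ?thesis using qle[OF x] qle[OF iE[OF x, of \<i>]] by linarith
    qed
  qed
qed

section \<open>Difference quotients of entire functions\<close>

lemma entire_mult_eq_zero:
  fixes f g :: "complex \<Rightarrow> complex"
  assumes f: "f holomorphic_on UNIV" and g: "g holomorphic_on UNIV"
    and eq: "\<And>z. f z * g z = 0" and nz: "f u \<noteq> 0"
  shows "g z = 0"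
proof (rule entire_zero_of_zero_on_open[OF g, of "{z. f z \<noteq> 0}" u])
  show "open {z. f z \<noteq> 0}"
    by (rule open_Collect_neq) (use f holomorphic_on_imp_continuous_on in auto)
  show "g z = 0" if "z \<in> {z. f z \<noteq> 0}" for z using eq[of z] that by simp
qed (use nz in auto)

definition diff_quot :: "(complex \<Rightarrow> complex) \<Rightarrow> complex \<Rightarrow> complex \<Rightarrow> complex" where
  "diff_quot f \<mu> = (\<lambda>z. if z = \<mu> then deriv f \<mu> else (f z - f \<mu>) / (z - \<mu>))"

lemma diff_quot_holomorphic: "f holomorphic_on UNIV \<Longrightarrow> diff_quot f \<mu> holomorphic_on UNIV"
  unfolding diff_quot_def by (rule pole_lemma_open) auto

lemma diff_quot_mult: "(z - \<mu>) * diff_quot f \<mu> z = f z - f \<mu>"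
  by (simp add: diff_quot_def)

lemma diff_quot_eqI:
  assumes f: "f holomorphic_on UNIV" and q: "q holomorphic_on UNIV"
    and eq: "\<And>z. (z - \<mu>) * q z = f z - f \<mu>"
  shows "diff_quot f \<mu> = q"
proof
  fix z
  have "diff_quot f \<mu> z - q z = 0"
  proof (rule entire_mult_eq_zero[of "\<lambda>z. z - \<mu>" "\<lambda>z. diff_quot f \<mu> z - q z" "\<mu> + 1"])
    show "(z - \<mu>) * (diff_quot f \<mu> z - q z) = 0" for z
      unfolding right_diff_distrib diff_quot_mult eq by simp
  qed (auto intro!: holomorphic_intros diff_quot_holomorphic f q)
  then show "diff_quot f \<mu> z = q z" by simp
qed

lemma divide_root_eq_diff_quot: "f \<mu> = 0 \<Longrightarrow> divide_root f \<mu> = diff_quot f \<mu>"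
  by (auto simp: divide_root_def diff_quot_def)

lemma diff_quot_lincomb:
  assumes f: "f holomorphic_on UNIV" and g: "g holomorphic_on UNIV"
  shows "diff_quot (\<lambda>z. \<alpha> * f z + \<beta> * g z) \<mu> = (\<lambda>z. \<alpha> * diff_quot f \<mu> z + \<beta> * diff_quot g \<mu> z)"
proof (rule diff_quot_eqI)
  fix z
  have "(z - \<mu>) * (\<alpha> * diff_quot f \<mu> z + \<beta> * diff_quot g \<mu> z)
      = \<alpha> * ((z - \<mu>) * diff_quot f \<mu> z) + \<beta> * ((z - \<mu>) * diff_quot g \<mu> z)" by (simp add: algebra_simps)
  then show "(z - \<mu>) * (\<alpha> * diff_quot f \<mu> z + \<beta> * diff_quot g \<mu> z)
      = \<alpha> * f z + \<beta> * g z - (\<alpha> * f \<mu> + \<beta> * g \<mu>)" by (simp only: diff_quot_mult) (simp add: algebra_simps)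
qed (intro holomorphic_intros diff_quot_holomorphic f g)+

text \<open>A first resolvent identity: the dependence on the base point is controlled by one
  further difference quotient. It is the source of continuity and differentiability of
  \<open>trf\<close>.\<close>

lemma diff_quot_resolvent:
  assumes f: "f holomorphic_on UNIV"
  shows "diff_quot f \<nu> = (\<lambda>z. 1 * diff_quot f \<mu> z + (\<nu> - \<mu>) * diff_quot (diff_quot f \<mu>) \<nu> z)"
proof (rule diff_quot_eqI)
  fix z
  have "(z - \<nu>) * (1 * diff_quot f \<mu> z + (\<nu> - \<mu>) * diff_quot (diff_quot f \<mu>) \<nu> z)
      = (z - \<nu>) * diff_quot f \<mu> z + (\<nu> - \<mu>) * ((z - \<nu>) * diff_quot (diff_quot f \<mu>) \<nu> z)"
    by (simp add: algebra_simps)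
  also have "\<dots> = (z - \<mu>) * diff_quot f \<mu> z - (\<nu> - \<mu>) * diff_quot f \<mu> \<nu>"
    unfolding diff_quot_mult[of z \<nu> "diff_quot f \<mu>"] by (simp add: algebra_simps)
  finally show "(z - \<nu>) * (1 * diff_quot f \<mu> z + (\<nu> - \<mu>) * diff_quot (diff_quot f \<mu>) \<nu> z) = f z - f \<nu>"
    using diff_quot_mult[of z \<mu> f] diff_quot_mult[of \<nu> \<mu> f] by simp
qed (intro holomorphic_intros diff_quot_holomorphic f)+

lemma diff_quot_times_ident:
  assumes f: "f holomorphic_on UNIV"
  shows "diff_quot (\<lambda>z. z * f z) \<mu> = (\<lambda>z. 1 * f z + \<mu> * diff_quot f \<mu> z)"
proof (rule diff_quot_eqI)
  fix z
  have "(z - \<mu>) * (1 * f z + \<mu> * diff_quot f \<mu> z) = (z - \<mu>) * f z + \<mu> * ((z - \<mu>) * diff_quot f \<mu> z)"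
    by (simp add: algebra_simps)
  then show "(z - \<mu>) * (1 * f z + \<mu> * diff_quot f \<mu> z) = z * f z - \<mu> * f \<mu>"
    by (simp only: diff_quot_mult) (simp add: algebra_simps)
qed (intro holomorphic_intros diff_quot_holomorphic f)+

section \<open>Continuous functionals on the inductive limit\<close>

context weight_seqs
begin

abbreviation "P \<equiv> P_space w r c"

lemma P_weighted_le_iff: "P_weighted w r c k f z \<le> M \<longleftrightarrow> norm (f z) \<le> M * W k z"
proof -
  have "P_weighted w r c k f z = norm (f z) / W k z"
    unfolding P_weighted_def W_def by (simp add: exp_minus field_simps flip: exp_add)
  then show ?thesis by (simp add: divide_le_eq)
qed

lemma P_step_iff: "f \<in> P_step w r c k \<longleftrightarrow> (\<exists>M. entire_le k M f)"
  unfolding P_step_def entire_le_def bdd_above_def by (auto simp: P_weighted_le_iff)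

lemma P_iff: "f \<in> P \<longleftrightarrow> (\<exists>k M. entire_le k M f)"
  unfolding P_space_def by (auto simp: P_step_iff)

lemma P_norm_le: "entire_le k M f \<Longrightarrow> P_norm w r c k f \<le> M"
  unfolding P_norm_def by (rule cSUP_least) (auto simp: P_weighted_le_iff entire_le_def)

lemma entire_le_lincomb:
  assumes f: "entire_le k M f" and g: "entire_le k N g"
  shows "entire_le k (norm \<alpha> * M + norm \<beta> * N) (\<lambda>z. \<alpha> * f z + \<beta> * g z)"
  unfolding entire_le_def
proof (intro conjI allI)
  show "(\<lambda>z. \<alpha> * f z + \<beta> * g z) holomorphic_on UNIV"
    by (intro holomorphic_intros entire_leD[OF f] entire_leD[OF g])
  fix z
  have "norm (\<alpha> * f z + \<beta> * g z) \<le> norm \<alpha> * norm (f z) + norm \<beta> * norm (g z)"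
    using norm_triangle_ineq[of "\<alpha> * f z" "\<beta> * g z"] by (simp add: norm_mult)
  also have "\<dots> \<le> norm \<alpha> * (M * W k z) + norm \<beta> * (N * W k z)"
    by (intro add_mono mult_left_mono entire_leD(2)[OF f] entire_leD(2)[OF g]) auto
  finally show "norm (\<alpha> * f z + \<beta> * g z) \<le> (norm \<alpha> * M + norm \<beta> * N) * W k z"
    by (simp add: algebra_simps)
qed

lemma entire_le_common:
  assumes "f \<in> P" "g \<in> P"
  obtains k M N where "entire_le k M f" "entire_le k N g"
proof -
  obtain k M k' N where "entire_le k M f" "entire_le k' N g" using assms P_iff by blast
  then have "entire_le (max k k') M f" "entire_le (max k k') N g"
    by (auto intro: entire_le_mono)
  then show ?thesis using that by blast
qed

lemma P_subspace: "complex_subspace P"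
  unfolding complex_subspace_def
proof (intro conjI ballI allI)
  have "entire_le 0 0 (\<lambda>_. 0)" by (simp add: entire_le_def)
  then show "(\<lambda>_. 0) \<in> P" using P_iff by blast
  show "(\<lambda>z. \<alpha> * x z + \<beta> * y z) \<in> P" if "x \<in> P" "y \<in> P" for x y \<alpha> \<beta>
    using entire_le_common[OF that] entire_le_lincomb P_iff by metis
qed

lemma P_holomorphic: "f \<in> P \<Longrightarrow> f holomorphic_on UNIV"
  using P_iff entire_leD by blast

text \<open>Continuity of a linear functional on the inductive limit, tested on the Banach
  steps.\<close>

definition step_bounded :: "((complex \<Rightarrow> complex) \<Rightarrow> complex) \<Rightarrow> bool" where
  "step_bounded S \<longleftrightarrow> (\<forall>k. \<exists>C\<ge>0. \<forall>M f. entire_le k M f \<longrightarrow> norm (S f) \<le> C * M)"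

lemma topspace_P_top: "topspace (P_top w r c) = P"
proof
  show "topspace (P_top w r c) \<subseteq> P"
    using openin_topspace[of "P_top w r c"] unfolding openin_P_top by blast
  have "P_nhd w r c P" unfolding P_nhd_def
  proof (intro conjI ballI allI impI)
    show "(\<lambda>z. \<alpha> * u z + \<beta> * v z) \<in> P" if "u \<in> P" "v \<in> P" for u v \<alpha> \<beta>
      using complex_subspaceD(2)[OF P_subspace that] .
    show "\<exists>\<epsilon>>0. {\<phi> \<in> P_step w r c k. P_norm w r c k \<phi> < \<epsilon>} \<subseteq> P" for k
      by (rule exI[of _ 1]) (auto simp: P_space_def)
  qed simp
  then have "openin (P_top w r c) P"
    unfolding openin_P_top using complex_subspaceD(4)[OF P_subspace] by blast
  then show "P \<subseteq> topspace (P_top w r c)" by (rule openin_subset)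
qed

text \<open>The seminorm is the Minkowski functional of an absolutely convex neighbourhood
  \<open>U\<close> whose translate by \<open>v\<close> misses \<open>J\<close>. Since
  \<open>U\<close> contains a ball of every step, a functional dominated by it is bounded on every
  step.\<close>

theorem closed_subspace_separation:
  assumes J: "closedin (P_top w r c) J" "complex_subspace J" and v: "v \<in> P" "v \<notin> J"
  obtains S where "linear_functional_on P S" "step_bounded S" "\<And>m. m \<in> J \<Longrightarrow> S m = 0" "S v \<noteq> 0"
proof -
  have JP: "J \<subseteq> P" using closedin_subset[OF J(1)] by (simp add: topspace_P_top)
  have "openin (P_top w r c) (P - J)" using J(1) by (simp add: closedin_def topspace_P_top)
  then obtain U where U: "P_nhd w r c U" "\<And>u. u \<in> U \<Longrightarrow> (\<lambda>z. v z + u z) \<in> P - J"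
    unfolding openin_P_top using v by blast
  have Uabs: "(\<lambda>z. \<alpha> * u z + \<beta> * u' z) \<in> U" if "u \<in> U" "u' \<in> U" "norm \<alpha> + norm \<beta> \<le> 1" for u u' \<alpha> \<beta>
    using U(1) that unfolding P_nhd_def by blast
  have Ubal: "(\<lambda>z. \<alpha> * u z) \<in> U" if "u \<in> U" "norm \<alpha> \<le> 1" for u \<alpha>
    using Uabs[OF that(1) that(1), of \<alpha> 0] that by simp
  define A where "A = (\<lambda>x :: complex \<Rightarrow> complex. {s::real. s > 0 \<and> (\<lambda>z. x z / of_real s) \<in> U})"
  define p where "p = (\<lambda>x. Inf (A x))"
  have eps: "\<exists>e>0. \<forall>M f s. entire_le k M f \<longrightarrow> s > 0 \<longrightarrow> M < e * s \<longrightarrow> s \<in> A f" for k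
  proof -
    obtain e where e: "e > 0" "{\<phi> \<in> P_step w r c k. P_norm w r c k \<phi> < e} \<subseteq> U"
      using U(1) unfolding P_nhd_def by blast
    have "s \<in> A f" if "entire_le k M f" "s > 0" "M < e * s" for M f s
    proof -
      have "entire_le k (norm (of_real (1/s) :: complex) * M + norm (0::complex) * M) (\<lambda>z. of_real (1/s) * f z + 0 * f z)"
        by (rule entire_le_lincomb[OF that(1) that(1)])
      then have *: "entire_le k (M / s) (\<lambda>z. f z / of_real s)" using that by (simp add: norm_divide)
      have "P_norm w r c k (\<lambda>z. f z / of_real s) \<le> M / s" by (rule P_norm_le[OF *])
      also have "\<dots> < e" using that by (simp add: divide_less_eq)
      finally show ?thesis using * e(2) that P_step_iff by (auto simp: A_def)
    qed
    then show ?thesis using e(1) by blast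
  qed
  have ne: "A x \<noteq> {}" if x: "x \<in> P" for x
  proof -
    obtain k M where kM: "entire_le k M x" using x P_iff by blast
    obtain e where e: "e > 0" "\<And>M f s. entire_le k M f \<Longrightarrow> s > 0 \<Longrightarrow> M < e * s \<Longrightarrow> s \<in> A f" using eps by blast
    have M0: "M \<ge> 0" using entire_le_nonneg[OF kM] .
    have "(M + 1) / e \<in> A x" by (rule e(2)[OF kM]) (use e M0 in auto)
    then show ?thesis by blast
  qed
  have bdd: "bdd_below (A x)" for x by (rule bdd_belowI[of _ 0]) (auto simp: A_def)
  have ple: "p x \<le> s" if "s \<in> A x" for x s unfolding p_def by (rule cInf_lower[OF that bdd])
  have pge: "t \<le> p x" if "x \<in> P" "\<And>s. s \<in> A x \<Longrightarrow> t \<le> s" for x t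
    unfolding p_def by (rule cInf_greatest[OF ne[OF that(1)] that(2)])
  have psemi: "seminorm_on P p" unfolding seminorm_on_def
  proof (intro conjI ballI allI)
    fix x y assume x: "x \<in> P" and y: "y \<in> P"
    have 1: "p (\<lambda>z. x z + y z) \<le> s + t" if s: "s \<in> A x" and t: "t \<in> A y" for s t
    proof (rule ple)
      have st: "s > 0" "t > 0" using s t by (auto simp: A_def)
      have "(\<lambda>z. of_real (s / (s + t)) * (x z / of_real s) + of_real (t / (s + t)) * (y z / of_real t)) \<in> U"
      proof (rule Uabs)
        show "norm (of_real (s / (s + t)) :: complex) + norm (of_real (t / (s + t)) :: complex) \<le> 1"
          using st unfolding norm_of_real by (simp flip: add_divide_distrib)
      qed (use s t in \<open>auto simp: A_def\<close>)
      moreover have "(\<lambda>z. of_real (s / (s + t)) * (x z / of_real s) + of_real (t / (s + t)) * (y z / of_real t))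
          = (\<lambda>z. (x z + y z) / of_real (s + t))"
        using st by (auto simp: fun_eq_iff add_divide_distrib)
      ultimately show "s + t \<in> A (\<lambda>z. x z + y z)" using st by (simp add: A_def)
    qed
    have 2: "p (\<lambda>z. x z + y z) - t \<le> p x" if "t \<in> A y" for t
    proof (rule pge[OF x])
      fix s assume "s \<in> A x"
      from 1[OF this that] show "p (\<lambda>z. x z + y z) - t \<le> s" by linarith
    qed
    have "p (\<lambda>z. x z + y z) - p x \<le> p y"
    proof (rule pge[OF y])
      fix t assume "t \<in> A y"
      from 2[OF this] show "p (\<lambda>z. x z + y z) - p x \<le> t" by linarith
    qed
    then show "p (\<lambda>z. x z + y z) \<le> p x + p y" by simp
  next
    fix x and \<alpha> :: complex assume x: "x \<in> P"
    have le: "p (\<lambda>z. \<alpha> * x z) \<le> norm \<alpha> * p x" if x: "x \<in> P" and \<alpha>: "\<alpha> \<noteq> 0" for x \<alpha>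
    proof -
      have "p (\<lambda>z. \<alpha> * x z) / norm \<alpha> \<le> p x"
      proof (rule pge[OF x])
        fix s assume s: "s \<in> A x"
        have "(\<lambda>z. (\<alpha> / of_real (norm \<alpha>)) * (x z / of_real s)) \<in> U"
          by (rule Ubal) (use s \<alpha> in \<open>auto simp: A_def norm_divide\<close>)
        then have "norm \<alpha> * s \<in> A (\<lambda>z. \<alpha> * x z)" using s \<alpha> by (simp add: A_def)
        from ple[OF this] show "p (\<lambda>z. \<alpha> * x z) / norm \<alpha> \<le> s" using \<alpha> by (simp add: divide_le_eq mult.commute)
      qed
      then show ?thesis using \<alpha> by (simp add: divide_le_eq mult.commute)
    qed
    show "p (\<lambda>z. \<alpha> * x z) = norm \<alpha> * p x"
    proof (cases "\<alpha> = 0")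
      case False
      have "p (\<lambda>z. inverse \<alpha> * (\<alpha> * x z)) \<le> norm (inverse \<alpha>) * p (\<lambda>z. \<alpha> * x z)"
        by (rule le) (use False x complex_subspaceD(3)[OF P_subspace] in auto)
      then have "p x \<le> norm (inverse \<alpha>) * p (\<lambda>z. \<alpha> * x z)" using False by (simp flip: mult.assoc)
      then have "norm \<alpha> * p x \<le> norm \<alpha> * (norm (inverse \<alpha>) * p (\<lambda>z. \<alpha> * x z))"
        by (rule mult_left_mono) simp
      also have "\<dots> = p (\<lambda>z. \<alpha> * x z)" using False by (simp add: norm_inverse)
      finally have "norm \<alpha> * p x \<le> p (\<lambda>z. \<alpha> * x z)" .
      then show ?thesis using le[OF x False] by simp
    next
      case True
      obtain s where "s \<in> A x" using ne[OF x] by blast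
      then have "(\<lambda>z. 0 * (x z / of_real s)) \<in> U" by (intro Ubal) (auto simp: A_def)
      then have A0: "s \<in> A (\<lambda>_. 0)" if "s > 0" for s using that by (simp add: A_def)
      have "p (\<lambda>_. 0) \<le> e" if "e > 0" for e using ple[OF A0[OF that]] .
      then have "p (\<lambda>_. 0) \<le> 0" by (rule field_le_epsilon[of _ 0, simplified])
      moreover have "0 \<le> p (\<lambda>_. 0)"
        by (rule pge[OF complex_subspaceD(1)[OF P_subspace]]) (auto simp: A_def)
      ultimately show ?thesis using True by simp
    qed
  qed
  have dist: "1 \<le> p (\<lambda>z. v z - m z)" if m: "m \<in> J" for m
  proof (rule pge)
    show vm: "(\<lambda>z. v z - m z) \<in> P" using complex_subspaceD(5)[OF P_subspace v(1)] m JP by blast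
    fix s assume s: "s \<in> A (\<lambda>z. v z - m z)"
    \<comment> \<open>If \<open>s < 1\<close>, then \<open>U\<close> contains \<open>m - v\<close>
      because it is balanced, and the translate of \<open>U\<close> by \<open>v\<close> would meet
      \<open>J\<close> in \<open>m\<close>.\<close>
    show "1 \<le> s"
    proof (rule ccontr)
      assume "\<not> 1 \<le> s"
      then have s1: "0 < s" "s < 1" using s by (auto simp: A_def)
      have "(\<lambda>z. of_real (- s) * ((v z - m z) / of_real s)) \<in> U"
        by (rule Ubal) (use s s1 in \<open>auto simp: A_def\<close>)
      moreover have "(\<lambda>z. of_real (- s) * ((v z - m z) / of_real s)) = (\<lambda>z. m z - v z)"
        using s1 by (auto simp: fun_eq_iff)
      ultimately have "(\<lambda>z. v z + (m z - v z)) \<in> P - J" using U(2)[of "\<lambda>z. m z - v z"] by simp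
      then show False using m by simp
    qed
  qed
  obtain S where S: "linear_functional_on P S" "\<And>m. m \<in> J \<Longrightarrow> S m = 0" "S v \<noteq> 0"
    "\<And>x. x \<in> P \<Longrightarrow> norm (S x) \<le> 2 * p x"
    using Hahn_Banach_separation[OF P_subspace J(2) JP psemi v(1) dist] by blast
  have "step_bounded S" unfolding step_bounded_def
  proof
    fix k
    obtain e where e: "e > 0" "\<And>M f s. entire_le k M f \<Longrightarrow> s > 0 \<Longrightarrow> M < e * s \<Longrightarrow> s \<in> A f" using eps by blast
    have "norm (S f) \<le> 2 / e * M" if f: "entire_le k M f" for M f
    proof -
      have M0: "M \<ge> 0" using entire_le_nonneg[OF f] .
      have "p f \<le> M / e + d" if d: "d > 0" for d
      proof (rule ple, rule e(2)[OF f])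
        show "0 < M / e + d" using M0 e d by (simp add: add_nonneg_pos)
        show "M < e * (M / e + d)" using e d by (simp add: distrib_left)
      qed
      then have "p f \<le> M / e" by (rule field_le_epsilon)
      moreover have "f \<in> P" using f P_iff by blast
      ultimately have "norm (S f) \<le> 2 * (M / e)" using S(4)[of f] by linarith
      then show ?thesis by simp
    qed
    then show "\<exists>C\<ge>0. \<forall>M f. entire_le k M f \<longrightarrow> norm (S f) \<le> C * M"
      using e(1) by (intro exI[of _ "2 / e"]) auto
  qed
  then show ?thesis using that S by blast
qed

text \<open>Outside the unit disc around \<open>\<mu>\<close> the division only decreases the
  modulus; inside, the maximum principle carries the bound over from the unit circle at the cost of
  \<open>W_shift\<close>. The constant is uniform in \<open>\<mu>\<close>, which every later bound
  on resolvents relies on.\<close>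

lemma diff_quot_le: "\<exists>C\<ge>1. \<forall>M f \<mu>. entire_le k M f \<longrightarrow> f \<mu> = 0 \<longrightarrow> entire_le k (C * M) (diff_quot f \<mu>)"
proof -
  obtain C where C: "C \<ge> 1" "\<And>u z. norm (u - z) \<le> 2 \<Longrightarrow> W k u \<le> C * W k z" using W_shift by blast
  have "entire_le k (C * M) (diff_quot f \<mu>)" if f: "entire_le k M f" and f0: "f \<mu> = 0" for M f \<mu>
    unfolding entire_le_def
  proof (intro conjI allI)
    show hol: "diff_quot f \<mu> holomorphic_on UNIV" using diff_quot_holomorphic entire_leD(1)[OF f] .
    have M0: "M \<ge> 0" using entire_le_nonneg[OF f] .
    have nd: "norm (diff_quot f \<mu> u) * norm (u - \<mu>) \<le> M * W k u" for u
      using diff_quot_mult[of u \<mu> f] entire_leD(2)[OF f, of u] f0 by (simp add: mult.commute flip: norm_mult)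
    fix z
    show "norm (diff_quot f \<mu> z) \<le> C * M * W k z"
    proof (cases "norm (z - \<mu>) < 1")
      case False
      then have "norm (diff_quot f \<mu> z) * 1 \<le> norm (diff_quot f \<mu> z) * norm (z - \<mu>)"
        by (intro mult_left_mono) auto
      also have "\<dots> \<le> M * W k z" by (rule nd)
      also have "\<dots> \<le> C * (M * W k z)" using mult_right_mono[OF C(1), of "M * W k z"] M0 W_pos[of k z] by simp
      finally show ?thesis by (simp add: mult.assoc)
    next
      case True
      show ?thesis
      proof (rule maximum_modulus_frontier[where f = "diff_quot f \<mu>" and S = "cball \<mu> 1" and \<xi> = z])
        show "diff_quot f \<mu> holomorphic_on interior (cball \<mu> 1)" using hol holomorphic_on_subset by blast
        show "continuous_on (closure (cball \<mu> 1)) (diff_quot f \<mu>)"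
          using holomorphic_on_imp_continuous_on[OF hol] continuous_on_subset by blast
        show "z \<in> cball \<mu> 1" using True by (simp add: dist_norm norm_minus_commute)
        fix u assume "u \<in> frontier (cball \<mu> 1)"
        then have u: "norm (u - \<mu>) = 1" by (simp add: frontier_cball dist_norm norm_minus_commute)
        have "norm (u - z) \<le> 2" using norm_triangle_ineq4[of "u - \<mu>" "z - \<mu>"] u True by simp
        then have "M * W k u \<le> M * (C * W k z)" using C(2) M0 by (intro mult_left_mono) auto
        then show "norm (diff_quot f \<mu> u) \<le> C * M * W k z" using nd[of u] u by (simp add: mult_ac)
      qed auto
    qed
  qed
  then show ?thesis using C(1) by blast
qed

text \<open>Without a zero at \<open>\<mu>\<close> the value \<open>f \<mu>\<close> has to be
  subtracted first, and the bound deteriorates like \<open>W k \<mu>\<close>. This is enough for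
  membership in the space and for local bounds in \<open>\<mu>\<close>.\<close>

lemma diff_quot_le': "\<exists>C\<ge>0. \<forall>M f \<mu>. entire_le k M f \<longrightarrow> entire_le k (C * M * W k \<mu>) (diff_quot f \<mu>)"
proof -
  obtain C where C: "C \<ge> 1" "\<And>M f \<mu>. entire_le k M f \<Longrightarrow> f \<mu> = 0 \<Longrightarrow> entire_le k (C * M) (diff_quot f \<mu>)"
    using diff_quot_le by blast
  have "entire_le k (2 * C * M * W k \<mu>) (diff_quot f \<mu>)" if f: "entire_le k M f" for M f \<mu>
  proof -
    have hol: "f holomorphic_on UNIV" using entire_leD(1)[OF f] .
    have M0: "M \<ge> 0" using entire_le_nonneg[OF f] .
    have "entire_le k (2 * M * W k \<mu>) (\<lambda>z. f z - f \<mu>)" unfolding entire_le_def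
    proof (intro conjI allI)
      show "(\<lambda>z. f z - f \<mu>) holomorphic_on UNIV" by (intro holomorphic_intros hol)
      fix z
      have "norm (f z - f \<mu>) \<le> norm (f z) + norm (f \<mu>)" by (rule norm_triangle_ineq4)
      also have "\<dots> \<le> M * W k z + M * W k \<mu>" using entire_leD(2)[OF f] by (intro add_mono)
      also have "M * W k z \<le> M * (W k \<mu> * W k z)"
        using M0 W_ge_1[of k \<mu>] W_pos[of k z] by (intro mult_left_mono) auto
      also have "M * W k \<mu> \<le> M * (W k \<mu> * W k z)"
        using M0 W_ge_1[of k z] W_pos[of k \<mu>] by (intro mult_left_mono) auto
      finally show "norm (f z - f \<mu>) \<le> 2 * M * W k \<mu> * W k z" by simp
    qed
    from C(2)[OF this, of \<mu>] have "entire_le k (C * (2 * M * W k \<mu>)) (diff_quot (\<lambda>z. f z - f \<mu>) \<mu>)" by simp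
    moreover have "diff_quot (\<lambda>z. f z - f \<mu>) \<mu> = diff_quot f \<mu>"
      by (rule diff_quot_eqI) (auto intro!: holomorphic_intros hol diff_quot_holomorphic simp: diff_quot_mult)
    ultimately show ?thesis by (simp add: mult_ac)
  qed
  then show ?thesis using C(1) by (intro exI[of _ "2 * C"]) auto
qed

lemma diff_quot_in_P: "f \<in> P \<Longrightarrow> diff_quot f \<mu> \<in> P"
  using diff_quot_le' P_iff by metis

end

section \<open>Resolvents of annihilating functionals\<close>

text \<open>Local quotients agree on overlaps, since a disagreement would make \<open>g\<close>
  vanish on an open set; their diagonal values therefore glue to an entire function.\<close>

lemma entire_quotient:
  fixes f g :: "complex \<Rightarrow> complex"
  assumes f: "f holomorphic_on UNIV" and g: "g holomorphic_on UNIV" "g v \<noteq> 0"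
    and loc: "\<And>z. \<exists>q r. r > 0 \<and> q holomorphic_on ball z r \<and> (\<forall>u\<in>ball z r. f u = g u * q u)"
  obtains h where "h holomorphic_on UNIV" "\<And>z. f z = g z * h z"
proof -
  obtain Q R where QR: "\<And>z. R z > 0" "\<And>z. Q z holomorphic_on ball z (R z)"
    "\<And>z u. u \<in> ball z (R z) \<Longrightarrow> f u = g u * Q z u"
    using loc by metis
  define h where "h = (\<lambda>z. Q z z)"
  have agree: "h u = Q z u" if u: "u \<in> ball z (R z)" for z u
  proof (rule ccontr)
    assume ne: "h u \<noteq> Q z u"
    define S where "S = ball u (R u) \<inter> ball z (R z)"
    have oS: "open S" and uS: "u \<in> S" using u QR(1) by (auto simp: S_def)
    define d where "d = (\<lambda>x. Q u x - Q z x)"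
    have "d holomorphic_on S" unfolding d_def S_def
      by (intro holomorphic_intros holomorphic_on_subset[OF QR(2)]) auto
    then have cd: "continuous_on S d" by (rule holomorphic_on_imp_continuous_on)
    have "open (S \<inter> d -` (- {0}))" using cd oS by (intro continuous_open_preimage) auto
    moreover have "u \<in> S \<inter> d -` (- {0})" using uS ne by (simp add: d_def h_def)
    moreover have "g x = 0" if "x \<in> S \<inter> d -` (- {0})" for x
    proof -
      have "g x * Q u x = g x * Q z x" using QR(3)[of x u] QR(3)[of x z] that by (auto simp: S_def)
      then show ?thesis using that by (auto simp: d_def)
    qed
    ultimately have "g v = 0" by (rule entire_zero_of_zero_on_open[OF g(1)])
    then show False using g(2) by simp
  qed
  show ?thesis
  proof (rule that[of h])
    have "h field_differentiable at z" for z
    proof -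
      have "h holomorphic_on ball z (R z)"
        by (rule holomorphic_transform[OF QR(2)]) (simp add: agree)
      then show ?thesis using QR(1)[of z] holomorphic_on_imp_differentiable_at[of h "ball z (R z)" z] by simp
    qed
    then show "h holomorphic_on UNIV" by (simp add: holomorphic_on_def)
    show "f z = g z * h z" for z using QR(3)[of z z] QR(1)[of z] by (simp add: h_def)
  qed
qed

lemma entire_order:
  assumes f: "f holomorphic_on UNIV" "f \<noteq> (\<lambda>_. 0)"
  obtains m g where "g holomorphic_on UNIV" "g \<mu> \<noteq> 0" "\<And>z. f z = (z - \<mu>) ^ m * g z"
    "vanishing_mult f \<mu> = enat m"
proof -
  have "\<exists>m g. g holomorphic_on UNIV \<and> g \<mu> \<noteq> 0 \<and> (\<forall>z. f z = (z - \<mu>) ^ m * g z)"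
  proof (cases "f \<mu> = 0")
    case False
    then show ?thesis using f(1) by (intro exI[of _ 0] exI[of _ f]) auto
  next
    case True
    have "\<not> f constant_on UNIV"
    proof
      assume "f constant_on UNIV"
      then obtain a where "\<And>z. f z = a" by (auto simp: constant_on_def)
      with True have "f = (\<lambda>_. 0)" by (metis (full_types))
      then show False using f(2) by simp
    qed
    then obtain g r n where g: "0 < n" "0 < r" "ball \<mu> r \<subseteq> UNIV" "g holomorphic_on ball \<mu> r"
      "\<And>u. u \<in> ball \<mu> r \<Longrightarrow> f u = (u - \<mu>) ^ n * g u" "\<And>u. u \<in> ball \<mu> r \<Longrightarrow> g u \<noteq> 0"
      using holomorphic_factor_zero_nonconstant[OF f(1) open_UNIV connected_UNIV UNIV_I True] by metis
    define G where "G = (\<lambda>z. if z \<in> ball \<mu> r then g z else f z / (z - \<mu>) ^ n)"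
    have G1: "G holomorphic_on ball \<mu> r"
      by (rule holomorphic_transform[OF g(4)]) (simp add: G_def)
    have "(\<lambda>z. f z / (z - \<mu>) ^ n) holomorphic_on - {\<mu>}"
      by (intro holomorphic_intros holomorphic_on_subset[OF f(1)]) auto
    then have G2: "G holomorphic_on - {\<mu>}"
      by (rule holomorphic_transform) (use g(5) in \<open>auto simp: G_def\<close>)
    have "ball \<mu> r \<union> - {\<mu>} = UNIV" using g(2) by auto
    then have "G holomorphic_on UNIV" using holomorphic_on_Un[OF G1 G2] by (simp add: open_Compl)
    moreover have "f z = (z - \<mu>) ^ n * G z" for z
      using g(2,5) by (cases "z = \<mu>") (auto simp: G_def)
    moreover have "G \<mu> \<noteq> 0" using g(2,6) by (simp add: G_def)
    ultimately show ?thesis by blast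
  qed
  then obtain m g where g: "g holomorphic_on UNIV" "g \<mu> \<noteq> 0" "\<And>z. f z = (z - \<mu>) ^ m * g z" by blast
  have "zorder f \<mu> = int m"
    by (rule zorder_eqI[of UNIV _ g]) (use g in \<open>auto simp: mult.commute\<close>)
  then have "vanishing_mult f \<mu> = enat m" using f(2) by (simp add: vanishing_mult_def)
  then show ?thesis using that g by blast
qed

text \<open>Multiplicity bounds become divisibility in the ring of entire functions; in this form
  the zero function with multiplicity \<open>\<infinity>\<close> is no exception.\<close>

lemma vanishing_mult_ge_iff:
  assumes f: "f holomorphic_on UNIV"
  shows "enat n \<le> vanishing_mult f \<mu> \<longleftrightarrow> (\<exists>q. q holomorphic_on UNIV \<and> (\<forall>z. f z = (z - \<mu>) ^ n * q z))"
proof (cases "f = (\<lambda>_. 0)")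
  case True
  then show ?thesis by (auto simp: vanishing_mult_def intro!: exI[of _ "\<lambda>_. 0"])
next
  case False
  obtain m g where g: "g holomorphic_on UNIV" "g \<mu> \<noteq> 0" "\<And>z. f z = (z - \<mu>) ^ m * g z"
    "vanishing_mult f \<mu> = enat m" using entire_order[OF f False] by blast
  show ?thesis
  proof
    assume "enat n \<le> vanishing_mult f \<mu>"
    then have nm: "n \<le> m" by (simp add: g(4))
    show "\<exists>q. q holomorphic_on UNIV \<and> (\<forall>z. f z = (z - \<mu>) ^ n * q z)"
      using nm by (intro exI[of _ "\<lambda>z. (z - \<mu>) ^ (m - n) * g z"])
         (auto intro!: holomorphic_intros g(1) simp: g(3) simp flip: mult.assoc power_add)
  next
    assume "\<exists>q. q holomorphic_on UNIV \<and> (\<forall>z. f z = (z - \<mu>) ^ n * q z)"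
    then obtain q where q: "q holomorphic_on UNIV" "\<And>z. f z = (z - \<mu>) ^ n * q z" by blast
    have "n \<le> m"
    proof (rule ccontr)
      assume "\<not> n \<le> m"
      then have nm: "m < n" by simp
      have "g \<mu> - (\<mu> - \<mu>) ^ (n - m) * q \<mu> = 0"
      proof (rule entire_mult_eq_zero[of "\<lambda>z. (z - \<mu>) ^ m" "\<lambda>z. g z - (z - \<mu>) ^ (n - m) * q z" "\<mu> + 1"])
        fix z
        have "(z - \<mu>) ^ m * ((z - \<mu>) ^ (n - m) * q z) = (z - \<mu>) ^ n * q z"
          using nm by (simp flip: mult.assoc power_add)
        then show "(z - \<mu>) ^ m * (g z - (z - \<mu>) ^ (n - m) * q z) = 0"
          using g(3)[of z] q(2)[of z] by (simp only: right_diff_distrib diff_self)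
      qed (auto intro!: holomorphic_intros g(1) q(1))
      then show False using g(2) nm by simp
    qed
    then show "enat n \<le> vanishing_mult f \<mu>" by (simp add: g(4))
  qed
qed

lemma vanishing_mult_pos:
  assumes f: "f holomorphic_on UNIV" and "f \<mu> = 0"
  shows "0 < vanishing_mult f \<mu>"
proof -
  obtain q where "q holomorphic_on UNIV" "\<And>z. f z = (z - \<mu>) * q z"
    using holomorphic_zero_factor[OF f open_UNIV assms(2)] by blast
  then have "enat 1 \<le> vanishing_mult f \<mu>" unfolding vanishing_mult_ge_iff[OF f] by auto
  then show ?thesis by (metis i0_less not_one_le_zero one_enat_def)
qed

lemma vanishing_mult_zero:
  assumes f: "f holomorphic_on UNIV" and "f \<mu> \<noteq> 0"
  shows "vanishing_mult f \<mu> = 0"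
proof (rule ccontr)
  assume "vanishing_mult f \<mu> \<noteq> 0"
  then have "enat 1 \<le> vanishing_mult f \<mu>" by (metis ileI1 i0_less one_eSuc one_enat_def)
  then obtain q where "\<And>z. f z = (z - \<mu>) ^ 1 * q z" unfolding vanishing_mult_ge_iff[OF f] by blast
  then have "f \<mu> = (\<mu> - \<mu>) ^ 1 * q \<mu>" by blast
  then show False using assms(2) by simp
qed

lemma vanishing_mult_times:
  assumes f: "f holomorphic_on UNIV" and g: "g holomorphic_on UNIV"
  shows "vanishing_mult f \<mu> \<le> vanishing_mult (\<lambda>z. f z * g z) \<mu>"
proof (cases "f = (\<lambda>_. 0)")
  case False
  obtain m h where h: "h holomorphic_on UNIV" "h \<mu> \<noteq> 0" "\<And>z. f z = (z - \<mu>) ^ m * h z"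
    "vanishing_mult f \<mu> = enat m" using entire_order[OF f False] by blast
  have "\<exists>q. q holomorphic_on UNIV \<and> (\<forall>z. f z * g z = (z - \<mu>) ^ m * q z)"
    by (intro exI[of _ "\<lambda>z. h z * g z"]) (auto intro!: holomorphic_intros h(1) g simp: h(3))
  then have "enat m \<le> vanishing_mult (\<lambda>z. f z * g z) \<mu>"
    by (subst vanishing_mult_ge_iff) (auto intro!: holomorphic_intros f g)
  then show ?thesis by (simp add: h(4))
qed (simp add: vanishing_mult_def)

section \<open>Stable submodules and the functions vanishing on their zero set\<close>

locale submodule_setting = weight_seqs +
  fixes J :: "(complex \<Rightarrow> complex) set"
  assumes closed_J: "closed_submodule w r c J" and stable_J: "stable_submodule J"
    and nontrivial_J: "J \<noteq> {\<lambda>_. 0}"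
begin

lemma J_closedin: "closedin (P_top w r c) J" using closed_J by (simp add: closed_submodule_def)

lemma J_sub_P: "J \<subseteq> P" using closedin_subset[OF J_closedin] by (simp add: topspace_P_top)

lemma J_holomorphic: "f \<in> J \<Longrightarrow> f holomorphic_on UNIV" using J_sub_P P_holomorphic by blast

lemma J_poly: "f \<in> J \<Longrightarrow> (\<lambda>z. poly p z * f z) \<in> J" using closed_J by (simp add: closed_submodule_def)

lemma J_subspace: "complex_subspace J"
  unfolding complex_subspace_def
proof (intro conjI ballI allI)
  show "(\<lambda>_. 0) \<in> J" using closed_J by (simp add: closed_submodule_def)
  fix x y and \<alpha> \<beta> :: complex assume "x \<in> J" "y \<in> J"
  then have "(\<lambda>z. \<alpha> * x z) \<in> J" "(\<lambda>z. \<beta> * y z) \<in> J"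
    using J_poly[of x "[:\<alpha>:]"] J_poly[of y "[:\<beta>:]"] by simp_all
  then show "(\<lambda>z. \<alpha> * x z + \<beta> * y z) \<in> J" using closed_J by (simp add: closed_submodule_def)
qed

lemma J_nonzero: obtains f u where "f \<in> J" "f u \<noteq> 0"
proof -
  have "(\<lambda>_. 0) \<in> J" using complex_subspaceD(1)[OF J_subspace] .
  then obtain f where "f \<in> J" "f \<noteq> (\<lambda>_. 0)" using nontrivial_J by blast
  then show ?thesis using that by (metis (full_types) ext)
qed

definition admissible :: "(complex \<Rightarrow> complex) \<Rightarrow> bool" where
  "admissible f \<longleftrightarrow> f \<in> P \<and> (\<forall>\<mu>. zero_set J \<mu> \<le> vanishing_mult f \<mu>)"

text \<open>Extended natural numbers are well ordered, so the infimum is a minimum, and a nonzero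
  member of \<open>J\<close> makes it finite.\<close>

lemma zero_set_attained: obtains f n where "f \<in> J" "zero_set J \<mu> = enat n" "vanishing_mult f \<mu> = enat n" "f \<noteq> (\<lambda>_. 0)"
proof -
  define A where "A = (\<lambda>f. vanishing_mult f \<mu>) ` J"
  obtain f u where f: "f \<in> J" "f u \<noteq> 0" by (rule J_nonzero)
  have fA: "vanishing_mult f \<mu> \<in> A" using f by (auto simp: A_def)
  have fin: "vanishing_mult f \<mu> \<noteq> \<infinity>" using f(2) by (auto simp: vanishing_mult_def)
  have z: "zero_set J \<mu> = Inf A" by (simp add: zero_set_def A_def)
  have "Inf A \<in> A" unfolding Inf_enat_def using fA LeastI[of "\<lambda>x. x \<in> A"] by auto
  moreover have "Inf A \<le> vanishing_mult f \<mu>" using fA by (rule Inf_lower)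
  ultimately have "\<exists>g\<in>J. Inf A = vanishing_mult g \<mu> \<and> vanishing_mult g \<mu> \<le> vanishing_mult f \<mu>"
    by (auto simp only: A_def)
  then obtain g where g: "g \<in> J" "Inf A = vanishing_mult g \<mu>" "vanishing_mult g \<mu> \<noteq> \<infinity>"
    using fin by (metis enat_ord_simps(5))
  then obtain n where "vanishing_mult g \<mu> = enat n" by auto
  moreover have "g \<noteq> (\<lambda>_. 0)" using g(3) by (auto simp: vanishing_mult_def)
  ultimately show ?thesis using that g z by auto
qed

lemma J_admissible: "f \<in> J \<Longrightarrow> admissible f"
  unfolding admissible_def zero_set_def using J_sub_P by (auto intro: INF_lower)

lemma admissible_times:
  assumes "admissible f" "g holomorphic_on UNIV" "(\<lambda>z. f z * g z) \<in> P"
  shows "admissible (\<lambda>z. f z * g z)"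
  unfolding admissible_def
proof (intro conjI allI)
  fix \<mu>
  have f: "f \<in> P" "zero_set J \<mu> \<le> vanishing_mult f \<mu>" using assms(1) by (auto simp: admissible_def)
  note f(2)
  also have "vanishing_mult f \<mu> \<le> vanishing_mult (\<lambda>z. f z * g z) \<mu>"
    by (rule vanishing_mult_times[OF P_holomorphic[OF f(1)] assms(2)])
  finally show "zero_set J \<mu> \<le> vanishing_mult (\<lambda>z. f z * g z) \<mu>" .
qed (rule assms(3))

end

section \<open>Transforms and resolvents of an annihilating functional\<close>

locale annihilator = submodule_setting +
  fixes S :: "(complex \<Rightarrow> complex) \<Rightarrow> complex"
  assumes S_linear: "linear_functional_on P S" and S_bounded: "step_bounded S"
    and S_J: "\<And>f. f \<in> J \<Longrightarrow> S f = 0"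
begin

lemma S_lincomb: "f \<in> P \<Longrightarrow> g \<in> P \<Longrightarrow> S (\<lambda>z. \<alpha> * f z + \<beta> * g z) = \<alpha> * S f + \<beta> * S g"
  using S_linear by (simp add: linear_functional_on_def)

text \<open>Dividing \<open>f\<close> itself by \<open>z - \<mu>\<close> leaves the entire functions
  when \<open>f \<mu> \<noteq> 0\<close>; the difference quotient is the substitute to which
  \<open>S\<close> can be applied for every \<open>\<mu>\<close>.\<close>

definition trf :: "(complex \<Rightarrow> complex) \<Rightarrow> complex \<Rightarrow> complex" where
  "trf f \<mu> = S (diff_quot f \<mu>)"

lemma trf_resolvent:
  assumes f: "f \<in> P" shows "trf f \<nu> = trf f \<mu> + (\<nu> - \<mu>) * trf (diff_quot f \<mu>) \<nu>"
  unfolding trf_def diff_quot_resolvent[OF P_holomorphic[OF f], of \<nu> \<mu>]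
  by (subst S_lincomb) (use diff_quot_in_P f in auto)

lemma trf_locally_bounded:
  assumes f: "f \<in> P" obtains B where "\<And>\<nu>. norm (\<nu> - \<mu>) \<le> 2 \<Longrightarrow> norm (trf f \<nu>) \<le> B"
proof -
  obtain k M where f: "entire_le k M f" using f P_iff by blast
  have M0: "M \<ge> 0" using entire_le_nonneg[OF f] .
  obtain C where C: "C \<ge> 0" "\<And>M f \<mu>. entire_le k M f \<Longrightarrow> entire_le k (C * M * W k \<mu>) (diff_quot f \<mu>)"
    using diff_quot_le' by blast
  obtain D where D: "D \<ge> 0" "\<And>M f. entire_le k M f \<Longrightarrow> norm (S f) \<le> D * M"
    using S_bounded unfolding step_bounded_def by blast
  obtain E where E: "E \<ge> 1" "\<And>u z. norm (u - z) \<le> 2 \<Longrightarrow> W k u \<le> E * W k z" using W_shift by blast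
  show ?thesis
  proof (rule that)
    fix \<nu> assume \<nu>: "norm (\<nu> - \<mu>) \<le> 2"
    have "norm (trf f \<nu>) \<le> D * (C * M * W k \<nu>)" unfolding trf_def by (rule D(2)[OF C(2)[OF f]])
    also have "\<dots> \<le> D * (C * M * (E * W k \<mu>))"
      using C(1) D(1) M0 E(2)[OF \<nu>] by (intro mult_left_mono) auto
    finally show "norm (trf f \<nu>) \<le> D * (C * M * (E * W k \<mu>))" .
  qed
qed

lemma trf_continuous:
  assumes f: "f \<in> P" shows "isCont (trf f) \<mu>"
proof -
  obtain B where B: "\<And>\<nu>. norm (\<nu> - \<mu>) \<le> 2 \<Longrightarrow> norm (trf (diff_quot f \<mu>) \<nu>) \<le> B"
    using trf_locally_bounded[OF diff_quot_in_P[OF f]] by blast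
  have "((\<lambda>\<nu>. trf f \<nu> - trf f \<mu>) \<longlongrightarrow> 0) (at \<mu>)"
  proof (rule Lim_null_comparison)
    have lim: "((\<lambda>\<nu>. norm (\<nu> - \<mu>)) \<longlongrightarrow> 0) (at \<mu>)" by (auto intro!: tendsto_eq_intros)
    have "\<forall>\<^sub>F \<nu> in at \<mu>. norm (\<nu> - \<mu>) < 2" using order_tendstoD(2)[OF lim, of 2] by simp
    then show "\<forall>\<^sub>F \<nu> in at \<mu>. norm (trf f \<nu> - trf f \<mu>) \<le> norm (\<nu> - \<mu>) * B"
    proof eventually_elim
      case (elim \<nu>)
      have "trf f \<nu> - trf f \<mu> = (\<nu> - \<mu>) * trf (diff_quot f \<mu>) \<nu>" using trf_resolvent[OF f, of \<nu> \<mu>] by simp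
      then have "norm (trf f \<nu> - trf f \<mu>) = norm (\<nu> - \<mu>) * norm (trf (diff_quot f \<mu>) \<nu>)" by (simp add: norm_mult)
      also have "\<dots> \<le> norm (\<nu> - \<mu>) * B" using B[of \<nu>] elim by (intro mult_left_mono) auto
      finally show ?case .
    qed
    show "((\<lambda>\<nu>. norm (\<nu> - \<mu>) * B) \<longlongrightarrow> 0) (at \<mu>)" using tendsto_mult_left_zero[OF lim] .
  qed
  then show ?thesis unfolding isCont_def using LIM_zero_iff by blast
qed

lemma trf_holomorphic:
  assumes f: "f \<in> P" shows "trf f holomorphic_on UNIV"
  unfolding holomorphic_on_def
proof
  fix \<mu> :: complex
  have "(trf f has_field_derivative trf (diff_quot f \<mu>) \<mu>) (at \<mu>)"
    unfolding has_field_derivative_iff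
  proof (rule Lim_transform_eventually)
    show "(trf (diff_quot f \<mu>) \<longlongrightarrow> trf (diff_quot f \<mu>) \<mu>) (at \<mu>)"
      using trf_continuous[OF diff_quot_in_P[OF f]] by (simp add: isCont_def)
    show "\<forall>\<^sub>F \<nu> in at \<mu>. trf (diff_quot f \<mu>) \<nu> = (trf f \<nu> - trf f \<mu>) / (\<nu> - \<mu>)"
    proof -
      have "\<forall>\<^sub>F \<nu> in at \<mu>. \<nu> \<noteq> \<mu>" by (simp add: eventually_at_filter)
      then show ?thesis
      proof eventually_elim
        case (elim \<nu>)
        have "trf f \<nu> - trf f \<mu> = (\<nu> - \<mu>) * trf (diff_quot f \<mu>) \<nu>"
          using trf_resolvent[OF f, of \<nu> \<mu>] by simp
        then show ?case using elim by simp
      qed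
    qed
  qed
  then show "trf f field_differentiable at \<mu> within UNIV"
    by (auto simp: field_differentiable_def)
qed

definition bil :: "(complex \<Rightarrow> complex) \<Rightarrow> (complex \<Rightarrow> complex) \<Rightarrow> complex \<Rightarrow> complex" where
  "bil f g \<mu> = f \<mu> * trf g \<mu> - g \<mu> * trf f \<mu>"

lemma bil_holomorphic: "f \<in> P \<Longrightarrow> g \<in> P \<Longrightarrow> bil f g holomorphic_on UNIV"
  unfolding bil_def by (intro holomorphic_intros trf_holomorphic P_holomorphic)

lemma bil_eq:
  assumes f: "f \<in> P" and g: "g \<in> P"
  shows "bil f g \<mu> = S (diff_quot (\<lambda>z. f \<mu> * g z + (- g \<mu>) * f z) \<mu>)"
  unfolding diff_quot_lincomb[OF P_holomorphic[OF g] P_holomorphic[OF f]]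
  by (subst S_lincomb) (use diff_quot_in_P f g in \<open>auto simp: bil_def trf_def\<close>)

text \<open>The combination of \<open>f\<close> and \<open>g\<close> under \<open>S\<close> vanishes
  at \<open>\<mu>\<close>, so the uniform estimate \<open>diff_quot_le\<close> applies and
  \<open>\<mu>\<close> enters only through the values \<open>f \<mu>\<close> and
  \<open>g \<mu>\<close>.\<close>

lemma bil_bound:
  "\<exists>B\<ge>0. \<forall>M N f g. entire_le k M f \<longrightarrow> entire_le k N g \<longrightarrow>
     (\<forall>\<mu>. norm (bil f g \<mu>) \<le> B * (norm (f \<mu>) * N + norm (g \<mu>) * M))"
proof -
  obtain C where C: "C \<ge> 1" "\<And>M f \<mu>. entire_le k M f \<Longrightarrow> f \<mu> = 0 \<Longrightarrow> entire_le k (C * M) (diff_quot f \<mu>)"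
    using diff_quot_le by blast
  obtain D where D: "D \<ge> 0" "\<And>M f. entire_le k M f \<Longrightarrow> norm (S f) \<le> D * M"
    using S_bounded unfolding step_bounded_def by blast
  have "norm (bil f g \<mu>) \<le> D * C * (norm (f \<mu>) * N + norm (g \<mu>) * M)"
    if f: "entire_le k M f" and g: "entire_le k N g" for M N f g \<mu>
  proof -
    have fg: "f \<in> P" "g \<in> P" using f g P_iff by blast+
    have "entire_le k (norm (f \<mu>) * N + norm (- g \<mu>) * M) (\<lambda>z. f \<mu> * g z + (- g \<mu>) * f z)"
      by (rule entire_le_lincomb[OF g f])
    from C(2)[OF this, of \<mu>]
    have "entire_le k (C * (norm (f \<mu>) * N + norm (- g \<mu>) * M)) (diff_quot (\<lambda>z. f \<mu> * g z + (- g \<mu>) * f z) \<mu>)"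
      by simp
    from D(2)[OF this] show ?thesis unfolding bil_eq[OF fg] by (simp add: mult.assoc)
  qed
  then show ?thesis using C(1) D(1) by (intro exI[of _ "D * C"]) auto
qed

text \<open>Here stability is used. Where some \<open>h\<close> in \<open>J\<close> does not vanish,
  the minimal multiplicity is \<open>0\<close>, so the combination of \<open>f\<close> and
  \<open>g\<close> vanishing at \<open>\<mu>\<close> may be divided by \<open>z - \<mu>\<close>
  inside \<open>J\<close>, and \<open>S\<close> annihilates the quotient. The zeros of
  \<open>h\<close> are covered by the identity theorem.\<close>

lemma bil_J:
  assumes f: "f \<in> J" and g: "g \<in> J" shows "bil f g \<mu> = 0"
proof -
  have fg: "f \<in> P" "g \<in> P" using f g J_sub_P by auto
  obtain h u where h: "h \<in> J" "h u \<noteq> 0" by (rule J_nonzero)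
  have "bil f g \<mu> = 0" if "h \<mu> \<noteq> 0" for \<mu>
  proof -
    have "zero_set J \<mu> \<le> vanishing_mult h \<mu>" using J_admissible[OF h(1)] by (simp add: admissible_def)
    then have z: "zero_set J \<mu> = 0" using vanishing_mult_zero[OF J_holomorphic[OF h(1)] that] by simp
    define v where "v = (\<lambda>z. f \<mu> * g z + (- g \<mu>) * f z)"
    have vJ: "v \<in> J" unfolding v_def using complex_subspaceD(2)[OF J_subspace g f] .
    have v0: "v \<mu> = 0" by (simp add: v_def)
    have "vanishing_mult v \<mu> > zero_set J \<mu>"
      using vanishing_mult_pos[OF J_holomorphic[OF vJ] v0] z by simp
    then have "divide_root v \<mu> \<in> J"
      using stable_J vJ unfolding stable_submodule_def stable_at_def by blast
    then have "S (diff_quot v \<mu>) = 0" using S_J divide_root_eq_diff_quot[of v, OF v0] by simp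
    then show ?thesis unfolding bil_eq[OF fg] v_def .
  qed
  then have "h \<mu> * bil f g \<mu> = 0" for \<mu> by (cases "h \<mu> = 0") auto
  then show ?thesis using entire_mult_eq_zero[OF J_holomorphic[OF h(1)] bil_holomorphic[OF fg] _ h(2)] by blast
qed

text \<open>The function \<open>G\<close> of the overview, with its defining quotient multiplied out
  so that zeros of \<open>f\<close> need no exception.\<close>

definition resolvent_of :: "(complex \<Rightarrow> complex) \<Rightarrow> (complex \<Rightarrow> complex) \<Rightarrow> bool" where
  "resolvent_of g G \<longleftrightarrow> G holomorphic_on UNIV \<and> (\<forall>f\<in>J. \<forall>\<mu>. f \<mu> * G \<mu> = bil f g \<mu>)"

text \<open>Because \<open>bil\<close> vanishes on pairs from \<open>J\<close>, the meromorphic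
  quotient of \<open>bil f g\<close> by \<open>f\<close> does not depend on \<open>f\<close> in
  \<open>J\<close>.\<close>

lemma bil_exchange:
  assumes "f \<in> J" "f' \<in> J" shows "f \<mu> * bil f' g \<mu> = f' \<mu> * bil f g \<mu>"
proof -
  have "f \<mu> * bil f' g \<mu> - f' \<mu> * bil f g \<mu> = - g \<mu> * bil f f' \<mu>" by (simp add: bil_def algebra_simps)
  then show ?thesis using bil_J[OF assms] by simp
qed

text \<open>Near \<open>z\<close> the quotient is formed with a member \<open>f'\<close> of
  \<open>J\<close> of minimal multiplicity \<open>n\<close> at \<open>z\<close>. Admissibility
  provides the same power of \<open>v - z\<close> in \<open>g\<close>, and after cancellation the
  denominator \<open>h\<close> does not vanish at \<open>z\<close>.\<close>

lemma resolvent_exists: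
  assumes g: "admissible g" obtains G where "resolvent_of g G"
proof -
  have gP: "g \<in> P" using g by (simp add: admissible_def)
  note holg = P_holomorphic[OF gP]
  obtain f u where f: "f \<in> J" "f u \<noteq> 0" by (rule J_nonzero)
  have fP: "f \<in> P" using f J_sub_P by auto
  note holf = P_holomorphic[OF fP]
  have "\<exists>q r. r > 0 \<and> q holomorphic_on ball z r \<and> (\<forall>v\<in>ball z r. bil f g v = f v * q v)" for z
  proof -
    obtain f' n where f': "f' \<in> J" "zero_set J z = enat n" "vanishing_mult f' z = enat n" "f' \<noteq> (\<lambda>_. 0)"
      by (rule zero_set_attained)
    have f'P: "f' \<in> P" using f' J_sub_P by auto
    obtain h where h: "h holomorphic_on UNIV" "h z \<noteq> 0" "\<And>v. f' v = (v - z) ^ n * h v"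
      using entire_order[OF P_holomorphic[OF f'P] f'(4), of z] f'(3) by (metis enat.inject)
    have "enat n \<le> vanishing_mult g z" using g f'(2) by (metis admissible_def)
    then obtain p where p: "p holomorphic_on UNIV" "\<And>v. g v = (v - z) ^ n * p v"
      unfolding vanishing_mult_ge_iff[OF holg] by blast
    have "isCont h z" using h(1) holomorphic_on_imp_continuous_on continuous_on_eq_continuous_at open_UNIV by blast
    then obtain r where r: "r > 0" "\<And>v. v \<in> ball z r \<Longrightarrow> h v \<noteq> 0"
      using continuous_at_avoid[of z h 0] h(2) by (auto simp: dist_commute)
    define q where "q = (\<lambda>v. (h v * trf g v - p v * trf f' v) / h v)"
    \<comment> \<open>The exchange identity for \<open>f\<close> and \<open>f'\<close>, with the
      common factor \<open>(v - z) ^ n\<close> removed; it is recovered from the original one by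
      cancelling an entire factor.\<close>
    define t where "t = (\<lambda>v. f v * (h v * trf g v - p v * trf f' v) - h v * bil f g v)"
    have "t v = 0" for v
    proof (rule entire_mult_eq_zero[of "\<lambda>v. (v - z) ^ n" t "z + 1"])
      show "t holomorphic_on UNIV" unfolding t_def
        by (intro holomorphic_intros holf h p trf_holomorphic gP f'P bil_holomorphic fP)
      show "(v - z) ^ n * t v = 0" for v
      proof -
        have "(v - z) ^ n * t v = f v * (((v - z) ^ n * h v) * trf g v - ((v - z) ^ n * p v) * trf f' v) - ((v - z) ^ n * h v) * bil f g v"
          by (simp add: t_def algebra_simps)
        also have "\<dots> = f v * bil f' g v - f' v * bil f g v"
          unfolding h(3)[symmetric] p(2)[symmetric] by (simp add: bil_def)
        finally show ?thesis using bil_exchange[OF f(1) f'(1)] by simp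
      qed
    qed (auto intro!: holomorphic_intros)
    then have t0: "f v * (h v * trf g v - p v * trf f' v) = h v * bil f g v" for v
      unfolding t_def by (metis eq_iff_diff_eq_0)
    have "bil f g v = f v * q v" if "v \<in> ball z r" for v
      using t0[of v] r(2)[OF that] by (simp add: q_def field_simps)
    moreover have "q holomorphic_on ball z r" unfolding q_def
      by (intro holomorphic_intros holomorphic_on_subset[OF h(1)] holomorphic_on_subset[OF p(1)]
          holomorphic_on_subset[OF trf_holomorphic[OF gP]] holomorphic_on_subset[OF trf_holomorphic[OF f'P]])
         (use r in auto)
    ultimately show ?thesis using r(1) by blast
  qed
  then obtain G where G: "G holomorphic_on UNIV" "\<And>z. bil f g z = f z * G z"
    using entire_quotient[OF bil_holomorphic[OF fP gP] holf f(2)] by metis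
  have "f' \<mu> * G \<mu> = bil f' g \<mu>" if f': "f' \<in> J" for f' \<mu>
  proof -
    have f'P: "f' \<in> P" using f' J_sub_P by auto
    have "f' \<mu> * G \<mu> - bil f' g \<mu> = 0"
    proof (rule entire_mult_eq_zero[of f "\<lambda>v. f' v * G v - bil f' g v", OF holf _ _ f(2)])
      show "(\<lambda>v. f' v * G v - bil f' g v) holomorphic_on UNIV"
        by (intro holomorphic_intros P_holomorphic f'P G bil_holomorphic gP)
      show "f v * (f' v * G v - bil f' g v) = 0" for v
      proof -
        have "f v * (f' v * G v - bil f' g v) = f' v * (f v * G v) - f v * bil f' g v" by (simp add: algebra_simps)
        also have "f' v * (f v * G v) = f v * bil f' g v"
          using bil_exchange[OF f' f(1)] by (simp only: G(2)[symmetric])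
        finally show ?thesis by simp
      qed
    qed
    then show ?thesis by simp
  qed
  then have "resolvent_of g G" using G(1) by (simp add: resolvent_of_def)
  then show ?thesis by (rule that)
qed

lemma resolvent_unique:
  assumes "resolvent_of g G" "resolvent_of g G'" shows "G z = G' z"
proof -
  obtain f u where f: "f \<in> J" "f u \<noteq> 0" by (rule J_nonzero)
  have "G z - G' z = 0"
  proof (rule entire_mult_eq_zero[of f "\<lambda>v. G v - G' v", OF J_holomorphic[OF f(1)] _ _ f(2)])
    show "(\<lambda>v. G v - G' v) holomorphic_on UNIV"
      using assms by (intro holomorphic_intros) (auto simp: resolvent_of_def)
    show "f v * (G v - G' v) = 0" for v
      using assms f(1) by (simp add: resolvent_of_def right_diff_distrib)
  qed
  then show ?thesis by simp
qed

lemma trf_times_ident: "f \<in> P \<Longrightarrow> trf (\<lambda>z. z * f z) \<mu> = S f + \<mu> * trf f \<mu>"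
  unfolding trf_def diff_quot_times_ident[OF P_holomorphic]
  by (subst S_lincomb) (auto simp: diff_quot_in_P)

lemma resolvent_times_ident:
  assumes g: "g \<in> P" and G: "resolvent_of g G"
  shows "resolvent_of (\<lambda>z. z * g z) (\<lambda>\<mu>. S g + \<mu> * G \<mu>)"
  unfolding resolvent_of_def
proof (intro conjI ballI allI)
  show "(\<lambda>\<mu>. S g + \<mu> * G \<mu>) holomorphic_on UNIV"
    using G by (intro holomorphic_intros) (auto simp: resolvent_of_def)
  fix f \<mu> assume f: "f \<in> J"
  have "f \<mu> * (S g + \<mu> * G \<mu>) = f \<mu> * S g + \<mu> * (f \<mu> * G \<mu>)" by (simp add: algebra_simps)
  also have "\<dots> = f \<mu> * S g + \<mu> * bil f g \<mu>" using G f by (simp add: resolvent_of_def)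
  also have "\<dots> = bil f (\<lambda>z. z * g z) \<mu>" by (simp add: bil_def trf_times_ident[OF g] algebra_simps)
  finally show "f \<mu> * (S g + \<mu> * G \<mu>) = bil f (\<lambda>z. z * g z) \<mu>" .
qed

text \<open>Both resolvents are constant by Liouville's theorem, while the second is a polynomial in
  \<open>\<mu>\<close> with linear coefficient \<open>S g\<close> and quadratic coefficient
  \<open>a\<close>. With a single factor \<open>z\<close> the number \<open>S g\<close> would only
  be the constant term, hence the use of \<open>z\<^sup>2 g\<close>.\<close>

lemma annihilates_of_bounded:
  assumes g: "g \<in> P" "(\<lambda>z. z * g z) \<in> P"
    and G: "resolvent_of g G" and B: "\<And>z. norm (G z) \<le> B"
    and G': "resolvent_of (\<lambda>z. z * (z * g z)) G'" and B': "\<And>z. norm (G' z) \<le> B'"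
  shows "S g = 0"
proof -
  have lin: "G' \<mu> = S (\<lambda>z. z * g z) + \<mu> * (S g + \<mu> * G \<mu>)" for \<mu>
    by (rule resolvent_unique[OF G' resolvent_times_ident[OF g(2) resolvent_times_ident[OF g(1) G]]])
  have "bounded (range G)" using B by (auto intro!: boundedI)
  then obtain a where a: "\<And>z. G z = a"
    using Liouville_theorem[of G] G by (auto simp: resolvent_of_def constant_on_def)
  have "bounded (range G')" using B' by (auto intro!: boundedI)
  then obtain b where b: "\<And>z. G' z = b"
    using Liouville_theorem[of G'] G' by (auto simp: resolvent_of_def constant_on_def)
  have e: "b = S (\<lambda>z. z * g z) + \<mu> * (S g + \<mu> * a)" for \<mu> using lin[of \<mu>] a b by simp
  have "S g + a = 0" using e[of 0] e[of 1] by simp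
  moreover have "- S g + a = 0" using e[of 0] e[of "-1"] by simp
  ultimately have "(S g + a) - (- S g + a) = 0" by simp
  then show ?thesis by simp
qed

end

text \<open>\<open>upper_type f h\<close> and \<open>upper_big f h\<close> bound the indicator of \<open>f\<close> in the direction \<open>\<i>\<close> from
  above and below; the direction \<open>-\<i>\<close> is treated by reflecting \<open>f\<close>, whence the sign \<open>s\<close> in what follows.\<close>

definition upper_type :: "(complex \<Rightarrow> complex) \<Rightarrow> real \<Rightarrow> bool" where
  "upper_type f h \<longleftrightarrow> (\<exists>A. \<forall>y\<ge>0. norm (f (\<i> * of_real y)) \<le> A * exp (h * y))"

definition upper_big :: "(complex \<Rightarrow> complex) \<Rightarrow> real \<Rightarrow> bool" where
  "upper_big f h \<longleftrightarrow> (\<forall>Y. \<exists>y\<ge>Y. exp (h * y) \<le> norm (f (\<i> * of_real y)))"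

lemma upper_typeE:
  assumes "upper_type f h"
  obtains A where "A \<ge> 0" "\<And>y. y \<ge> 0 \<Longrightarrow> norm (f (\<i> * of_real y)) \<le> A * exp (h * y)"
proof -
  obtain A where A: "\<And>y. y \<ge> 0 \<Longrightarrow> norm (f (\<i> * of_real y)) \<le> A * exp (h * y)"
    using assms by (auto simp: upper_type_def)
  have "0 \<le> A" using order_trans[OF norm_ge_zero A[of 0]] by simp
  then show ?thesis using A that by blast
qed

lemma upper_type_mono: "upper_type f h \<Longrightarrow> h \<le> h' \<Longrightarrow> upper_type f h'"
proof -
  assume "upper_type f h" and h: "h \<le> h'"
  then obtain A where A: "A \<ge> 0" "\<And>y. y \<ge> 0 \<Longrightarrow> norm (f (\<i> * of_real y)) \<le> A * exp (h * y)"
    using upper_typeE by metis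
  have "norm (f (\<i> * of_real y)) \<le> A * exp (h' * y)" if y: "y \<ge> 0" for y
  proof -
    have "h * y \<le> h' * y" using h y by (rule mult_right_mono)
    then have "A * exp (h * y) \<le> A * exp (h' * y)" using A(1) by (intro mult_left_mono) auto
    then show ?thesis using A(2)[OF y] by linarith
  qed
  then show ?thesis by (auto simp: upper_type_def)
qed

lemma upper_big_mono: "upper_big f h \<Longrightarrow> h' \<le> h \<Longrightarrow> upper_big f h'"
proof -
  assume f: "upper_big f h" and h: "h' \<le> h"
  show ?thesis unfolding upper_big_def
  proof
    fix Y
    obtain y where y: "y \<ge> max Y 0" "exp (h * y) \<le> norm (f (\<i> * of_real y))"
      using f unfolding upper_big_def by blast
    have "h' * y \<le> h * y" using h y by (intro mult_right_mono) auto
    then have "exp (h' * y) \<le> norm (f (\<i> * of_real y))" using y(2) by (meson exp_le_cancel_iff order_trans)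
    then show "\<exists>y\<ge>Y. exp (h' * y) \<le> norm (f (\<i> * of_real y))" using y(1) by auto
  qed
qed

lemma upper_type_times_ident:
  assumes "upper_type f h" "h < h'" shows "upper_type (\<lambda>z. z * f z) h'"
proof -
  obtain A where A: "A \<ge> 0" "\<And>y. y \<ge> 0 \<Longrightarrow> norm (f (\<i> * of_real y)) \<le> A * exp (h * y)"
    using upper_typeE[OF assms(1)] by metis
  define d where "d = h' - h"
  have d: "d > 0" using assms(2) by (simp add: d_def)
  have "norm (\<i> * of_real y * f (\<i> * of_real y)) \<le> (A / d) * exp (h' * y)" if y: "y \<ge> 0" for y
  proof -
    have "d * y \<le> exp (d * y)" using exp_ge_add_one_self[of "d * y"] by linarith
    then have "y \<le> exp (d * y) / d" using d by (simp add: le_divide_eq mult.commute)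
    then have "y * norm (f (\<i> * of_real y)) \<le> (exp (d * y) / d) * (A * exp (h * y))"
      using A(2)[OF y] by (intro mult_mono) (use d in auto)
    also have "\<dots> = (A / d) * (exp (d * y) * exp (h * y))" by simp
    also have "exp (d * y) * exp (h * y) = exp (h' * y)" by (simp add: d_def algebra_simps flip: exp_add)
    finally show ?thesis using y by (simp add: norm_mult)
  qed
  then show ?thesis unfolding upper_type_def by (intro exI[of _ "A / d"]) blast
qed

lemma upper_type_mult:
  assumes "upper_type f h" "upper_type g h'" shows "upper_type (\<lambda>z. f z * g z) (h + h')"
proof -
  obtain A where A: "A \<ge> 0" "\<And>y. y \<ge> 0 \<Longrightarrow> norm (f (\<i> * of_real y)) \<le> A * exp (h * y)"
    using upper_typeE[OF assms(1)] by metis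
  obtain B where B: "B \<ge> 0" "\<And>y. y \<ge> 0 \<Longrightarrow> norm (g (\<i> * of_real y)) \<le> B * exp (h' * y)"
    using upper_typeE[OF assms(2)] by metis
  have "norm (f (\<i> * of_real y) * g (\<i> * of_real y)) \<le> (A * B) * exp ((h + h') * y)" if y: "y \<ge> 0" for y
  proof -
    have "norm (f (\<i> * of_real y) * g (\<i> * of_real y)) \<le> (A * exp (h * y)) * (B * exp (h' * y))"
      unfolding norm_mult using A B y by (intro mult_mono) auto
    also have "\<dots> = (A * B) * (exp (h * y) * exp (h' * y))" by simp
    also have "exp (h * y) * exp (h' * y) = exp ((h + h') * y)" by (simp add: algebra_simps flip: exp_add)
    finally show ?thesis .
  qed
  then show ?thesis by (auto simp: upper_type_def)
qed

lemma upper_type_power: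
  assumes "upper_type f h" shows "upper_type (\<lambda>z. f z ^ n) (of_nat n * h)"
proof (induction n)
  case 0
  show ?case by (auto simp: upper_type_def intro!: exI[of _ 1])
next
  case (Suc n)
  then show ?case using upper_type_mult[OF assms Suc] by (simp add: distrib_right)
qed

section \<open>Room in the steps for polynomial factors and exponential shifts\<close>

context weight_seqs
begin

lemma W_nonneg [simp]: "0 \<le> W k z" by (simp add: W_def)

lemma larger_c: obtains k' where "k \<le> k'" "c k < c k'"
proof -
  have "\<forall>\<^sub>F n in sequentially. ereal (c k) < ereal (c n)"
    using order_tendstoD(1)[OF c_lim c_less[of k]] .
  then obtain N where "\<And>n. n \<ge> N \<Longrightarrow> c k < c n" by (auto simp: eventually_sequentially)
  then have "c k < c (max k N)" by simp
  then show ?thesis by (rule that[rotated]) simp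
qed

lemma larger_r: obtains k' where "k \<le> k'" "r k < r k'"
proof -
  have "\<forall>\<^sub>F n in sequentially. r k < r n"
    using order_tendstoD(1)[OF r_lim r_less[of k]] .
  then obtain N where "\<And>n. n \<ge> N \<Longrightarrow> r k < r n" by (auto simp: eventually_sequentially)
  then have "r k < r (max k N)" by simp
  then show ?thesis by (rule that[rotated]) simp
qed

text \<open>This is where \<open>ln x = o (w x)\<close> is used: polynomial factors cost an
  arbitrarily small multiple of \<open>w\<close> in the exponent.\<close>

lemma linear_le_exp_w:
  assumes e: "e > 0" shows "\<exists>C\<ge>0. \<forall>x\<ge>0. 1 + x \<le> C * exp (e * w x)"
proof -
  have "(\<lambda>x. ln x) \<in> o[at_top](w)" using weight unfolding weight_def by blast
  from landau_o.smallD[OF this e] obtain X where X: "\<And>x. x \<ge> X \<Longrightarrow> norm (ln x) \<le> e * norm (w x)"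
    by (auto simp: eventually_at_top_linorder)
  define Y where "Y = max X 1"
  have "1 + x \<le> (2 + Y) * exp (e * w x)" if x: "x \<ge> 0" for x
  proof (cases "x \<ge> Y")
    case True
    then have x1: "x \<ge> X" "x \<ge> 1" by (auto simp: Y_def)
    have "ln x \<le> e * w x" using X[OF x1(1)] x1 w_nonneg[OF x] by simp
    then have "exp (ln x) \<le> exp (e * w x)" by simp
    then have "x \<le> exp (e * w x)" using x1 by simp
    then have "1 + x \<le> 2 * exp (e * w x)" using x1 by linarith
    also have "\<dots> \<le> (2 + Y) * exp (e * w x)" by (intro mult_right_mono) (auto simp: Y_def)
    finally show ?thesis .
  next
    case False
    have "1 \<le> exp (e * w x)" using e w_nonneg[OF x] by simp
    then have "(2 + Y) * 1 \<le> (2 + Y) * exp (e * w x)" by (intro mult_left_mono) (auto simp: Y_def)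
    then show ?thesis using False by simp
  qed
  moreover have "0 \<le> 2 + Y" by (simp add: Y_def)
  ultimately show ?thesis by blast
qed

lemma W_linear: "\<exists>k' C. k \<le> k' \<and> C \<ge> 0 \<and> (\<forall>z. (1 + norm z) * W k z \<le> C * W k' z)"
proof -
  obtain k' where k': "k \<le> k'" "r k < r k'" by (rule larger_r)
  then obtain C where C: "C \<ge> 0" "\<And>x. x \<ge> 0 \<Longrightarrow> 1 + x \<le> C * exp ((r k' - r k) * w x)"
    using linear_le_exp_w[of "r k' - r k"] by auto
  have "(1 + norm z) * W k z \<le> C * W k' z" for z
  proof -
    have "(1 + norm z) * W k z \<le> C * exp ((r k' - r k) * w (norm z)) * W k z"
      using C(2)[of "norm z"] by (intro mult_right_mono) (auto intro: less_imp_le)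
    also have "\<dots> = C * exp (r k' * w (norm z) + c k * \<bar>Im z\<bar>)"
      unfolding W_def by (simp add: mult.assoc left_diff_distrib flip: exp_add)
    also have "\<dots> \<le> C * W k' z"
      unfolding W_def using C(1) incseqD[OF c_inc k'(1)] by (intro mult_left_mono) (auto intro: mult_right_mono)
    finally show ?thesis .
  qed
  then show ?thesis using k'(1) C(1) by blast
qed

lemma P_times_ident: "f \<in> P \<Longrightarrow> (\<lambda>z. z * f z) \<in> P"
proof -
  assume "f \<in> P"
  then obtain k M where f: "entire_le k M f" using P_iff by blast
  obtain k' C where C: "C \<ge> 0" "\<And>z. (1 + norm z) * W k z \<le> C * W k' z" using W_linear by blast
  have M0: "M \<ge> 0" using entire_le_nonneg[OF f] .
  have "entire_le k' (M * C) (\<lambda>z. z * f z)" unfolding entire_le_def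
  proof (intro conjI allI)
    show "(\<lambda>z. z * f z) holomorphic_on UNIV" by (intro holomorphic_intros entire_leD(1)[OF f])
    fix z
    have "norm (z * f z) \<le> (1 + norm z) * (M * W k z)"
      unfolding norm_mult using entire_leD(2)[OF f, of z] by (intro mult_mono) auto
    also have "\<dots> = M * ((1 + norm z) * W k z)" by simp
    also have "\<dots> \<le> M * (C * W k' z)" using C(2) M0 by (intro mult_left_mono)
    finally show "norm (z * f z) \<le> M * C * W k' z" by simp
  qed
  then show ?thesis using P_iff by blast
qed

lemma entire_le_reflect:
  assumes "entire_le k M f" "s = 1 \<or> s = -1"
  shows "entire_le k M (\<lambda>z. f (s * z))"
  unfolding entire_le_def
proof (intro conjI allI)
  have "(f \<circ> (\<lambda>z. s * z)) holomorphic_on UNIV"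
    by (rule holomorphic_on_compose_gen[OF _ entire_leD(1)[OF assms(1)]]) (auto intro!: holomorphic_intros)
  then show "(\<lambda>z. f (s * z)) holomorphic_on UNIV" by (simp add: o_def)
  show "norm (f (s * z)) \<le> M * W k z" for z
    using entire_leD(2)[OF assms(1), of "s * z"] assms(2) by (auto simp: W_def)
qed

end

context annihilator
begin

text \<open>\<open>quotient_growth\<close> is applied to \<open>bil f g = f * G\<close> in the half
  plane selected by \<open>s\<close>. The numerator obeys the same kind of bound as
  \<open>f\<close>, because \<open>bil_bound\<close> is linear in the values of \<open>f\<close> and
  \<open>g\<close>, both of type at most \<open>h + e\<close>.\<close>

lemma resolvent_growth_half:
  assumes s: "s = 1 \<or> s = -1" and g: "g \<in> P" and G: "resolvent_of g G" and e: "e > 0" and f: "f \<in> J"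
    and ft: "upper_type (\<lambda>z. f (s * z)) (h + e)" "upper_big (\<lambda>z. f (s * z)) (h - e)"
    and gt: "upper_type (\<lambda>z. g (s * z)) (h + e)"
  shows "\<exists>K. \<forall>z. 0 < Im z \<longrightarrow> norm (G (s * z)) \<le> K * exp (16 * e * ((norm z)\<^sup>2 / Im z))"
proof -
  have fP: "f \<in> P" using f J_sub_P by blast
  obtain k M N where kM: "entire_le k M f" "entire_le k N g" by (rule entire_le_common[OF fP g])
  obtain B where B: "B \<ge> 0" "\<And>\<mu>. norm (bil f g \<mu>) \<le> B * (norm (f \<mu>) * N + norm (g \<mu>) * M)"
    using bil_bound[of k] kM by blast
  have M0: "M \<ge> 0" "N \<ge> 0" using entire_le_nonneg kM by auto
  define E where "E = (\<lambda>z. exp (Re (maj z) + (h + e) * Im z))"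
  obtain A1 where A1: "\<And>y. y \<ge> 0 \<Longrightarrow> norm (f (s * (\<i> * of_real y))) \<le> A1 * exp ((h + e) * y)"
    using ft(1) by (auto simp: upper_type_def)
  obtain A2 where A2: "\<And>y. y \<ge> 0 \<Longrightarrow> norm (g (s * (\<i> * of_real y))) \<le> A2 * exp ((h + e) * y)"
    using gt by (auto simp: upper_type_def)
  have fb: "norm (f (s * z)) \<le> M * exp (w 1) * E z" if "0 \<le> Im z" for z
    unfolding E_def by (rule half_plane_bound[OF entire_le_reflect[OF kM(1) s] A1 that])
  have gb: "norm (g (s * z)) \<le> N * exp (w 1) * E z" if "0 \<le> Im z" for z
    unfolding E_def by (rule half_plane_bound[OF entire_le_reflect[OF kM(2) s] A2 that])
  define A where "A = B * (2 * M * N * exp (w 1)) + M * exp (w 1)"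
  have E0: "0 \<le> E z" for z by (simp add: E_def)
  have hol: "(\<lambda>z. q (s * z)) holomorphic_on UNIV" if "q holomorphic_on UNIV" for q
  proof -
    have "(q \<circ> (\<lambda>z. s * z)) holomorphic_on UNIV"
      by (rule holomorphic_on_compose_gen[OF _ that]) (auto intro!: holomorphic_intros)
    then show ?thesis by (simp add: o_def)
  qed
  show ?thesis
  proof (rule quotient_growth[OF e hol[OF bil_holomorphic[OF fP g]] hol[OF P_holomorphic[OF fP]]])
    show "(\<lambda>z. G (s * z)) holomorphic_on UNIV" by (rule hol) (use G in \<open>simp add: resolvent_of_def\<close>)
    show "bil f g (s * z) = f (s * z) * G (s * z)" for z using G f by (simp add: resolvent_of_def)
    show "norm (bil f g (s * z)) \<le> A * exp (Re (maj z) + (h + e) * Im z)" if z: "0 \<le> Im z" for z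
    proof -
      have "norm (bil f g (s * z)) \<le> B * (norm (f (s * z)) * N + norm (g (s * z)) * M)" by (rule B(2))
      also have "\<dots> \<le> B * ((M * exp (w 1) * E z) * N + (N * exp (w 1) * E z) * M)"
        using fb[OF z] gb[OF z] M0 B(1) by (intro mult_left_mono add_mono mult_right_mono) auto
      also have "\<dots> = B * (2 * M * N * exp (w 1)) * E z" by (simp add: algebra_simps)
      also have "\<dots> \<le> A * E z" unfolding A_def using M0 E0 by (intro mult_right_mono) auto
      finally show ?thesis by (simp add: E_def)
    qed
    show "norm (f (s * z)) \<le> A * exp (Re (maj z) + (h + e) * Im z)" if z: "0 \<le> Im z" for z
    proof -
      have "M * exp (w 1) * E z \<le> A * E z" unfolding A_def using M0 B(1) E0 by (intro mult_right_mono) auto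
      then show ?thesis using order_trans[OF fb[OF z]] by (simp only: E_def)
    qed
    show "\<exists>y\<ge>Y. exp ((h - e) * y) \<le> norm (f (s * (\<i> * of_real y)))" for Y
      using ft(2) by (auto simp: upper_big_def)
  qed
qed

text \<open>One number \<open>h\<close> has to bound \<open>f\<close> from both sides and
  \<open>g\<close> from above; a mismatch could leave exponential growth of \<open>G\<close> along
  the axis.\<close>

definition comparable :: "real \<Rightarrow> complex \<Rightarrow> (complex \<Rightarrow> complex) \<Rightarrow> bool" where
  "comparable e s g \<longleftrightarrow> (\<exists>f\<in>J. \<exists>h. upper_type (\<lambda>z. f (s * z)) (h + e) \<and>
     upper_big (\<lambda>z. f (s * z)) (h - e) \<and> upper_type (\<lambda>z. g (s * z)) (h + e))"

lemma resolvent_growth: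
  assumes g: "g \<in> P" and G: "resolvent_of g G" and e: "e > 0"
    and "comparable e 1 g" "comparable e (-1) g"
  obtains K where "K \<ge> 0" "\<And>z. Im z \<noteq> 0 \<Longrightarrow> norm (G z) \<le> K * exp (16 * e * ((norm z)\<^sup>2 / \<bar>Im z\<bar>))"
proof -
  obtain K1 where K1: "\<And>z. 0 < Im z \<Longrightarrow> norm (G (1 * z)) \<le> K1 * exp (16 * e * ((norm z)\<^sup>2 / Im z))"
    using resolvent_growth_half[OF _ g G e] assms(4) unfolding comparable_def by blast
  obtain K2 where K2: "\<And>z. 0 < Im z \<Longrightarrow> norm (G (-1 * z)) \<le> K2 * exp (16 * e * ((norm z)\<^sup>2 / Im z))"
    using resolvent_growth_half[OF _ g G e] assms(5) unfolding comparable_def by blast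
  define K where "K = max 0 (max K1 K2)"
  have K: "K1 * x \<le> K * x" "K2 * x \<le> K * x" if "x \<ge> 0" for x
    using that by (auto simp: K_def intro!: mult_right_mono)
  show ?thesis
  proof (rule that)
    show "K \<ge> 0" by (simp add: K_def)
    fix z :: complex assume "Im z \<noteq> 0"
    then consider "0 < Im z" | "0 < Im (- z)" by fastforce
    then show "norm (G z) \<le> K * exp (16 * e * ((norm z)\<^sup>2 / \<bar>Im z\<bar>))"
    proof cases
      case 1
      then show ?thesis
        using order_trans[OF K1[OF 1] K(1)[of "exp (16 * e * ((norm z)\<^sup>2 / Im z))"]] by simp
    next
      case 2
      then show ?thesis
        using order_trans[OF K2[OF 2] K(2)[of "exp (16 * e * ((norm (- z))\<^sup>2 / Im (- z)))"]] by simp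
    qed
  qed
qed

end

text \<open>A base larger than \<open>2 * A\<close> would make the powers of \<open>2\<close>
  bounded. The constants \<open>p\<close> and \<open>q\<close> leave no trace in the
  conclusion.\<close>

lemma linear_le_of_power_le:
  fixes x A p q :: real
  assumes A: "0 < A" and p: "0 < p" and le: "\<And>n. p * x ^ Suc n \<le> q * A ^ n"
  shows "x \<le> 2 * A"
proof (rule ccontr)
  assume "\<not> x \<le> 2 * A"
  then have x: "x > 2 * A" by simp
  have x0: "x > 0" using x A by linarith
  have "p * x * 2 ^ n \<le> q" for n
  proof -
    have "p * x * (2 * A) ^ n \<le> p * x * x ^ n"
      using x A p x0 by (intro mult_left_mono power_mono) auto
    also have "\<dots> \<le> q * A ^ n" using le[of n] by (simp add: mult.assoc)
    finally have "p * x * 2 ^ n * A ^ n \<le> q * A ^ n" by (simp add: power_mult_distrib mult.assoc)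
    then show ?thesis using A by simp
  qed
  then have le2: "2 ^ n \<le> q / (p * x)" for n using p x0 by (simp add: le_divide_eq mult.commute)
  obtain n where "q / (p * x) < 2 ^ n" using real_arch_pow[of 2 "q / (p * x)"] by auto
  then show False using le2[of n] by simp
qed

section \<open>Exponential shifts of a function and of its resolvent\<close>

context annihilator
begin

lemma exp_shift_in_P:
  assumes g: "entire_le k M g" and k': "k \<le> k'" and t: "\<bar>t\<bar> \<le> c k' - c k"
  shows "entire_le k' M (\<lambda>z. g z * exp (\<i> * of_real t * z))"
  unfolding entire_le_def
proof (intro conjI allI)
  show "(\<lambda>z. g z * exp (\<i> * of_real t * z)) holomorphic_on UNIV"
    by (intro holomorphic_intros entire_leD(1)[OF g])
  fix z
  have M0: "M \<ge> 0" using entire_le_nonneg[OF g] .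
  have "- (t * Im z) \<le> \<bar>t\<bar> * \<bar>Im z\<bar>" by (metis abs_ge_minus_self abs_mult)
  also have "\<dots> \<le> (c k' - c k) * \<bar>Im z\<bar>" using t by (intro mult_right_mono) auto
  finally have 1: "exp (- (t * Im z)) \<le> exp ((c k' - c k) * \<bar>Im z\<bar>)" by simp
  have "norm (g z * exp (\<i> * of_real t * z)) = norm (g z) * exp (- (t * Im z))" by (simp add: norm_mult)
  also have "\<dots> \<le> (M * W k z) * exp ((c k' - c k) * \<bar>Im z\<bar>)"
    using entire_leD(2)[OF g, of z] 1 M0 by (intro mult_mono) auto
  also have "\<dots> = M * exp (r k * w (norm z) + c k' * \<bar>Im z\<bar>)"
    unfolding W_def by (simp add: mult.assoc left_diff_distrib flip: exp_add)
  also have "\<dots> \<le> M * W k' z"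
    unfolding W_def using M0 incseqD[OF r_inc k'] w_nonneg[of "norm z"]
    by (intro mult_left_mono) (auto intro: mult_right_mono)
  finally show "norm (g z * exp (\<i> * of_real t * z)) \<le> M * W k' z" .
qed

lemma upper_type_exp_shift:
  assumes "upper_type (\<lambda>z. g (s * z)) h" "s = 1 \<or> s = -1" "\<bar>t\<bar> \<le> d"
  shows "upper_type (\<lambda>z. g (s * z) * exp (\<i> * of_real t * (s * z))) (h + d)"
proof -
  have "upper_type (\<lambda>z. exp (\<i> * of_real t * (s * z))) d"
    unfolding upper_type_def
  proof (intro exI[of _ 1] allI impI)
    fix y :: real assume y: "y \<ge> 0"
    have "- t \<le> d" "t \<le> d" using assms(3) by auto
    from this[THEN mult_right_mono[OF _ y]] have "- t * y \<le> d * y" "t * y \<le> d * y" .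
    then have "norm (exp (\<i> * of_real t * (s * (\<i> * of_real y)))) \<le> exp (d * y)" using assms(2) by auto
    then show "norm (exp (\<i> * of_real t * (s * (\<i> * of_real y)))) \<le> 1 * exp (d * y)" by simp
  qed
  from upper_type_mult[OF assms(1) this] show ?thesis .
qed

text \<open>Multiplied by \<open>f\<close> in \<open>J\<close>, the terms containing
  \<open>trf f\<close> cancel, because the factor at \<open>\<mu>\<close> undoes the shift of
  \<open>g\<close>. What remains is \<open>S\<close> of the difference quotient of a function that
  vanishes at \<open>\<mu>\<close>.\<close>

lemma resolvent_exp_shift:
  assumes g: "g \<in> P" and G: "resolvent_of g G"
    and gt: "(\<lambda>z. g z * exp (\<i> * of_real t * z)) \<in> P"
    and Gt: "resolvent_of (\<lambda>z. g z * exp (\<i> * of_real t * z)) Gt"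
  shows "G \<mu> = exp (- \<i> * of_real t * \<mu>) * Gt \<mu> +
    S (diff_quot (\<lambda>z. 1 * g z + (- exp (- \<i> * of_real t * \<mu>)) * (g z * exp (\<i> * of_real t * z))) \<mu>)"
proof -
  define gt' where "gt' = (\<lambda>z. g z * exp (\<i> * of_real t * z))"
  define E where "E = (\<lambda>\<mu>. exp (- \<i> * of_real t * \<mu>))"
  have gtP: "gt' \<in> P" using gt by (simp add: gt'_def)
  have Gt': "resolvent_of gt' Gt" using Gt by (simp add: gt'_def)
  have holE: "E holomorphic_on UNIV" unfolding E_def by (intro holomorphic_intros)
  have Eg: "E v * gt' v = g v" for v
  proof -
    have "exp (- \<i> * of_real t * v) * exp (\<i> * of_real t * v) = 1" by (simp flip: exp_add)
    then show ?thesis by (simp add: E_def gt'_def mult_ac)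
  qed
  obtain f u where f: "f \<in> J" "f u \<noteq> 0" by (rule J_nonzero)
  have fP: "f \<in> P" using f J_sub_P by blast
  have "G \<mu> - E \<mu> * Gt \<mu> - (trf g \<mu> - E \<mu> * trf gt' \<mu>) = 0"
  proof (rule entire_mult_eq_zero[of f "\<lambda>v. G v - E v * Gt v - (trf g v - E v * trf gt' v)", OF P_holomorphic[OF fP] _ _ f(2)])
    show "(\<lambda>v. G v - E v * Gt v - (trf g v - E v * trf gt' v)) holomorphic_on UNIV"
      using G Gt' by (intro holomorphic_intros holE trf_holomorphic g gtP) (auto simp: resolvent_of_def)
    show "f v * (G v - E v * Gt v - (trf g v - E v * trf gt' v)) = 0" for v
    proof -
      have 1: "f v * G v = f v * trf g v - g v * trf f v" using G f(1) by (simp add: resolvent_of_def bil_def)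
      have 2: "f v * Gt v = f v * trf gt' v - gt' v * trf f v" using Gt' f(1) by (simp add: resolvent_of_def bil_def)
      have "f v * (G v - E v * Gt v - (trf g v - E v * trf gt' v))
         = f v * G v - E v * (f v * Gt v) - (f v * trf g v - E v * (f v * trf gt' v))" by (simp add: algebra_simps)
      also have "\<dots> = (E v * gt' v - g v) * trf f v" unfolding 1 2 by (simp add: algebra_simps)
      finally show ?thesis by (simp add: Eg)
    qed
  qed
  then have "G \<mu> = E \<mu> * Gt \<mu> + (1 * trf g \<mu> + (- E \<mu>) * trf gt' \<mu>)" by (simp add: algebra_simps)
  also have "1 * trf g \<mu> + (- E \<mu>) * trf gt' \<mu> = S (diff_quot (\<lambda>z. 1 * g z + (- E \<mu>) * gt' z) \<mu>)"
    unfolding diff_quot_lincomb[OF P_holomorphic[OF g] P_holomorphic[OF gtP]] trf_def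
    by (rule S_lincomb[symmetric]) (intro diff_quot_in_P g gtP)+
  finally show ?thesis by (simp only: E_def gt'_def)
qed

text \<open>In the half plane \<open>t * Im \<mu> \<le> 0\<close> the factor
  \<open>exp (- \<i> * t * \<mu>)\<close> has modulus at most \<open>1\<close>, so the function
  under \<open>S\<close> has norm at most \<open>2 * M\<close> and its remainder term is bounded
  uniformly in \<open>\<mu>\<close>.\<close>

lemma resolvent_le_exp_shift:
  assumes g: "entire_le k M g" and G: "resolvent_of g G" and k': "k \<le> k'" "\<bar>t\<bar> \<le> c k' - c k"
    and Gt: "resolvent_of (\<lambda>z. g z * exp (\<i> * of_real t * z)) Gt"
  obtains D where "\<And>\<mu>. t * Im \<mu> \<le> 0 \<Longrightarrow> norm (G \<mu>) \<le> exp (t * Im \<mu>) * norm (Gt \<mu>) + D"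
proof -
  note gk = entire_le_mono[OF g k'(1) order_refl]
  note gt = exp_shift_in_P[OF g k']
  have gP: "g \<in> P" "(\<lambda>z. g z * exp (\<i> * of_real t * z)) \<in> P" using g gt P_iff by blast+
  obtain C where C: "C \<ge> 1" "\<And>M f \<mu>. entire_le k' M f \<Longrightarrow> f \<mu> = 0 \<Longrightarrow> entire_le k' (C * M) (diff_quot f \<mu>)"
    using diff_quot_le by blast
  obtain B where B: "B \<ge> 0" "\<And>M f. entire_le k' M f \<Longrightarrow> norm (S f) \<le> B * M"
    using S_bounded unfolding step_bounded_def by blast
  have M0: "M \<ge> 0" using entire_le_nonneg[OF g] .
  show ?thesis
  proof (rule that)
    fix \<mu> assume t: "t * Im \<mu> \<le> 0"
    define E where "E = exp (- \<i> * of_real t * \<mu>)"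
    have nE: "norm E = exp (t * Im \<mu>)" by (simp add: E_def)
    define u where "u = (\<lambda>z. 1 * g z + (- E) * (g z * exp (\<i> * of_real t * z)))"
    have "entire_le k' (norm (1::complex) * M + norm (- E) * M) u"
      unfolding u_def by (rule entire_le_lincomb[OF gk gt])
    then have "entire_le k' (2 * M) u"
      by (rule entire_le_mono[OF _ order_refl]) (use nE t M0 in \<open>auto intro!: mult_left_le_one_le\<close>)
    moreover have "u \<mu> = 0"
    proof -
      have "E * exp (\<i> * of_real t * \<mu>) = 1" by (simp add: E_def flip: exp_add)
      then show ?thesis by (simp add: u_def mult.left_commute[of E])
    qed
    ultimately have "entire_le k' (C * (2 * M)) (diff_quot u \<mu>)" by (rule C(2))
    then have Su: "norm (S (diff_quot u \<mu>)) \<le> B * (C * (2 * M))" by (rule B(2))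
    have "G \<mu> = E * Gt \<mu> + S (diff_quot u \<mu>)"
      using resolvent_exp_shift[OF gP(1) G gP(2) Gt, of \<mu>] by (simp only: E_def u_def)
    then have "norm (G \<mu>) \<le> norm (E * Gt \<mu>) + norm (S (diff_quot u \<mu>))" using norm_triangle_ineq by simp
    then show "norm (G \<mu>) \<le> exp (t * Im \<mu>) * norm (Gt \<mu>) + B * (C * (2 * M))"
      using Su by (simp add: norm_mult nE)
  qed
qed

end

section \<open>Position of a function's type relative to the submodule\<close>

context submodule_setting
begin

text \<open>The gap \<open>h - \<eta>\<close> is the room for exponential shifts. The comparison
  function and its type \<open>h'\<close> may change with \<open>e\<close>, as only a level
  \<open>h\<close> reached by \<open>J\<close> is fixed.\<close>

definition interior_type :: "complex \<Rightarrow> (complex \<Rightarrow> complex) \<Rightarrow> bool" where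
  "interior_type s g \<longleftrightarrow> (\<exists>h \<eta>. \<eta> < h \<and> upper_type (\<lambda>z. g (s * z)) \<eta> \<and>
     (\<forall>e>0. \<exists>f\<in>J. \<exists>h'\<ge>h. upper_type (\<lambda>z. f (s * z)) (h' + e) \<and> upper_big (\<lambda>z. f (s * z)) (h' - e)))"

definition boundary_type :: "complex \<Rightarrow> (complex \<Rightarrow> complex) \<Rightarrow> bool" where
  "boundary_type s g \<longleftrightarrow> (\<forall>e>0. \<exists>f\<in>J. \<exists>h. upper_type (\<lambda>z. f (s * z)) (h + e) \<and>
     upper_big (\<lambda>z. f (s * z)) (h - e) \<and> upper_type (\<lambda>z. g (s * z)) (h + e))"

lemma upper_type_times_ident_sign:
  assumes "upper_type (\<lambda>z. g (s * z)) h" "h < h'" "s = 1 \<or> s = -1"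
  shows "upper_type (\<lambda>z. (\<lambda>v. v * g v) (s * z)) h'"
proof -
  have "upper_type (\<lambda>z. z * g (s * z)) h'" by (rule upper_type_times_ident[OF assms(1,2)])
  moreover have "norm (s * z * g (s * z)) = norm (z * g (s * z))" for z
    using assms(3) by (auto simp: norm_mult)
  ultimately show ?thesis unfolding upper_type_def by simp
qed

lemma interior_type_times_ident:
  assumes "interior_type s g" "s = 1 \<or> s = -1" shows "interior_type s (\<lambda>z. z * g z)"
proof -
  obtain h \<eta> where h: "\<eta> < h" "upper_type (\<lambda>z. g (s * z)) \<eta>"
    "\<forall>e>0. \<exists>f\<in>J. \<exists>h'\<ge>h. upper_type (\<lambda>z. f (s * z)) (h' + e) \<and> upper_big (\<lambda>z. f (s * z)) (h' - e)"
    using assms(1) unfolding interior_type_def by blast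
  obtain \<eta>' where \<eta>': "\<eta> < \<eta>'" "\<eta>' < h" using dense[OF h(1)] by blast
  show ?thesis unfolding interior_type_def
    using upper_type_times_ident_sign[OF h(2) \<eta>'(1) assms(2)] \<eta>'(2) h(3) by blast
qed

lemma boundary_type_times_ident:
  assumes "boundary_type s g" "s = 1 \<or> s = -1" shows "boundary_type s (\<lambda>z. z * g z)"
  unfolding boundary_type_def
proof (intro allI impI)
  fix e :: real assume e: "e > 0"
  then have "e / 2 > 0" by simp
  then obtain f h where f: "f \<in> J" "upper_type (\<lambda>z. f (s * z)) (h + e / 2)"
     "upper_big (\<lambda>z. f (s * z)) (h - e / 2)" "upper_type (\<lambda>z. g (s * z)) (h + e / 2)"
    using assms(1) unfolding boundary_type_def by blast
  have "upper_type (\<lambda>z. f (s * z)) (h + e)" by (rule upper_type_mono[OF f(2)]) (use e in simp)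
  moreover have "upper_big (\<lambda>z. f (s * z)) (h - e)" by (rule upper_big_mono[OF f(3)]) (use e in simp)
  moreover have "upper_type (\<lambda>z. (\<lambda>v. v * g v) (s * z)) (h + e)"
    by (rule upper_type_times_ident_sign[OF f(4) _ assms(2)]) (use e in simp)
  ultimately show "\<exists>f\<in>J. \<exists>h. upper_type (\<lambda>z. f (s * z)) (h + e) \<and>
     upper_big (\<lambda>z. f (s * z)) (h - e) \<and> upper_type (\<lambda>z. s * z * g (s * z)) (h + e)"
    using f(1) by blast
qed

lemma admissible_times_ident: "admissible g \<Longrightarrow> admissible (\<lambda>z. z * g z)"
proof -
  assume g: "admissible g"
  then have "(\<lambda>z. g z * z) \<in> P" using P_times_ident[of g] by (simp add: admissible_def mult.commute)
  from admissible_times[OF g _ this] have "admissible (\<lambda>z. g z * z)" by (simp add: holomorphic_on_ident)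
  then show ?thesis by (simp add: mult.commute)
qed

text \<open>The hypothesis ranges over all annihilating functionals because the one that separates
  \<open>g\<close> from \<open>J\<close> is produced only inside the proof by contradiction.\<close>

lemma membership_of_bounded_resolvents:
  assumes g: "admissible g"
    and bd: "\<And>S G j. annihilator w a r c J S \<Longrightarrow> j \<in> {g, (\<lambda>z. z * (z * g z))} \<Longrightarrow>
      annihilator.resolvent_of J S j G \<Longrightarrow> \<exists>B. \<forall>z. norm (G z) \<le> B"
  shows "g \<in> J"
proof (rule ccontr)
  assume gJ: "g \<notin> J"
  have gP: "g \<in> P" using g by (simp add: admissible_def)
  obtain S where S: "linear_functional_on P S" "step_bounded S" "\<And>m. m \<in> J \<Longrightarrow> S m = 0" "S g \<noteq> 0"
    using closed_subspace_separation[OF J_closedin J_subspace gP gJ] by blast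
  interpret annihilator w a r c J S by unfold_locales (use S in auto)
  have an: "annihilator w a r c J S" by unfold_locales
  note zg = admissible_times_ident[OF g]
  note zzg = admissible_times_ident[OF zg]
  obtain G where G: "resolvent_of g G" using resolvent_exists[OF g] by blast
  obtain G' where G': "resolvent_of (\<lambda>z. z * (z * g z)) G'" using resolvent_exists[OF zzg] by blast
  have "\<exists>B. \<forall>z. norm (G z) \<le> B" by (rule bd[OF an _ G]) simp
  then obtain B where B: "\<And>z. norm (G z) \<le> B" by blast
  have "\<exists>B. \<forall>z. norm (G' z) \<le> B" by (rule bd[OF an _ G']) simp
  then obtain B' where B': "\<And>z. norm (G' z) \<le> B'" by blast
  have "S g = 0"
    by (rule annihilates_of_bounded[OF gP _ G B G' B']) (use zg in \<open>simp add: admissible_def\<close>)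
  then show False using S(4) by simp
qed

end

context annihilator
begin

lemma interior_resolvent_bounded:
  assumes g: "admissible g" and t1: "interior_type 1 g" and t2: "interior_type (-1) g"
    and G: "resolvent_of g G"
  obtains B where "\<And>z. norm (G z) \<le> B"
proof -
  have gP: "g \<in> P" using g by (simp add: admissible_def)
  obtain k M where kM: "entire_le k M g" using gP P_iff by blast
  obtain k' where k': "k \<le> k'" "c k < c k'" by (rule larger_c)
  obtain h1 n1 where h1: "n1 < h1" "upper_type (\<lambda>z. g (1 * z)) n1"
    "\<And>e. e > 0 \<Longrightarrow> \<exists>f\<in>J. \<exists>h'\<ge>h1. upper_type (\<lambda>z. f (1 * z)) (h' + e) \<and> upper_big (\<lambda>z. f (1 * z)) (h' - e)"
    using t1 unfolding interior_type_def by blast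
  obtain h2 n2 where h2: "n2 < h2" "upper_type (\<lambda>z. g (-1 * z)) n2"
    "\<And>e. e > 0 \<Longrightarrow> \<exists>f\<in>J. \<exists>h'\<ge>h2. upper_type (\<lambda>z. f (-1 * z)) (h' + e) \<and> upper_big (\<lambda>z. f (-1 * z)) (h' - e)"
    using t2 unfolding interior_type_def by blast
  define t where "t = min (c k' - c k) (min (h1 - n1) (h2 - n2))"
  have t: "t > 0" "t \<le> c k' - c k" "n1 + t \<le> h1" "n2 + t \<le> h2" using k' h1(1) h2(1) by (auto simp: t_def)
  \<comment> \<open>In the double sector \<open>(norm z)\<^sup>2\<close> is at most
    \<open>17 * (Im z)\<^sup>2\<close>. With \<open>272 = 16 * 17\<close> the growth exponent
    becomes at most \<open>t * \<bar>Im z\<bar>\<close>, exactly what a shift of size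
    \<open>t\<close> absorbs.\<close>
  define e where "e = t / 272"
  have e: "e > 0" using t by (simp add: e_def)
  have growth: "\<exists>K Gs. K \<ge> 0 \<and> resolvent_of (\<lambda>z. g z * exp (\<i> * of_real s * z)) Gs \<and>
      (\<forall>z. Im z \<noteq> 0 \<longrightarrow> norm (Gs z) \<le> K * exp (16 * e * ((norm z)\<^sup>2 / \<bar>Im z\<bar>)))" if s: "\<bar>s\<bar> \<le> t" for s
  proof -
    define gs where "gs = (\<lambda>z. g z * exp (\<i> * of_real s * z))"
    have "entire_le k' M gs" unfolding gs_def by (rule exp_shift_in_P[OF kM k'(1)]) (use s t in auto)
    then have gsP: "gs \<in> P" using P_iff by blast
    have adm: "admissible gs" unfolding gs_def
      by (rule admissible_times[OF g]) (use gsP in \<open>auto intro!: holomorphic_intros simp: gs_def\<close>)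
    obtain Gs where Gs: "resolvent_of gs Gs" using resolvent_exists[OF adm] by blast
    have c1: "comparable e 1 gs"
    proof -
      obtain f h' where f: "f \<in> J" "h' \<ge> h1" "upper_type (\<lambda>z. f (1 * z)) (h' + e)" "upper_big (\<lambda>z. f (1 * z)) (h' - e)"
        using h1(3)[OF e] by blast
      have "upper_type (\<lambda>z. gs (1 * z)) (n1 + t)" unfolding gs_def
        by (rule upper_type_exp_shift[OF h1(2) _ s]) simp
      then have "upper_type (\<lambda>z. gs (1 * z)) (h' + e)"
        by (rule upper_type_mono) (use f(2) t e in linarith)
      then show ?thesis unfolding comparable_def using f by blast
    qed
    have c2: "comparable e (-1) gs"
    proof -
      obtain f h' where f: "f \<in> J" "h' \<ge> h2" "upper_type (\<lambda>z. f (-1 * z)) (h' + e)" "upper_big (\<lambda>z. f (-1 * z)) (h' - e)"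
        using h2(3)[OF e] by blast
      have "upper_type (\<lambda>z. gs (-1 * z)) (n2 + t)" unfolding gs_def
        by (rule upper_type_exp_shift[OF h2(2) _ s]) simp
      then have "upper_type (\<lambda>z. gs (-1 * z)) (h' + e)"
        by (rule upper_type_mono) (use f(2) t e in linarith)
      then show ?thesis unfolding comparable_def using f by blast
    qed
    obtain K where "K \<ge> 0" "\<And>z. Im z \<noteq> 0 \<Longrightarrow> norm (Gs z) \<le> K * exp (16 * e * ((norm z)\<^sup>2 / \<bar>Im z\<bar>))"
      using resolvent_growth[OF gsP Gs e c1 c2] by blast
    then show ?thesis using Gs unfolding gs_def by blast
  qed
  \<comment> \<open>A shift with \<open>s = t\<close> bounds \<open>G\<close> in the lower half of
    the double sector, one with \<open>s = - t\<close> in the upper half.\<close>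
  have cone: "\<exists>B. \<forall>z. s * Im z < 0 \<longrightarrow> \<bar>Re z\<bar> \<le> 4 * \<bar>Im z\<bar> \<longrightarrow> norm (G z) \<le> B" if s: "\<bar>s\<bar> = t" for s
  proof -
    obtain K Gs where K: "K \<ge> 0" "resolvent_of (\<lambda>z. g z * exp (\<i> * of_real s * z)) Gs"
      "\<And>z. Im z \<noteq> 0 \<Longrightarrow> norm (Gs z) \<le> K * exp (16 * e * ((norm z)\<^sup>2 / \<bar>Im z\<bar>))"
      using growth[of s] s by auto
    obtain D where D: "\<And>\<mu>. s * Im \<mu> \<le> 0 \<Longrightarrow> norm (G \<mu>) \<le> exp (s * Im \<mu>) * norm (Gs \<mu>) + D"
      using resolvent_le_exp_shift[OF kM G k'(1) _ K(2)] s t by metis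
    have "norm (G z) \<le> K + D" if z: "s * Im z < 0" "\<bar>Re z\<bar> \<le> 4 * \<bar>Im z\<bar>" for z
    proof -
      have Im0: "Im z \<noteq> 0" using z(1) by auto
      have "(norm z)\<^sup>2 = (Re z)\<^sup>2 + (Im z)\<^sup>2" by (rule cmod_power2)
      also have "(Re z)\<^sup>2 \<le> (4 * Im z)\<^sup>2" using z(2) by (subst abs_le_square_iff[symmetric]) (simp add: abs_mult)
      finally have "(norm z)\<^sup>2 \<le> 17 * (Im z)\<^sup>2" by (simp add: power_mult_distrib)
      also have "\<dots> = 17 * \<bar>Im z\<bar> * \<bar>Im z\<bar>" by (simp add: power2_eq_square)
      finally have "(norm z)\<^sup>2 / \<bar>Im z\<bar> \<le> 17 * \<bar>Im z\<bar>" using Im0 by (simp add: divide_le_eq)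
      then have "16 * e * ((norm z)\<^sup>2 / \<bar>Im z\<bar>) \<le> 16 * e * (17 * \<bar>Im z\<bar>)" using e by (intro mult_left_mono) auto
      also have "\<dots> = t * \<bar>Im z\<bar>" by (simp add: e_def)
      also have "\<dots> = - (s * Im z)" using z(1) s abs_mult[of s "Im z"] by simp
      finally have "16 * e * ((norm z)\<^sup>2 / \<bar>Im z\<bar>) \<le> - (s * Im z)" .
      then have "K * exp (16 * e * ((norm z)\<^sup>2 / \<bar>Im z\<bar>)) \<le> K * exp (- (s * Im z))"
        using K(1) by (intro mult_left_mono) auto
      then have "norm (Gs z) \<le> K * exp (- (s * Im z))" using K(3)[OF Im0] by linarith
      then have "exp (s * Im z) * norm (Gs z) \<le> exp (s * Im z) * (K * exp (- (s * Im z)))"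
        by (intro mult_left_mono) auto
      also have "\<dots> = K" by (simp add: exp_minus)
      finally show ?thesis using D[of z] z(1) by simp
    qed
    then show ?thesis by blast
  qed
  obtain B1 where B1: "\<And>z. t * Im z < 0 \<Longrightarrow> \<bar>Re z\<bar> \<le> 4 * \<bar>Im z\<bar> \<Longrightarrow> norm (G z) \<le> B1"
    using cone[of t] t by auto
  obtain B2 where B2: "\<And>z. - t * Im z < 0 \<Longrightarrow> \<bar>Re z\<bar> \<le> 4 * \<bar>Im z\<bar> \<Longrightarrow> norm (G z) \<le> B2"
    using cone[of "- t"] t by auto
  \<comment> \<open>The trivial shift gives the growth bound for \<open>G\<close> itself, which
    \<open>wedge_bounded\<close> needs outside the double sector.\<close>
  obtain K Gs where K: "resolvent_of (\<lambda>z. g z * exp (\<i> * of_real 0 * z)) Gs"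
      "\<And>z. Im z \<noteq> 0 \<Longrightarrow> norm (Gs z) \<le> K * exp (16 * e * ((norm z)\<^sup>2 / \<bar>Im z\<bar>))"
    using growth[of 0] t by auto
  have Gs: "Gs = G" using resolvent_unique[OF _ G, of Gs] K(1) by (auto simp: fun_eq_iff)
  define B where "B = max (norm (G 0)) (max B1 B2)"
  have bd: "norm (G z) \<le> B" if z: "\<bar>Re z\<bar> \<le> 4 * \<bar>Im z\<bar>" for z
  proof -
    consider "Im z = 0" | "Im z < 0" | "Im z > 0" by linarith
    then show ?thesis
    proof cases
      case 1
      then have "z = 0" using z by (simp add: complex_eq_iff)
      then show ?thesis by (simp add: B_def)
    next
      case 2
      then have "norm (G z) \<le> B1" using t by (intro B1 z) (simp add: mult_pos_neg)
      then show ?thesis by (simp add: B_def)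
    next
      case 3
      then have "norm (G z) \<le> B2" using t by (intro B2 z) simp
      then show ?thesis by (simp add: B_def)
    qed
  qed
  have "norm (G z) \<le> max B K" for z
    by (rule wedge_bounded[where C = "16 * e"]) (use G bd K(2) Gs in \<open>auto simp: resolvent_of_def\<close>)
  then show ?thesis using that by blast
qed

end

context submodule_setting
begin

lemma interior_type_in_J:
  assumes g: "admissible g" and t: "interior_type 1 g" "interior_type (-1) g"
  shows "g \<in> J"
proof (rule membership_of_bounded_resolvents[OF g])
  fix S G j
  assume an: "annihilator w a r c J S" and j: "j \<in> {g, (\<lambda>z. z * (z * g z))}"
    and G: "annihilator.resolvent_of J S j G"
  have t': "interior_type 1 (\<lambda>z. z * (z * g z))" "interior_type (-1) (\<lambda>z. z * (z * g z))"
    using t by (auto intro!: interior_type_times_ident)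
  have j': "admissible j" "interior_type 1 j" "interior_type (-1) j"
    using j g t t' admissible_times_ident[OF admissible_times_ident[OF g]] by auto
  show "\<exists>B. \<forall>z. norm (G z) \<le> B"
    using annihilator.interior_resolvent_bounded[OF an j' G] by blast
qed

end

context annihilator
begin

text \<open>\<open>G\<close> has arbitrarily small type along the imaginary axis, so each
  \<open>p * G ^ n\<close> remains of interior type and lies in \<open>J\<close> once it is known to
  lie in the space. Membership in \<open>J\<close> turns the next power into
  \<open>bil (p * G ^ n) g\<close>, and \<open>bil_bound\<close> shows that it lies in the
  space.\<close>

lemma boundary_resolvent_bounded:
  assumes g: "admissible g" and t: "boundary_type 1 g" "boundary_type (-1) g"
    and p: "admissible p" "p u \<noteq> 0" "interior_type 1 p" "interior_type (-1) p"
    and G: "resolvent_of g G"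
  obtains B where "\<And>z. norm (G z) \<le> B"
proof -
  have gP: "g \<in> P" and pP: "p \<in> P" using g p(1) by (auto simp: admissible_def)
  have holG: "G holomorphic_on UNIV" using G by (simp add: resolvent_of_def)
  have Gtype: "upper_type (\<lambda>z. G (s * z)) e" if e: "e > 0" and s: "s = 1 \<or> s = -1" for e s
  proof -
    have e16: "e / 16 > 0" using e by simp
    have "comparable (e / 16) 1 g" "comparable (e / 16) (-1) g"
      using t e16 unfolding boundary_type_def comparable_def by blast+
    then obtain K where K: "K \<ge> 0" "\<And>z. Im z \<noteq> 0 \<Longrightarrow> norm (G z) \<le> K * exp (16 * (e / 16) * ((norm z)\<^sup>2 / \<bar>Im z\<bar>))"
      using resolvent_growth[OF gP G e16] by blast
    have "norm (G (s * (\<i> * of_real y))) \<le> max K (norm (G 0)) * exp (e * y)" if y: "y \<ge> 0" for y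
    proof (cases "y = 0")
      case False
      have "norm (G (s * (\<i> * of_real y))) \<le> K * exp (e * y)"
        using K(2)[of "s * (\<i> * of_real y)"] s y False by (auto simp: norm_mult power2_eq_square)
      also have "\<dots> \<le> max K (norm (G 0)) * exp (e * y)" by (intro mult_right_mono) auto
      finally show ?thesis .
    qed auto
    then show ?thesis unfolding upper_type_def by blast
  qed
  obtain k M N where kM: "entire_le k M p" "entire_le k N g" by (rule entire_le_common[OF pP gP])
  have M0: "M \<ge> 0" "N \<ge> 0" using entire_le_nonneg kM by auto
  obtain B where B: "B \<ge> 0" "\<And>M N f g \<mu>. entire_le k M f \<Longrightarrow> entire_le k N g \<Longrightarrow>
      norm (bil f g \<mu>) \<le> B * (norm (f \<mu>) * N + norm (g \<mu>) * M)"
    using bil_bound[of k] by blast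
  \<comment> \<open>\<open>2 * B * N\<close> is the factor gained with each power of
    \<open>G\<close>; adding \<open>1\<close> ensures \<open>A > 0\<close>.\<close>
  define A where "A = 2 * B * N + 1"
  have A: "A > 0" "2 * B * N \<le> A" using B(1) M0 by (auto simp: A_def add_nonneg_pos)
  \<comment> \<open>The step \<open>k\<close> is the same for all \<open>n\<close>; only the
    constant grows, and it grows geometrically.\<close>
  have main: "(\<lambda>z. p z * G z ^ n) \<in> J \<and> entire_le k (M * A ^ n) (\<lambda>z. p z * G z ^ n)" for n
  proof (induction n)
    case 0
    show ?case using interior_type_in_J[OF p(1,3,4)] kM by simp
  next
    case (Suc n)
    define f where "f = (\<lambda>z. p z * G z ^ n)"
    have f: "f \<in> J" "entire_le k (M * A ^ n) f" using Suc by (auto simp: f_def)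
    have eq: "p z * G z ^ Suc n = bil f g z" for z
      using G f(1) by (auto simp: resolvent_of_def f_def mult_ac)
    have le: "entire_le k (M * A ^ Suc n) (\<lambda>z. p z * G z ^ Suc n)"
      unfolding entire_le_def
    proof (intro conjI allI)
      show "(\<lambda>z. p z * G z ^ Suc n) holomorphic_on UNIV"
        by (intro holomorphic_intros holG P_holomorphic pP)
      fix z
      have "norm (bil f g z) \<le> B * (norm (f z) * N + norm (g z) * (M * A ^ n))" by (rule B(2)[OF f(2) kM(2)])
      also have "\<dots> \<le> B * ((M * A ^ n * W k z) * N + (N * W k z) * (M * A ^ n))"
        using entire_leD(2)[OF f(2)] entire_leD(2)[OF kM(2)] M0 B(1) A
        by (intro mult_left_mono add_mono mult_right_mono) auto
      also have "\<dots> = (2 * B * N) * (M * A ^ n * W k z)" by (simp add: algebra_simps)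
      also have "\<dots> \<le> A * (M * A ^ n * W k z)"
        using A M0 W_pos[of k z] by (intro mult_right_mono) auto
      finally show "norm (p z * G z ^ Suc n) \<le> M * A ^ Suc n * W k z" by (simp only: eq) (simp add: mult_ac)
    qed
    then have inP: "(\<lambda>z. p z * G z ^ Suc n) \<in> P" using P_iff by blast
    have adm: "admissible (\<lambda>z. p z * G z ^ Suc n)"
      by (rule admissible_times[OF p(1) _ inP]) (intro holomorphic_intros holG)
    have "interior_type s (\<lambda>z. p z * G z ^ Suc n)" if s: "s = 1 \<or> s = -1" and ps: "interior_type s p" for s
    proof -
      obtain h \<eta> where h: "\<eta> < h" "upper_type (\<lambda>z. p (s * z)) \<eta>"
        "\<forall>e>0. \<exists>f\<in>J. \<exists>h'\<ge>h. upper_type (\<lambda>z. f (s * z)) (h' + e) \<and> upper_big (\<lambda>z. f (s * z)) (h' - e)"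
        using ps unfolding interior_type_def by blast
      \<comment> \<open>The \<open>n + 1\<close> factors \<open>G\<close> may together use up half
        of the gap between the type of \<open>p\<close> and the level \<open>h\<close>.\<close>
      define e where "e = (h - \<eta>) / (2 * of_nat (Suc n))"
      have e: "e > 0" using h(1) by (simp add: e_def)
      have "upper_type (\<lambda>z. p (s * z) * G (s * z) ^ Suc n) (\<eta> + of_nat (Suc n) * e)"
        by (rule upper_type_mult[OF h(2) upper_type_power[OF Gtype[OF e s]]])
      moreover have "of_nat (Suc n) * e = (h - \<eta>) / 2" unfolding e_def
        by (simp del: of_nat_Suc)
      then have "\<eta> + of_nat (Suc n) * e < h" using h(1) by (simp add: field_simps)
      ultimately show ?thesis unfolding interior_type_def using h(3) by blast
    qed
    then have "(\<lambda>z. p z * G z ^ Suc n) \<in> J" using p adm by (intro interior_type_in_J) auto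
    then show ?case using le by blast
  qed
  \<comment> \<open>When \<open>norm (G z) > A\<close>, the term of \<open>bil_bound\<close>
    containing \<open>norm (f z)\<close> is at most half of the left-hand side and is absorbed. The
    remaining term is geometric in \<open>n\<close>, so the final bound does not depend on
    \<open>z\<close>.\<close>
  have bd: "norm (G z) \<le> 2 * A" if pz: "p z \<noteq> 0" for z
  proof (cases "norm (G z) \<le> A")
    case True
    then show ?thesis using A by simp
  next
    case False
    show ?thesis
    proof (rule linear_le_of_power_le[OF A(1)])
      show "0 < norm (p z)" using pz by simp
      fix n
      define f where "f = (\<lambda>z. p z * G z ^ n)"
      have f: "f \<in> J" "entire_le k (M * A ^ n) f" using main[of n] by (auto simp: f_def)
      define x where "x = norm (p z) * norm (G z) ^ n"
      have x0: "x \<ge> 0" by (simp add: x_def)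
      have "norm (f z * G z) = norm (bil f g z)" using G f(1) by (simp add: resolvent_of_def)
      also have "\<dots> \<le> B * (norm (f z) * N + norm (g z) * (M * A ^ n))" by (rule B(2)[OF f(2) kM(2)])
      finally have 1: "x * norm (G z) \<le> B * N * x + B * norm (g z) * (M * A ^ n)"
        by (simp add: f_def norm_mult norm_power x_def algebra_simps)
      have "2 * (B * N * x) = (2 * B * N) * x" by simp
      also have "\<dots> \<le> norm (G z) * x" using A(2) False x0 by (intro mult_right_mono) auto
      finally have "x * norm (G z) \<le> 2 * (B * norm (g z) * (M * A ^ n))" using 1 by (simp add: mult.commute)
      then show "norm (p z) * norm (G z) ^ Suc n \<le> (2 * B * norm (g z) * M) * A ^ n"
        by (simp add: x_def mult_ac)
    qed
  qed
  have "norm (G z) \<le> 2 * A" for z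
  proof (rule ccontr)
    assume z: "\<not> norm (G z) \<le> 2 * A"
    have "open {z. 2 * A < norm (G z)}"
      by (intro open_Collect_less continuous_intros holomorphic_on_imp_continuous_on holG)
    moreover have "p v = 0" if "v \<in> {z. 2 * A < norm (G z)}" for v
      using bd[of v] that by auto
    moreover have "z \<in> {z. 2 * A < norm (G z)}" using z by simp
    ultimately have "p u = 0"
      using entire_zero_of_zero_on_open[OF P_holomorphic[OF pP]] by blast
    then show False using p(2) by simp
  qed
  then show ?thesis using that by blast
qed

end

context submodule_setting
begin

theorem boundary_type_in_J:
  assumes g: "admissible g" and t: "boundary_type 1 g" "boundary_type (-1) g"
    and p: "admissible p" "p u \<noteq> 0" "interior_type 1 p" "interior_type (-1) p"
  shows "g \<in> J"
proof (rule membership_of_bounded_resolvents[OF g])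
  fix S G j
  assume an: "annihilator w a r c J S" and j: "j \<in> {g, (\<lambda>z. z * (z * g z))}"
    and G: "annihilator.resolvent_of J S j G"
  have t': "boundary_type 1 (\<lambda>z. z * (z * g z))" "boundary_type (-1) (\<lambda>z. z * (z * g z))"
    using t by (auto intro!: boundary_type_times_ident)
  have j': "admissible j" "boundary_type 1 j" "boundary_type (-1) j"
    using j g t t' admissible_times_ident[OF admissible_times_ident[OF g]] by auto
  show "\<exists>B. \<forall>z. norm (G z) \<le> B"
    using annihilator.boundary_resolvent_bounded[OF an j' p G] by blast
qed

end

section \<open>Incomplete exponential systems\<close>

lemma iter_deriv_0 [simp]: "iter_deriv 0 f = f"
  by (simp add: iter_deriv_def)

lemma iter_deriv_Suc: "iter_deriv (Suc n) f = (\<lambda>t. vector_derivative (iter_deriv n f) (at t))"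
  by (simp add: iter_deriv_def)

lemma iter_deriv_Suc': "iter_deriv (Suc n) f = iter_deriv n (\<lambda>t. vector_derivative f (at t))"
  unfolding iter_deriv_def funpow_Suc_right by simp

text \<open>Any explicit chain of derivatives identifies \<open>iter_deriv\<close> and proves
  smoothness at once; the open interval allows the functions to be exchanged locally at each
  stage.\<close>

lemma iter_deriv_seq:
  assumes D0: "\<And>t. t \<in> {-\<rho><..<\<rho>} \<Longrightarrow> f t = D 0 t"
    and D: "\<And>n t. t \<in> {-\<rho><..<\<rho>} \<Longrightarrow> (D n has_vector_derivative D (Suc n) t) (at t)"
  shows "t \<in> {-\<rho><..<\<rho>} \<Longrightarrow> iter_deriv n f t = D n t" and "smooth_on_sym \<rho> f"
proof -
  have eq: "iter_deriv n f t = D n t" if "t \<in> {-\<rho><..<\<rho>}" for n t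
    using that
  proof (induction n arbitrary: t)
    case (Suc n)
    have "(iter_deriv n f has_vector_derivative D (Suc n) t) (at t)"
      by (rule has_vector_derivative_transform_within_open[OF D[OF Suc.prems] open_greaterThanLessThan Suc.prems])
         (simp add: Suc.IH)
    then show ?case unfolding iter_deriv_Suc by (rule vector_derivative_at)
  qed (use D0 in simp)
  then show "t \<in> {-\<rho><..<\<rho>} \<Longrightarrow> iter_deriv n f t = D n t" by blast
  show "smooth_on_sym \<rho> f" unfolding smooth_on_sym_def
  proof (intro allI ballI)
    fix n t assume t: "t \<in> {-\<rho><..<\<rho>}"
    have "(iter_deriv n f has_vector_derivative D (Suc n) t) (at t)"
      by (rule has_vector_derivative_transform_within_open[OF D[OF t] open_greaterThanLessThan t])
         (simp add: eq)
    then show "iter_deriv n f differentiable at t"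
      by (rule differentiableI_vector)
  qed
qed

lemma smooth_has_vector_derivative:
  assumes "smooth_on_sym \<rho> f" "t \<in> {-\<rho><..<\<rho>}"
  shows "(iter_deriv n f has_vector_derivative iter_deriv (Suc n) f t) (at t)"
  using assms unfolding smooth_on_sym_def iter_deriv_Suc by (simp add: vector_derivative_works)

lemma smooth_lincomb:
  assumes f: "smooth_on_sym \<rho> f" and g: "smooth_on_sym \<rho> g"
  shows "smooth_on_sym \<rho> (\<lambda>t. \<alpha> * f t + \<beta> * g t)"
    and "t \<in> {-\<rho><..<\<rho>} \<Longrightarrow>
      iter_deriv n (\<lambda>t. \<alpha> * f t + \<beta> * g t) t = \<alpha> * iter_deriv n f t + \<beta> * iter_deriv n g t"
proof -
  define D where "D = (\<lambda>n t. \<alpha> * iter_deriv n f t + \<beta> * iter_deriv n g t)"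
  have D: "(D n has_vector_derivative D (Suc n) t) (at t)" if "t \<in> {-\<rho><..<\<rho>}" for n t
    unfolding D_def using smooth_has_vector_derivative[OF f that] smooth_has_vector_derivative[OF g that]
    by (intro has_vector_derivative_add has_vector_derivative_mult_right)
  note * = iter_deriv_seq[of \<rho> "\<lambda>t. \<alpha> * f t + \<beta> * g t" D, OF _ D]
  show "smooth_on_sym \<rho> (\<lambda>t. \<alpha> * f t + \<beta> * g t)" by (rule *(2)) (auto simp: D_def)
  show "t \<in> {-\<rho><..<\<rho>} \<Longrightarrow> iter_deriv n (\<lambda>t. \<alpha> * f t + \<beta> * g t) t = \<alpha> * iter_deriv n f t + \<beta> * iter_deriv n g t"
    using *(1)[of t n] by (simp add: D_def)
qed

lemma smooth_derivative:
  assumes f: "smooth_on_sym \<rho> f" shows "smooth_on_sym \<rho> (\<lambda>t. vector_derivative f (at t))"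
  using assms unfolding smooth_on_sym_def by (auto simp flip: iter_deriv_Suc')

lemma smooth_subspace: "complex_subspace {f. smooth_on_sym \<rho> f}"
proof -
  have "smooth_on_sym \<rho> (\<lambda>_. 0)" by (rule iter_deriv_seq(2)[of _ _ "\<lambda>_ _. 0"]) auto
  then show ?thesis unfolding complex_subspace_def by (auto intro: smooth_lincomb(1))
qed

lemma iter_deriv_entire:
  assumes F: "F holomorphic_on UNIV"
  shows "iter_deriv n (\<lambda>t. F (of_real t)) t = (deriv ^^ n) F (of_real t)"
    and "smooth_on_sym \<rho> (\<lambda>t. F (of_real t))"
proof -
  have D: "((\<lambda>t. (deriv ^^ n) F (of_real t)) has_vector_derivative (deriv ^^ Suc n) F (of_real t)) (at t)" for n t
  proof (rule has_vector_derivative_real_field)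
    have "(deriv ^^ n) F holomorphic_on UNIV" by (rule holomorphic_higher_deriv[OF F open_UNIV])
    then show "((deriv ^^ n) F has_field_derivative (deriv ^^ Suc n) F (of_real t)) (at (of_real t))"
      using holomorphic_derivI[of _ UNIV] by simp
  qed
  have "t \<in> {- (\<bar>t\<bar> + 1)<..<\<bar>t\<bar> + 1}" by auto
  then show "iter_deriv n (\<lambda>t. F (of_real t)) t = (deriv ^^ n) F (of_real t)"
    by (rule iter_deriv_seq(1)[of "\<bar>t\<bar> + 1" _ "\<lambda>n t. (deriv ^^ n) F (of_real t)", rotated 2]) (use D in auto)
  show "smooth_on_sym \<rho> (\<lambda>t. F (of_real t))"
    by (rule iter_deriv_seq(2)[of \<rho> _ "\<lambda>n t. (deriv ^^ n) F (of_real t)"]) (use D in auto)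
qed

text \<open>Cauchy's estimate on unit circles: a bound in a complex neighbourhood controls all
  derivatives on the real interval, so it suffices to estimate entire functions in modulus.\<close>

lemma iter_deriv_entire_le:
  assumes F: "F holomorphic_on UNIV" and B: "\<And>u. norm u \<le> R + 1 \<Longrightarrow> norm (F u) \<le> B" and t: "\<bar>t\<bar> \<le> R"
  shows "norm (iter_deriv n (\<lambda>t. F (of_real t)) t) \<le> fact n * B"
proof -
  have "norm ((deriv ^^ n) F (of_real t)) \<le> fact n * B / 1 ^ n"
  proof (rule Cauchy_inequality)
    show "F holomorphic_on ball (of_real t) 1" "continuous_on (cball (of_real t) 1) F"
      using F by (auto intro: holomorphic_on_subset holomorphic_on_imp_continuous_on)
    fix x :: complex assume "norm (of_real t - x) = 1"
    then have "norm x \<le> R + 1" using norm_triangle_ineq2[of x "of_real t"] t by (simp add: norm_minus_commute)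
    then show "norm (F x) \<le> B" by (rule B)
  qed simp
  then show ?thesis by (simp add: iter_deriv_entire(1)[OF F])
qed

section \<open>Density of polynomials together with their derivatives\<close>

lemma complex_Weierstrass:
  fixes f :: "real \<Rightarrow> complex"
  assumes "continuous_on {a..b} f" "e > 0"
  obtains p where "\<And>t. t \<in> {a..b} \<Longrightarrow> norm (f t - poly p (of_real t)) < e"
proof -
  have "\<exists>g. polynomial_function g \<and> (\<forall>x\<in>{a..b}. norm (f x - g x) < e)"
    by (rule Stone_Weierstrass_polynomial_function[OF compact_Icc assms])
  then obtain g where g: "polynomial_function g" "\<And>x. x \<in> {a..b} \<Longrightarrow> norm (f x - g x) < e"
    by (elim exE conjE) simp
  have "real_polynomial_function (\<lambda>x. Re (g x))" "real_polynomial_function (\<lambda>x. Im (g x))"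
    using g(1) bounded_linear_Re bounded_linear_Im unfolding polynomial_function_def by (auto simp: o_def)
  then obtain a1 n1 a2 n2 where "(\<lambda>x. Re (g x)) = (\<lambda>x. \<Sum>i\<le>n1. a1 i * x ^ i)" "(\<lambda>x. Im (g x)) = (\<lambda>x. \<Sum>i\<le>n2. a2 i * x ^ i)"
    unfolding real_polynomial_function_iff_sum by (elim exE) simp
  from this[THEN fun_cong] have R: "\<And>x. Re (g x) = (\<Sum>i\<le>n1. a1 i * x ^ i)" "\<And>x. Im (g x) = (\<Sum>i\<le>n2. a2 i * x ^ i)" .
  define p where "p = (\<Sum>i\<le>n1. monom (of_real (a1 i)) i) + smult \<i> (\<Sum>i\<le>n2. monom (of_real (a2 i)) i)"
  have "g x = poly p (of_real x)" for x
    by (rule complex_eqI) (auto simp: R p_def poly_sum poly_monom simp flip: of_real_power of_real_mult of_real_sum)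
  then show ?thesis using g(2) by (intro that[of p]) simp
qed

lemma poly_antiderivative:
  fixes p :: "complex poly"
  obtains q where "pderiv q = p" "poly q 0 = v"
proof -
  define q where "q = [:v:] + (\<Sum>i\<le>degree p. monom (coeff p i / of_nat (Suc i)) (Suc i))"
  have "pderiv q = (\<Sum>i\<le>degree p. pderiv (monom (coeff p i / of_nat (Suc i)) (Suc i)))"
    unfolding q_def pderiv_add by (simp add: pderiv_pCons higher_pderiv_sum[of 1, simplified])
  also have "\<dots> = (\<Sum>i\<le>degree p. monom (coeff p i) i)"
    by (intro sum.cong) (auto simp: pderiv_monom simp del: of_nat_Suc)
  also have "\<dots> = p" by (rule poly_as_sum_of_monoms)
  finally have "pderiv q = p" .
  moreover have "poly q 0 = v" by (simp add: q_def poly_sum poly_monom)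
  ultimately show ?thesis using that by blast
qed

lemma vector_derivative_poly: "vector_derivative (\<lambda>t. poly p (of_real t)) (at t) = poly (pderiv p) (of_real t)"
  for p :: "complex poly"
  by (rule vector_derivative_at[OF has_vector_derivative_real_field[OF poly_DERIV]])

text \<open>In the induction step the derivative is approximated together with its derivatives up to
  order \<open>N\<close>; the antiderivative of the approximant that agrees with \<open>f\<close> at
  \<open>0\<close> is then close to \<open>f\<close> by the mean value inequality.\<close>

lemma polynomials_dense:
  assumes R: "0 \<le> R" "R < \<rho>" and f: "smooth_on_sym \<rho> f" and e: "e > 0"
  shows "\<exists>p :: complex poly. \<forall>n\<le>N. \<forall>t\<in>{-R..R}. norm (iter_deriv n f t - iter_deriv n (\<lambda>t. poly p (of_real t)) t) < e"
  using f e
proof (induction N arbitrary: f e)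
  case 0
  have "continuous_on {-R..R} f"
  proof (rule continuous_at_imp_continuous_on, rule ballI)
    fix t assume "t \<in> {-R..R}"
    then have "t \<in> {-\<rho><..<\<rho>}" using R by auto
    then show "isCont f t"
      using smooth_has_vector_derivative[OF 0(1), of t 0] has_vector_derivative_continuous by simp
  qed
  then obtain p :: "complex poly" where "\<And>t. t \<in> {-R..R} \<Longrightarrow> norm (f t - poly p (of_real t)) < e"
    using complex_Weierstrass[OF _ 0(2)] by blast
  then show ?case by (intro exI[of _ p]) simp
next
  case (Suc N)
  define f' where "f' = (\<lambda>t. vector_derivative f (at t))"
  have sf': "smooth_on_sym \<rho> f'" unfolding f'_def by (rule smooth_derivative[OF Suc.prems(1)])
  \<comment> \<open>One choice serves both the derivatives, which need \<open>e' \<le> e\<close>,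
    and the integration over length at most \<open>R\<close>, which needs
    \<open>e' * R < e\<close>.\<close>
  define e' where "e' = e / (R + 1)"
  have e': "e' > 0" "e' \<le> e" "e' * R < e" using Suc.prems(2) R by (auto simp: e'_def field_simps)
  obtain p1 :: "complex poly" where p1: "\<And>n t. n \<le> N \<Longrightarrow> t \<in> {-R..R} \<Longrightarrow>
      norm (iter_deriv n f' t - iter_deriv n (\<lambda>t. poly p1 (of_real t)) t) < e'"
    using Suc.IH[OF sf' e'(1)] by blast
  obtain q where q: "pderiv q = p1" "poly q 0 = f 0" by (rule poly_antiderivative)
  have iq: "iter_deriv (Suc n) (\<lambda>t. poly q (of_real t)) = iter_deriv n (\<lambda>t. poly p1 (of_real t))" for n
    by (simp add: iter_deriv_Suc' vector_derivative_poly q)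
  have "norm (iter_deriv n f t - iter_deriv n (\<lambda>t. poly q (of_real t)) t) < e" if n: "n \<le> Suc N" and t: "t \<in> {-R..R}" for n t
  proof (cases n)
    case 0
    define d where "d = (\<lambda>t. f t - poly q (of_real t))"
    have dd: "(d has_derivative (\<lambda>h. h *\<^sub>R (f' x - poly p1 (of_real x)))) (at x within {-R..R})" if x: "x \<in> {-R..R}" for x
    proof -
      have "x \<in> {-\<rho><..<\<rho>}" using x R by auto
      from smooth_has_vector_derivative[OF Suc.prems(1) this, of 0]
      have "(f has_vector_derivative f' x) (at x)" by (simp add: iter_deriv_Suc f'_def)
      moreover have "((\<lambda>t. poly q (of_real t)) has_vector_derivative poly p1 (of_real x)) (at x)"
        using has_vector_derivative_real_field[OF poly_DERIV[of q]] q(1) by simp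
      ultimately have "(d has_vector_derivative (f' x - poly p1 (of_real x))) (at x)"
        unfolding d_def by (rule has_vector_derivative_diff)
      then show ?thesis unfolding has_vector_derivative_def by (rule has_derivative_at_withinI)
    qed
    have on: "onorm (\<lambda>h. h *\<^sub>R (f' x - poly p1 (of_real x))) \<le> e'" if x: "x \<in> {-R..R}" for x
    proof (rule onorm_le)
      fix h :: real
      have "norm (f' x - poly p1 (of_real x)) \<le> e'" using p1[of 0 x] x by simp
      then have "\<bar>h\<bar> * norm (f' x - poly p1 (of_real x)) \<le> \<bar>h\<bar> * e'" by (rule mult_left_mono) simp
      then show "norm (h *\<^sub>R (f' x - poly p1 (of_real x))) \<le> e' * norm h" by (simp add: mult.commute)
    qed
    have "norm (d t - d 0) \<le> e' * norm (t - 0)"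
      by (rule differentiable_bound[OF convex_real_interval(5) dd on]) (use t R in auto)
    moreover have "d 0 = 0" using q(2) by (simp add: d_def)
    moreover have "e' * norm t \<le> e' * R" using t e'(1) by (intro mult_left_mono) auto
    ultimately show ?thesis using e'(3) by (simp add: 0 d_def)
  next
    case (Suc m)
    have "norm (iter_deriv m f' t - iter_deriv m (\<lambda>t. poly p1 (of_real t)) t) < e'" using p1 n t Suc by simp
    then show ?thesis using e'(2) by (simp add: Suc iq iter_deriv_Suc' f'_def)
  qed
  then show ?case by blast
qed

lemma linear_functional_sum:
  assumes E: "complex_subspace E" and T: "linear_functional_on E T"
    and F: "\<And>i. i \<in> A \<Longrightarrow> F i \<in> E" and fin: "finite A"
  shows "T (\<lambda>z. \<Sum>i\<in>A. \<alpha> i * F i z) = (\<Sum>i\<in>A. \<alpha> i * T (F i))" and "(\<lambda>z. \<Sum>i\<in>A. \<alpha> i * F i z) \<in> E"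
proof -
  have "T (\<lambda>z. \<Sum>i\<in>A. \<alpha> i * F i z) = (\<Sum>i\<in>A. \<alpha> i * T (F i)) \<and> (\<lambda>z. \<Sum>i\<in>A. \<alpha> i * F i z) \<in> E"
    using fin F
  proof (induction A rule: finite_induct)
    case empty
    have z: "(\<lambda>_. 0) \<in> E" using complex_subspaceD(1)[OF E] .
    then show ?case using T[unfolded linear_functional_on_def, rule_format, OF z z, of 0 0] by simp
  next
    case (insert x A)
    have IH: "T (\<lambda>z. \<Sum>i\<in>A. \<alpha> i * F i z) = (\<Sum>i\<in>A. \<alpha> i * T (F i))" "(\<lambda>z. \<Sum>i\<in>A. \<alpha> i * F i z) \<in> E"
      using insert by auto
    have Fx: "F x \<in> E" using insert.prems by simp
    have "T (\<lambda>z. \<alpha> x * F x z + 1 * (\<Sum>i\<in>A. \<alpha> i * F i z)) = \<alpha> x * T (F x) + 1 * T (\<lambda>z. \<Sum>i\<in>A. \<alpha> i * F i z)"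
      by (rule T[unfolded linear_functional_on_def, rule_format, OF Fx IH(2)])
    moreover have "(\<lambda>z. \<alpha> x * F x z + 1 * (\<Sum>i\<in>A. \<alpha> i * F i z)) \<in> E"
      by (rule complex_subspaceD(2)[OF E Fx IH(2)])
    ultimately show ?case using insert.hyps IH by simp
  qed
  then show "T (\<lambda>z. \<Sum>i\<in>A. \<alpha> i * F i z) = (\<Sum>i\<in>A. \<alpha> i * T (F i))" "(\<lambda>z. \<Sum>i\<in>A. \<alpha> i * F i z) \<in> E" by auto
qed

section \<open>Exponential monomials and their span\<close>

definition exp_monomial :: "complex \<Rightarrow> nat \<Rightarrow> real \<Rightarrow> complex" where
  "exp_monomial \<mu> k = (\<lambda>t. of_real t ^ k * exp (- \<i> * \<mu> * of_real t))"

lemma exp_monomial_smooth: "smooth_on_sym \<rho> (exp_monomial \<mu> k)"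
  unfolding exp_monomial_def
  by (rule iter_deriv_entire(2)[of "\<lambda>z. z ^ k * exp (- \<i> * \<mu> * z)"]) (intro holomorphic_intros)

lemma exp_span_subspace: "complex_subspace (exp_span m)"
  unfolding complex_subspace_def
proof (intro conjI ballI allI)
  show "(\<lambda>_. 0) \<in> exp_span m" unfolding exp_span_def by (rule CollectI, intro exI[of _ "{}"]) auto
  fix x y and \<alpha> \<beta> :: complex assume "x \<in> exp_span m" "y \<in> exp_span m"
  then obtain F b G d where F: "x = (\<lambda>t. \<Sum>(\<mu>, k)\<in>F. b \<mu> k * (of_real t ^ k * exp (- \<i> * \<mu> * of_real t)))"
      "finite F" "F \<subseteq> {(\<mu>, k). enat k < m \<mu>}"
    and G: "y = (\<lambda>t. \<Sum>(\<mu>, k)\<in>G. d \<mu> k * (of_real t ^ k * exp (- \<i> * \<mu> * of_real t)))"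
      "finite G" "G \<subseteq> {(\<mu>, k). enat k < m \<mu>}"
    unfolding exp_span_def by blast
  define b' where "b' = (\<lambda>\<mu> k. if (\<mu>, k) \<in> F then b \<mu> k else 0)"
  define d' where "d' = (\<lambda>\<mu> k. if (\<mu>, k) \<in> G then d \<mu> k else 0)"
  have x: "x = (\<lambda>t. \<Sum>(\<mu>, k)\<in>F \<union> G. b' \<mu> k * (of_real t ^ k * exp (- \<i> * \<mu> * of_real t)))"
    unfolding F(1) b'_def using F(2) G(2) by (intro ext sum.mono_neutral_cong_left) (auto split: if_splits)
  have y: "y = (\<lambda>t. \<Sum>(\<mu>, k)\<in>F \<union> G. d' \<mu> k * (of_real t ^ k * exp (- \<i> * \<mu> * of_real t)))"
    unfolding G(1) d'_def using F(2) G(2) by (intro ext sum.mono_neutral_cong_left) (auto split: if_splits)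
  have "(\<lambda>z. \<alpha> * x z + \<beta> * y z) = (\<lambda>t. \<Sum>(\<mu>, k)\<in>F \<union> G. (\<alpha> * b' \<mu> k + \<beta> * d' \<mu> k) * (of_real t ^ k * exp (- \<i> * \<mu> * of_real t)))"
    unfolding x y sum_distrib_left sum.distrib[symmetric]
    by (intro ext sum.cong refl) (auto simp: distrib_right mult.assoc)
  then show "(\<lambda>z. \<alpha> * x z + \<beta> * y z) \<in> exp_span m"
    unfolding exp_span_def using F(2,3) G(2,3)
    by (intro CollectI exI[of _ "F \<union> G"] exI[of _ "\<lambda>\<mu> k. \<alpha> * b' \<mu> k + \<beta> * d' \<mu> k"]) auto
qed

lemma exp_monomial_in_span: "enat k < m \<mu> \<Longrightarrow> exp_monomial \<mu> k \<in> exp_span m"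
  unfolding exp_span_def exp_monomial_def
  by (rule CollectI, intro exI[of _ "{(\<mu>, k)}"] exI[of _ "\<lambda>_ _. 1"]) auto

lemma exp_span_smooth: "exp_span m \<subseteq> {f. smooth_on_sym \<rho> f}"
proof
  fix f assume "f \<in> exp_span m"
  then obtain F b where F: "f = (\<lambda>t. \<Sum>(\<mu>, k)\<in>F. b \<mu> k * (of_real t ^ k * exp (- \<i> * \<mu> * of_real t)))" "finite F"
    unfolding exp_span_def by blast
  have "f = (\<lambda>t. (\<lambda>z. \<Sum>(\<mu>, k)\<in>F. b \<mu> k * (z ^ k * exp (- \<i> * \<mu> * z))) (of_real t))" by (simp add: F(1))
  moreover have "(\<lambda>z. \<Sum>(\<mu>, k)\<in>F. b \<mu> k * (z ^ k * exp (- \<i> * \<mu> * z))) holomorphic_on UNIV"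
    unfolding case_prod_beta by (intro holomorphic_intros)
  ultimately show "f \<in> {f. smooth_on_sym \<rho> f}" using iter_deriv_entire(2) by simp
qed

section \<open>The Fourier-Laplace transform of a functional on smooth functions\<close>

lemma exp_taylor_remainder:
  fixes w :: complex
  assumes "norm w \<le> X"
  shows "norm (exp w - (\<Sum>k\<le>n. w ^ k / fact k)) \<le> exp X * X ^ Suc n / fact n"
proof -
  have "norm (exp w - (\<Sum>k\<le>n. w ^ k / fact k)) \<le> exp \<bar>Re w\<bar> * norm w ^ Suc n / fact n"
    by (rule Taylor_exp)
  also have "\<dots> \<le> exp X * X ^ Suc n / fact n"
    using assms abs_Re_le_cmod[of w] by (intro divide_right_mono mult_mono power_mono) auto
  finally show ?thesis .
qed

lemma exp_taylor_bound_tendsto: "(\<lambda>n. exp X * X ^ Suc n / fact n) \<longlonglongrightarrow> (0::real)"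
proof -
  have "summable (\<lambda>n. inverse (fact n) * X ^ n)" by (rule summable_exp)
  then have "(\<lambda>n. inverse (fact n) * X ^ n) \<longlonglongrightarrow> 0" by (rule summable_LIMSEQ_zero)
  then have "(\<lambda>n. (exp X * X) * (inverse (fact n) * X ^ n)) \<longlonglongrightarrow> (exp X * X) * 0" by (intro tendsto_intros)
  moreover have "(\<lambda>n. (exp X * X) * (inverse (fact n) * X ^ n)) = (\<lambda>n. exp X * X ^ Suc n / fact n)"
    by (auto simp: field_simps)
  ultimately show ?thesis by simp
qed

text \<open>In substance a distribution of order at most \<open>N\<close> carried by the compact
  interval from \<open>-R\<close> to \<open>R\<close>, where \<open>R < \<rho>\<close>.\<close>

locale smooth_functional =
  fixes T :: "(real \<Rightarrow> complex) \<Rightarrow> complex" and \<rho> R A :: real and N :: nat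
  assumes R: "0 \<le> R" "R < \<rho>" and A: "0 \<le> A"
    and T_linear: "linear_functional_on {f. smooth_on_sym \<rho> f} T"
    and T_bound: "\<And>f B. smooth_on_sym \<rho> f \<Longrightarrow>
      (\<And>n t. n \<le> N \<Longrightarrow> t \<in> {-R..R} \<Longrightarrow> norm (iter_deriv n f t) \<le> B) \<Longrightarrow> norm (T f) \<le> A * B"
begin

lemma T_lincomb: "smooth_on_sym \<rho> f \<Longrightarrow> smooth_on_sym \<rho> g \<Longrightarrow>
    T (\<lambda>t. \<alpha> * f t + \<beta> * g t) = \<alpha> * T f + \<beta> * T g"
  using T_linear unfolding linear_functional_on_def by blast

lemma T_entire_le:
  assumes F: "F holomorphic_on UNIV" and B: "\<And>u. norm u \<le> R + 1 \<Longrightarrow> norm (F u) \<le> B"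
  shows "norm (T (\<lambda>t. F (of_real t))) \<le> A * (fact N * B)"
proof (rule T_bound[OF iter_deriv_entire(2)[OF F]])
  fix n t assume n: "n \<le> N" and t: "t \<in> {-R..R}"
  have "0 \<le> B" using order_trans[OF norm_ge_zero B[of 0]] R by simp
  then have "fact n * B \<le> fact N * B" using n by (intro mult_right_mono fact_mono) auto
  moreover have "norm (iter_deriv n (\<lambda>t. F (of_real t)) t) \<le> fact n * B"
    by (rule iter_deriv_entire_le[OF F B]) (use t in auto)
  ultimately show "norm (iter_deriv n (\<lambda>t. F (of_real t)) t) \<le> fact N * B" by linarith
qed

definition transform :: "complex \<Rightarrow> complex" where
  "transform z = T (exp_monomial z 0)"

definition transform_coeff :: "complex \<Rightarrow> nat \<Rightarrow> complex" where
  "transform_coeff \<mu> k = (- \<i>) ^ k / fact k * T (exp_monomial \<mu> k)"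

text \<open>The functional may be applied termwise: the remainder of the exponential series is small
  for \<open>norm u \<le> R + 1\<close>, and by Cauchy's estimate this controls the derivatives seen
  by \<open>T\<close>. The numbers \<open>transform_coeff \<mu> k\<close> are thus the Taylor
  coefficients at \<open>\<mu>\<close>.\<close>

lemma transform_sums: "(\<lambda>k. transform_coeff \<mu> k * h ^ k) sums transform (\<mu> + h)"
proof -
  define X where "X = norm h * (R + 1)"
  define D where "D = exp (norm \<mu> * (R + 1))"
  define a where "a = (\<lambda>k. (- \<i> * h) ^ k / fact k)"
  have sm: "exp_monomial \<mu> k \<in> {f. smooth_on_sym \<rho> f}" for k using exp_monomial_smooth by simp
  have bound: "norm (transform (\<mu> + h) - (\<Sum>k\<le>n. transform_coeff \<mu> k * h ^ k)) \<le> A * (fact N * (D * (exp X * X ^ Suc n / fact n)))" for n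
  proof -
    define F where "F = (\<lambda>u. exp (- \<i> * \<mu> * u) * (exp (- \<i> * h * u) - (\<Sum>k\<le>n. (- \<i> * h * u) ^ k / fact k)))"
    have holF: "F holomorphic_on UNIV" unfolding F_def by (intro holomorphic_intros) auto
    have "T (\<lambda>t. F (of_real t)) = T (\<lambda>t. 1 * exp_monomial (\<mu> + h) 0 t + (-1) * (\<Sum>k\<le>n. a k * exp_monomial \<mu> k t))"
    proof (rule arg_cong[of _ _ T], rule ext)
      fix t
      have "exp (- \<i> * (\<mu> + h) * of_real t) = exp (- \<i> * \<mu> * of_real t) * exp (- \<i> * h * of_real t)"
        by (simp add: algebra_simps flip: exp_add)
      moreover have "exp (- \<i> * \<mu> * of_real t) * (\<Sum>k\<le>n. (- \<i> * h * of_real t) ^ k / fact k) = (\<Sum>k\<le>n. a k * exp_monomial \<mu> k t)"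
        unfolding sum_distrib_left
      proof (rule sum.cong[OF refl])
        fix k
        have "(- \<i> * h * of_real t) ^ k = (- \<i> * h) ^ k * of_real t ^ k" by (simp only: power_mult_distrib)
        then show "exp (- \<i> * \<mu> * of_real t) * ((- \<i> * h * of_real t) ^ k / fact k) = a k * exp_monomial \<mu> k t"
          by (simp add: a_def exp_monomial_def)
      qed
      ultimately show "F (of_real t) = 1 * exp_monomial (\<mu> + h) 0 t + (-1) * (\<Sum>k\<le>n. a k * exp_monomial \<mu> k t)"
        by (simp add: F_def exp_monomial_def right_diff_distrib)
    qed
    also have "\<dots> = 1 * transform (\<mu> + h) + (-1) * T (\<lambda>t. \<Sum>k\<le>n. a k * exp_monomial \<mu> k t)"
      unfolding transform_def
    proof (rule T_lincomb[OF exp_monomial_smooth])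
      have "(\<lambda>t. \<Sum>k\<le>n. a k * exp_monomial \<mu> k t) \<in> {f. smooth_on_sym \<rho> f}"
        by (rule linear_functional_sum(2)[OF smooth_subspace T_linear sm]) simp
      then show "smooth_on_sym \<rho> (\<lambda>t. \<Sum>k\<le>n. a k * exp_monomial \<mu> k t)" by simp
    qed
    also have "T (\<lambda>t. \<Sum>k\<le>n. a k * exp_monomial \<mu> k t) = (\<Sum>k\<le>n. a k * T (exp_monomial \<mu> k))"
      by (rule linear_functional_sum(1)[OF smooth_subspace T_linear sm]) simp
    also have "\<dots> = (\<Sum>k\<le>n. transform_coeff \<mu> k * h ^ k)"
    proof (rule sum.cong[OF refl])
      fix k
      have "(- \<i> * h) ^ k = (- \<i>) ^ k * h ^ k" by (simp only: power_mult_distrib)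
      then show "a k * T (exp_monomial \<mu> k) = transform_coeff \<mu> k * h ^ k"
        by (simp only: a_def transform_coeff_def) simp
    qed
    finally have eq: "T (\<lambda>t. F (of_real t)) = transform (\<mu> + h) - (\<Sum>k\<le>n. transform_coeff \<mu> k * h ^ k)" by simp
    have "norm (F u) \<le> D * (exp X * X ^ Suc n / fact n)" if u: "norm u \<le> R + 1" for u
      unfolding F_def norm_mult
    proof (rule mult_mono)
      have "norm (exp (- \<i> * \<mu> * u)) \<le> exp (norm (- \<i> * \<mu> * u))" by (rule norm_exp)
      also have "\<dots> \<le> D" unfolding D_def using u by (auto simp: norm_mult intro: mult_left_mono)
      finally show "norm (exp (- \<i> * \<mu> * u)) \<le> D" .
      show "norm (exp (- \<i> * h * u) - (\<Sum>k\<le>n. (- \<i> * h * u) ^ k / fact k)) \<le> exp X * X ^ Suc n / fact n"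
        by (rule exp_taylor_remainder) (use u in \<open>auto simp: X_def norm_mult intro: mult_left_mono\<close>)
    qed (auto simp: D_def)
    from T_entire_le[OF holF this] show ?thesis by (simp add: eq)
  qed
  have "(\<lambda>n. \<Sum>k\<le>n. transform_coeff \<mu> k * h ^ k) \<longlonglongrightarrow> transform (\<mu> + h)"
  proof (rule LIM_zero_cancel, rule Lim_null_comparison)
    show "\<forall>\<^sub>F n in sequentially. norm ((\<Sum>k\<le>n. transform_coeff \<mu> k * h ^ k) - transform (\<mu> + h))
        \<le> A * (fact N * (D * (exp X * X ^ Suc n / fact n)))"
      using bound by (simp add: norm_minus_commute)
    have "(\<lambda>n. A * (fact N * (D * (exp X * X ^ Suc n / fact n)))) \<longlonglongrightarrow> A * (fact N * (D * 0))"
      by (intro tendsto_mult tendsto_const exp_taylor_bound_tendsto)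
    then show "(\<lambda>n. A * (fact N * (D * (exp X * X ^ Suc n / fact n)))) \<longlonglongrightarrow> 0" by simp
  qed
  then show ?thesis unfolding sums_def_le by simp
qed

text \<open>Annihilated exponential monomials are vanishing Taylor coefficients. The value of
  \<open>q\<close> at \<open>\<mu>\<close> is recorded because \<open>transform_nonzero\<close>
  reads off the next coefficient from it.\<close>

lemma transform_factor:
  assumes "\<And>k. k < n \<Longrightarrow> T (exp_monomial \<mu> k) = 0"
  obtains q where "q holomorphic_on UNIV" "\<And>z. transform z = (z - \<mu>) ^ n * q z" "q \<mu> = transform_coeff \<mu> n"
proof -
  have c0: "transform_coeff \<mu> k = 0" if "k < n" for k using assms[OF that] by (simp add: transform_coeff_def)
  have sm: "summable (\<lambda>k. transform_coeff \<mu> (k + n) * h ^ k)" for h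
  proof (cases "h = 0")
    case True
    show ?thesis unfolding True by (rule summable_finite[of "{0}"]) auto
  next
    case False
    have "summable (\<lambda>k. transform_coeff \<mu> (k + n) * h ^ (k + n))"
      using sums_summable[OF transform_sums[of \<mu> h]] by (rule summable_ignore_initial_segment)
    then have "summable (\<lambda>k. (transform_coeff \<mu> (k + n) * h ^ (k + n)) / h ^ n)" by (rule summable_divide)
    then show ?thesis using False by (simp add: power_add)
  qed
  define q where "q = (\<lambda>z. \<Sum>k. transform_coeff \<mu> (k + n) * (z - \<mu>) ^ k)"
  show ?thesis
  proof (rule that[of q])
    have "q field_differentiable at z" for z
    proof -
      have "q holomorphic_on ball \<mu> (norm (z - \<mu>) + 1)"
        by (rule power_series_holomorphic) (auto simp: q_def intro: summable_sums sm)
      then show ?thesis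
        by (rule holomorphic_on_imp_differentiable_at) (auto simp: dist_norm norm_minus_commute)
    qed
    then show "q holomorphic_on UNIV" by (simp add: holomorphic_on_def)
    show "q \<mu> = transform_coeff \<mu> n" unfolding q_def by (subst suminf_finite[of "{0}"]) auto
    fix z
    have "(\<lambda>k. transform_coeff \<mu> (k + n) * (z - \<mu>) ^ (k + n)) sums transform z"
      using transform_sums[of \<mu> "z - \<mu>"] sums_iff_shift'[of "\<lambda>k. transform_coeff \<mu> k * (z - \<mu>) ^ k" n "transform z"] c0
      by simp
    moreover have "(\<lambda>k. (z - \<mu>) ^ n * (transform_coeff \<mu> (k + n) * (z - \<mu>) ^ k)) sums ((z - \<mu>) ^ n * q z)"
      unfolding q_def by (intro sums_mult summable_sums sm)
    ultimately show "transform z = (z - \<mu>) ^ n * q z"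
      using sums_unique2 by (simp add: power_add mult_ac) blast
  qed
qed

lemma transform_holomorphic: "transform holomorphic_on UNIV"
proof -
  obtain q where q: "q holomorphic_on UNIV" "\<And>z. transform z = (z - 0) ^ 0 * q z"
    using transform_factor[of 0 0] by blast
  have "transform = q" using q(2) by (auto simp: fun_eq_iff)
  then show ?thesis using q(1) by simp
qed

text \<open>If the transform vanished identically, all its Taylor coefficients at \<open>0\<close>
  would vanish, so \<open>T\<close> would annihilate every polynomial and, by density, every smooth
  function.\<close>

lemma transform_nonzero:
  assumes f: "smooth_on_sym \<rho> f" "T f \<noteq> 0"
  obtains u where "transform u \<noteq> 0"
proof (rule ccontr)
  assume "\<not> thesis"
  then have z: "transform u = 0" for u using that by blast
  have T0: "T (exp_monomial 0 k) = 0" for k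
  proof (induction k rule: less_induct)
    case (less k)
    obtain q where q: "q holomorphic_on UNIV" "\<And>z. transform z = (z - 0) ^ k * q z" "q 0 = transform_coeff 0 k"
      using transform_factor[OF less] by blast
    have "q 0 = 0"
    proof (rule entire_mult_eq_zero[of "\<lambda>z. (z - 0) ^ k" q 1])
      show "(z - 0) ^ k * q z = 0" for z using q(2)[of z] z[of z] by simp
    qed (auto intro!: holomorphic_intros q(1))
    then show ?case using q(3) by (auto simp: transform_coeff_def)
  qed
  have Tpoly: "T (\<lambda>t. poly p (of_real t)) = 0" for p
  proof -
    have "T (\<lambda>t. poly p (of_real t)) = T (\<lambda>t. \<Sum>k\<le>degree p. coeff p k * exp_monomial 0 k t)"
      by (simp add: poly_altdef exp_monomial_def)
    also have "\<dots> = (\<Sum>k\<le>degree p. coeff p k * T (exp_monomial 0 k))"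
      by (rule linear_functional_sum(1)[OF smooth_subspace T_linear]) (auto simp: exp_monomial_smooth)
    finally show ?thesis by (simp add: T0)
  qed
  have "norm (T f) \<le> A * e" if e: "e > 0" for e
  proof -
    obtain p :: "complex poly" where p: "\<And>n t. n \<le> N \<Longrightarrow> t \<in> {-R..R} \<Longrightarrow>
        norm (iter_deriv n f t - iter_deriv n (\<lambda>t. poly p (of_real t)) t) < e"
      using polynomials_dense[OF R f(1) e, of N] by blast
    have sp: "smooth_on_sym \<rho> (\<lambda>t. poly p (of_real t))"
      by (rule iter_deriv_entire(2)) (intro holomorphic_intros)
    define d where "d = (\<lambda>t. 1 * f t + (-1) * poly p (of_real t))"
    have "norm (T d) \<le> A * e"
    proof (rule T_bound)
      show "smooth_on_sym \<rho> d" unfolding d_def by (rule smooth_lincomb(1)[OF f(1) sp])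
      fix n t assume n: "n \<le> N" and t: "t \<in> {-R..R}"
      then have "t \<in> {-\<rho><..<\<rho>}" using R by auto
      then have "iter_deriv n d t = 1 * iter_deriv n f t + (-1) * iter_deriv n (\<lambda>t. poly p (of_real t)) t"
        unfolding d_def by (rule smooth_lincomb(2)[OF f(1) sp])
      then show "norm (iter_deriv n d t) \<le> e" using p[OF n t] by simp
    qed
    moreover have "T d = 1 * T f + (-1) * T (\<lambda>t. poly p (of_real t))"
      unfolding d_def by (rule T_lincomb[OF f(1) sp])
    ultimately show ?thesis using Tpoly by simp
  qed
  note le = this
  have "norm (T f) \<le> 0 + d" if d: "d > 0" for d
  proof -
    have "d / (A + 1) > 0" using A d by simp
    from le[OF this] have "norm (T f) \<le> A * (d / (A + 1))" .
    also have "\<dots> \<le> (A + 1) * (d / (A + 1))" using A d by (intro mult_right_mono) auto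
    also have "\<dots> = d" using A by simp
    finally show ?thesis by simp
  qed
  then have "norm (T f) \<le> 0" by (rule field_le_epsilon)
  then show False using f(2) by simp
qed

text \<open>The elementary half of the Paley-Wiener-Schwartz theorem: \<open>n\<close> derivatives
  of the exponential bring down the \<open>n\<close>-th power of \<open>z\<close>, and
  \<open>n\<close> is at most \<open>N\<close>.\<close>

lemma transform_bound: "norm (transform z) \<le> A * (1 + norm z) ^ N * exp (R * \<bar>Im z\<bar>)"
proof -
  have "norm (T (exp_monomial z 0)) \<le> A * ((1 + norm z) ^ N * exp (R * \<bar>Im z\<bar>))"
  proof (rule T_bound[OF exp_monomial_smooth])
    fix n t assume n: "n \<le> N" and t: "t \<in> {-R..R}"
    define F where "F = (\<lambda>u. exp (- \<i> * z * u))"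
    have F: "F holomorphic_on UNIV" unfolding F_def by (intro holomorphic_intros)
    have "(deriv ^^ k) F = (\<lambda>u. (- \<i> * z) ^ k * F u)" for k
    proof (induction k)
      case (Suc k)
      have "((\<lambda>u. (- \<i> * z) ^ k * F u) has_field_derivative (- \<i> * z) ^ Suc k * F u) (at u)" for u
        unfolding F_def by (auto intro!: derivative_eq_intros)
      from DERIV_imp_deriv[OF this] show ?case by (simp only: funpow.simps o_apply Suc)
    qed simp
    moreover have "exp_monomial z 0 = (\<lambda>t. F (of_real t))" by (simp add: exp_monomial_def F_def)
    ultimately have "iter_deriv n (exp_monomial z 0) t = (- \<i> * z) ^ n * F (of_real t)"
      using iter_deriv_entire(1)[OF F] by simp
    then have eq: "norm (iter_deriv n (exp_monomial z 0) t) = norm z ^ n * exp (t * Im z)"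
      by (simp add: norm_mult norm_power F_def mult.commute)
    have "norm z ^ n \<le> (1 + norm z) ^ n" by (intro power_mono) auto
    also have "\<dots> \<le> (1 + norm z) ^ N" using n by (intro power_increasing) auto
    finally have 1: "norm z ^ n \<le> (1 + norm z) ^ N" .
    have "t * Im z \<le> \<bar>t\<bar> * \<bar>Im z\<bar>" by (metis abs_ge_self abs_mult)
    also have "\<dots> \<le> R * \<bar>Im z\<bar>" using t by (intro mult_right_mono) auto
    finally show "norm (iter_deriv n (exp_monomial z 0) t) \<le> (1 + norm z) ^ N * exp (R * \<bar>Im z\<bar>)"
      unfolding eq using 1 by (intro mult_mono) auto
  qed
  then show ?thesis by (simp add: transform_def mult.assoc)
qed

end

text \<open>Failure of density is witnessed by a single seminorm, hence by a compact set and
  finitely many derivatives. The separating functional has finite order and compact carrier, which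
  yields polynomial growth on the real line and \<open>R < \<rho>\<close> strictly.\<close>

theorem incomplete_imp_entire_function:
  assumes "\<not> exp_complete m \<rho>"
  obtains f u R A N where "f holomorphic_on UNIV" "f u \<noteq> 0" "0 \<le> R" "R < \<rho>" "0 \<le> A"
    "\<And>z. norm (f z) \<le> A * (1 + norm z) ^ N * exp (R * \<bar>Im z\<bar>)"
    "\<And>\<mu> n. enat n \<le> m \<mu> \<Longrightarrow> \<exists>q. q holomorphic_on UNIV \<and> (\<forall>z. f z = (z - \<mu>) ^ n * q z)"
proof -
  obtain f0 K N e where f0: "smooth_on_sym \<rho> f0" and e: "e > 0" and K: "compact K" "K \<subseteq> {-\<rho><..<\<rho>}"
    and no: "\<not> (\<exists>g\<in>exp_span m. \<forall>n\<le>N. \<forall>t\<in>K. norm (iter_deriv n f0 t - iter_deriv n g t) < e)"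
    using assms unfolding exp_complete_def by blast
  have no': "\<exists>n\<le>N. \<exists>t\<in>K. e \<le> norm (iter_deriv n f0 t - iter_deriv n g t)" if "g \<in> exp_span m" for g
    using no that by (meson not_le)
  define E where "E = {f. smooth_on_sym \<rho> f}"
  note subE = smooth_subspace[of \<rho>, folded E_def]
  have "K \<noteq> {}" using no'[OF complex_subspaceD(1)[OF exp_span_subspace]] by blast
  moreover have "continuous_on K (\<lambda>t::real. \<bar>t\<bar>)" by (intro continuous_intros)
  ultimately obtain t0 where t0: "t0 \<in> K" "\<And>t. t \<in> K \<Longrightarrow> \<bar>t\<bar> \<le> \<bar>t0\<bar>"
    using continuous_attains_sup[OF K(1)] by metis
  \<comment> \<open>The maximum of \<open>\<bar>t\<bar>\<close> over \<open>K\<close> is attained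
    inside the open interval; the resulting slack \<open>\<rho> - R\<close> later absorbs the
    polynomial factor.\<close>
  define R where "R = \<bar>t0\<bar>"
  have "t0 \<in> {-\<rho><..<\<rho>}" using t0(1) K(2) by blast
  then have R: "0 \<le> R" "R < \<rho>" by (auto simp: R_def)
  have KR: "t \<in> {-R..R}" if "t \<in> K" for t using t0(2)[OF that] by (auto simp: R_def)
  define I where "I = {..N} \<times> K"
  have I: "I \<noteq> {}" using \<open>K \<noteq> {}\<close> by (auto simp: I_def)
  \<comment> \<open>Division by \<open>e\<close> normalises the distance of \<open>f0\<close> from
    the span to at least \<open>1\<close>, as the separation theorem requires.\<close>
  define v where "v = (\<lambda>f (n, t). norm (iter_deriv n f t) / e)"
  define p where "p = (\<lambda>f. SUP i\<in>I. v f i)"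
  have bdd: "bdd_above (v f ` I)" if f: "f \<in> E" for f
  proof -
    have "\<exists>B. \<forall>t\<in>K. norm (iter_deriv n f t) \<le> B" for n
    proof -
      have "continuous_on K (iter_deriv n f)"
      proof (rule continuous_at_imp_continuous_on, rule ballI)
        fix t assume "t \<in> K"
        then have "t \<in> {-\<rho><..<\<rho>}" using K(2) by blast
        then show "isCont (iter_deriv n f) t"
          using smooth_has_vector_derivative[of \<rho> f t n] f has_vector_derivative_continuous unfolding E_def by blast
      qed
      then have "bounded (iter_deriv n f ` K)" using K(1) compact_continuous_image compact_imp_bounded by blast
      then show ?thesis unfolding bounded_iff by blast
    qed
    then obtain B where B: "\<And>n t. t \<in> K \<Longrightarrow> norm (iter_deriv n f t) \<le> B n" by metis
    show ?thesis
    proof (rule bdd_aboveI)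
      fix x assume "x \<in> v f ` I"
      then obtain n t where nt: "n \<le> N" "t \<in> K" "x = norm (iter_deriv n f t) / e" by (auto simp: I_def v_def)
      have "norm (iter_deriv n f t) \<le> \<bar>B n\<bar>" using B[OF nt(2), of n] by linarith
      also have "\<dots> \<le> (\<Sum>n\<le>N. \<bar>B n\<bar>)" using nt(1) by (intro member_le_sum) auto
      finally show "x \<le> (\<Sum>n\<le>N. \<bar>B n\<bar>) / e" using nt(3) e by (simp add: divide_right_mono)
    qed
  qed
  have up: "v f i \<le> p f" if "f \<in> E" "i \<in> I" for f i
    unfolding p_def by (rule cSUP_upper[OF that(2) bdd[OF that(1)]])
  have least: "p f \<le> x" if "\<And>i. i \<in> I \<Longrightarrow> v f i \<le> x" for f x
    unfolding p_def by (rule cSUP_least[OF I that])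
  have lin: "v (\<lambda>t. \<alpha> * f t + \<beta> * g t) i \<le> norm \<alpha> * v f i + norm \<beta> * v g i"
    if fg: "f \<in> E" "g \<in> E" and i: "i \<in> I" for f g \<alpha> \<beta> i
  proof (cases i)
    case (Pair n t)
    then have t: "t \<in> {-\<rho><..<\<rho>}" using i K(2) by (auto simp: I_def)
    have "norm (iter_deriv n (\<lambda>t. \<alpha> * f t + \<beta> * g t) t) = norm (\<alpha> * iter_deriv n f t + \<beta> * iter_deriv n g t)"
      using smooth_lincomb(2)[OF _ _ t] fg by (simp add: E_def)
    also have "\<dots> \<le> norm \<alpha> * norm (iter_deriv n f t) + norm \<beta> * norm (iter_deriv n g t)"
      using norm_triangle_ineq[of "\<alpha> * iter_deriv n f t" "\<beta> * iter_deriv n g t"] by (simp add: norm_mult)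
    finally have "norm (iter_deriv n (\<lambda>t. \<alpha> * f t + \<beta> * g t) t) / e
        \<le> (norm \<alpha> * norm (iter_deriv n f t) + norm \<beta> * norm (iter_deriv n g t)) / e"
      using e by (intro divide_right_mono) auto
    then show ?thesis by (simp add: v_def Pair add_divide_distrib)
  qed
  have v0: "0 \<le> v f i" for f i using e by (cases i) (simp add: v_def)
  have scale_le: "p (\<lambda>z. \<alpha> * f z) \<le> norm \<alpha> * p f" if f: "f \<in> E" for f \<alpha>
  proof (rule least)
    fix i assume i: "i \<in> I"
    have "v (\<lambda>t. \<alpha> * f t + 0 * f t) i \<le> norm \<alpha> * v f i + norm (0::complex) * v f i" by (rule lin[OF f f i])
    also have "\<dots> \<le> norm \<alpha> * p f" using up[OF f i] by (simp add: mult_left_mono)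
    finally show "v (\<lambda>z. \<alpha> * f z) i \<le> norm \<alpha> * p f" by simp
  qed
  have semi: "seminorm_on E p" unfolding seminorm_on_def
  proof (intro conjI ballI allI)
    fix x y assume xy: "x \<in> E" "y \<in> E"
    show "p (\<lambda>z. x z + y z) \<le> p x + p y"
    proof (rule least)
      fix i assume i: "i \<in> I"
      have "v (\<lambda>t. 1 * x t + 1 * y t) i \<le> norm (1::complex) * v x i + norm (1::complex) * v y i" by (rule lin[OF xy i])
      then show "v (\<lambda>z. x z + y z) i \<le> p x + p y" using up[OF xy(1) i] up[OF xy(2) i] by simp
    qed
  next
    fix x and \<alpha> :: complex assume x: "x \<in> E"
    show "p (\<lambda>z. \<alpha> * x z) = norm \<alpha> * p x"
    proof (rule antisym[OF scale_le[OF x]])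
      show "norm \<alpha> * p x \<le> p (\<lambda>z. \<alpha> * x z)"
      proof (cases "\<alpha> = 0")
        case False
        have "p (\<lambda>z. inverse \<alpha> * (\<alpha> * x z)) \<le> norm (inverse \<alpha>) * p (\<lambda>z. \<alpha> * x z)"
          by (rule scale_le[OF complex_subspaceD(3)[OF subE x]])
        then have "p x \<le> norm (inverse \<alpha>) * p (\<lambda>z. \<alpha> * x z)" using False by (simp flip: mult.assoc)
        then have "norm \<alpha> * p x \<le> norm \<alpha> * (norm (inverse \<alpha>) * p (\<lambda>z. \<alpha> * x z))"
          by (rule mult_left_mono) simp
        also have "\<dots> = p (\<lambda>z. \<alpha> * x z)" using False by (simp add: norm_inverse)
        finally show ?thesis .
      next
        case True
        obtain i where i: "i \<in> I" using I by blast
        have "0 \<le> p (\<lambda>z. \<alpha> * x z)"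
          using up[OF complex_subspaceD(3)[OF subE x] i] v0 order_trans by blast
        then show ?thesis using True by simp
      qed
    qed
  qed
  have dist: "1 \<le> p (\<lambda>z. f0 z - g z)" if g: "g \<in> exp_span m" for g
  proof -
    have gE: "g \<in> E" using g exp_span_smooth E_def by blast
    have f0E: "f0 \<in> E" using f0 by (simp add: E_def)
    obtain n t where nt: "n \<le> N" "t \<in> K" "e \<le> norm (iter_deriv n f0 t - iter_deriv n g t)" using no'[OF g] by blast
    then have t: "t \<in> {-\<rho><..<\<rho>}" using K(2) by blast
    have "iter_deriv n (\<lambda>z. 1 * f0 z + (-1) * g z) t = 1 * iter_deriv n f0 t + (-1) * iter_deriv n g t"
      by (rule smooth_lincomb(2)[OF f0 _ t]) (use gE E_def in simp)
    then have "1 \<le> v (\<lambda>z. f0 z - g z) (n, t)" using nt(3) e by (simp add: v_def)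
    also have "\<dots> \<le> p (\<lambda>z. f0 z - g z)"
      by (rule up[OF complex_subspaceD(5)[OF subE f0E gE]]) (use nt in \<open>simp add: I_def\<close>)
    finally show ?thesis .
  qed
  obtain T where T: "linear_functional_on E T" "\<And>g. g \<in> exp_span m \<Longrightarrow> T g = 0" "T f0 \<noteq> 0"
    "\<And>x. x \<in> E \<Longrightarrow> norm (T x) \<le> 2 * p x"
    using Hahn_Banach_separation[OF subE exp_span_subspace exp_span_smooth[of m \<rho>, folded E_def] semi _ dist] f0 E_def by blast
  interpret smooth_functional T \<rho> R "2 / e" N
  proof
    show "linear_functional_on {f. smooth_on_sym \<rho> f} T" using T(1) by (simp add: E_def)
    fix f B assume f: "smooth_on_sym \<rho> f" and B: "\<And>n t. n \<le> N \<Longrightarrow> t \<in> {-R..R} \<Longrightarrow> norm (iter_deriv n f t) \<le> B"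
    have fE: "f \<in> E" using f by (simp add: E_def)
    have "p f \<le> B / e"
    proof (rule least)
      fix i assume "i \<in> I"
      then obtain n t where "i = (n, t)" "n \<le> N" "t \<in> {-R..R}" using KR by (auto simp: I_def)
      then show "v f i \<le> B / e" using B e by (simp add: v_def divide_right_mono)
    qed
    then show "norm (T f) \<le> 2 / e * B" using T(4)[OF fE] by simp
  qed (use R e in auto)
  obtain u where u: "transform u \<noteq> 0" using transform_nonzero[OF f0 T(3)] by blast
  show ?thesis
  proof (rule that[of transform u R "2 / e" N])
    show "\<exists>q. q holomorphic_on UNIV \<and> (\<forall>z. transform z = (z - \<mu>) ^ n * q z)" if n: "enat n \<le> m \<mu>" for \<mu> n
    proof -
      have "T (exp_monomial \<mu> k) = 0" if "k < n" for k
      proof (rule T(2), rule exp_monomial_in_span)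
        have "enat k < enat n" using that by simp
        then show "enat k < m \<mu>" using n by (rule less_le_trans)
      qed
      then show ?thesis using transform_factor[of n \<mu>] by metis
    qed
  qed (use transform_holomorphic u R e transform_bound in auto)
qed

section \<open>Indicators and weak localisability\<close>

lemma ln_norm_less_imp:
  assumes "ln_norm u / ereal y < ereal h" "y > 0"
  shows "norm u \<le> exp (h * y)"
proof (cases "u = 0")
  case False
  then have "ereal (ln (norm u)) / ereal y < ereal h" using assms(1) by (simp add: ln_norm_def)
  then have "ln (norm u) < h * y" using assms(2) by (simp add: divide_less_eq)
  then have "exp (ln (norm u)) \<le> exp (h * y)" by simp
  then show ?thesis using False by simp
qed simp

lemma ln_norm_le:
  assumes "norm u < exp (h * y)" "y > 0"
  shows "ln_norm u / ereal y \<le> ereal h"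
proof (cases "u = 0")
  case True
  then show ?thesis using assms(2) by (simp add: ln_norm_def)
next
  case False
  then have "ln (norm u) \<le> ln (exp (h * y))" using assms(1) by (subst ln_le_cancel_iff) auto
  then show ?thesis using assms(2) False by (simp add: ln_norm_def divide_le_eq)
qed

lemma d_fun_alt: "d_fun f = Limsup at_top (\<lambda>y. ln_norm (f (\<i> * of_real y)) / ereal y)"
  by (simp add: d_fun_def indicator_fun_def mult.commute)

lemma d_fun_reflect: "d_fun (\<lambda>z. f (-1 * z)) = - c_fun f"
proof -
  have "cis (- (pi / 2)) = - \<i>" by (simp add: cis.ctr complex_eq_iff)
  then show ?thesis by (simp add: d_fun_alt c_fun_def indicator_fun_def mult.commute)
qed

lemma upper_type_of_d_fun:
  assumes f: "f holomorphic_on UNIV" and d: "d_fun f < ereal h"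
  shows "upper_type f h"
proof -
  have "\<forall>\<^sub>F y in at_top. ln_norm (f (\<i> * of_real y)) / ereal y < ereal h"
    using d unfolding d_fun_alt by (rule Limsup_lessD)
  then obtain Y where Y: "\<And>y. y \<ge> Y \<Longrightarrow> ln_norm (f (\<i> * of_real y)) / ereal y < ereal h"
    by (auto simp: eventually_at_top_linorder)
  define Z where "Z = max Y 1"
  have "continuous_on {0..Z} (\<lambda>y. f (\<i> * of_real y))"
    by (rule continuous_on_compose2[OF holomorphic_on_imp_continuous_on[OF f]]) (auto intro!: continuous_intros)
  then have "bounded ((\<lambda>y. f (\<i> * of_real y)) ` {0..Z})"
    using compact_continuous_image compact_imp_bounded by blast
  then obtain B where B: "\<And>y. 0 \<le> y \<Longrightarrow> y \<le> Z \<Longrightarrow> norm (f (\<i> * of_real y)) \<le> B"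
    unfolding bounded_iff by fastforce
  have Z: "Z \<ge> 1" "Z \<ge> Y" by (auto simp: Z_def)
  have B0: "B \<ge> 0" using order_trans[OF norm_ge_zero B[of 0]] Z by simp
  have "norm (f (\<i> * of_real y)) \<le> (1 + B * exp (\<bar>h\<bar> * Z)) * exp (h * y)" if y: "y \<ge> 0" for y
  proof (cases "y \<le> Z")
    case True
    have "(- h) * y \<le> \<bar>h\<bar> * y" using y by (intro mult_right_mono) auto
    then have "- (h * y) \<le> \<bar>h\<bar> * y" by simp
    also have "\<dots> \<le> \<bar>h\<bar> * Z" using True by (intro mult_left_mono) auto
    finally have "1 \<le> exp (\<bar>h\<bar> * Z) * exp (h * y)" by (simp flip: exp_add)
    then have "B * 1 \<le> B * (exp (\<bar>h\<bar> * Z) * exp (h * y))" using B0 by (rule mult_left_mono)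
    moreover have "norm (f (\<i> * of_real y)) \<le> B" using B y True by blast
    ultimately show ?thesis using exp_ge_zero[of "h * y"]
      by (simp only: distrib_right mult.assoc mult_1 mult_1_right)
  next
    case False
    then have "norm (f (\<i> * of_real y)) \<le> exp (h * y)"
      using Z by (intro ln_norm_less_imp Y) auto
    moreover have "0 \<le> B * exp (\<bar>h\<bar> * Z) * exp (h * y)" using B0 by simp
    ultimately show ?thesis by (simp only: distrib_right mult_1)
  qed
  then show ?thesis unfolding upper_type_def by blast
qed

lemma upper_big_of_d_fun:
  assumes "ereal h < d_fun f" shows "upper_big f h"
proof (rule ccontr)
  assume "\<not> upper_big f h"
  then obtain Y where Y: "\<And>y. y \<ge> Y \<Longrightarrow> norm (f (\<i> * of_real y)) < exp (h * y)"
    unfolding upper_big_def by (meson not_le)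
  have "\<forall>\<^sub>F y in at_top. ln_norm (f (\<i> * of_real y)) / ereal y \<le> ereal h"
    using eventually_ge_at_top[of "max Y 1"] by eventually_elim (intro ln_norm_le Y, auto)
  then have "d_fun f \<le> ereal h" unfolding d_fun_alt by (rule Limsup_bounded)
  then show False using assms by simp
qed

lemma d_fun_le_of_upper_type:
  assumes "upper_type f h" shows "d_fun f \<le> ereal h"
proof (rule ccontr)
  assume "\<not> d_fun f \<le> ereal h"
  then obtain h' where h': "ereal h < ereal h'" "ereal h' < d_fun f"
    using ereal_dense2[of "ereal h" "d_fun f"] by (auto simp only: not_le)
  obtain A where A: "A \<ge> 0" "\<And>y. y \<ge> 0 \<Longrightarrow> norm (f (\<i> * of_real y)) \<le> A * exp (h * y)"
    using upper_typeE[OF assms] by metis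
  define d where "d = h' - h"
  have d: "d > 0" using h'(1) by (simp add: d_def)
  obtain y where y: "y \<ge> A / d" "exp (h' * y) \<le> norm (f (\<i> * of_real y))"
    using upper_big_of_d_fun[OF h'(2)] unfolding upper_big_def by blast
  have y0: "y \<ge> 0" using y(1) A(1) d by (meson divide_nonneg_pos order_trans)
  have "exp (d * y) * exp (h * y) = exp (h' * y)" by (simp add: d_def algebra_simps flip: exp_add)
  then have "exp (d * y) * exp (h * y) \<le> A * exp (h * y)" using y(2) A(2)[OF y0] by simp
  then have "exp (d * y) \<le> A" by simp
  moreover have "A \<le> d * y" using y(1) d by (simp add: divide_le_eq mult.commute)
  moreover have "1 + d * y \<le> exp (d * y)" by (rule exp_ge_add_one_self)
  ultimately show False by linarith
qed

context weight_seqs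
begin

lemma upper_type_entire_le:
  assumes f: "entire_le k M f" and e: "e > 0"
  shows "upper_type f (c k + e)"
proof -
  obtain C where C: "C \<ge> 0" "\<And>x. x \<ge> 0 \<Longrightarrow> w x \<le> C + e * x" using w_small[OF e] by blast
  have "norm (f (\<i> * of_real y)) \<le> M * exp C * exp ((c k + e) * y)" if y: "y \<ge> 0" for y
  proof -
    have "r k * w y \<le> 1 * w y" using r_less[of k] w_nonneg[OF y] by (intro mult_right_mono) auto
    then have "r k * w y + c k * y \<le> C + (c k + e) * y" using C(2)[OF y] by (simp add: distrib_right)
    then have "W k (\<i> * of_real y) \<le> exp C * exp ((c k + e) * y)"
      using y by (simp add: W_def norm_mult flip: exp_add)
    then have "M * W k (\<i> * of_real y) \<le> M * (exp C * exp ((c k + e) * y))"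
      using entire_le_nonneg[OF f] by (rule mult_left_mono)
    then show ?thesis using entire_leD(2)[OF f, of "\<i> * of_real y"] by simp
  qed
  then show ?thesis by (auto simp: upper_type_def)
qed

lemma d_fun_le_c:
  assumes f: "entire_le k M f" shows "d_fun f \<le> ereal (c k)"
proof (rule ereal_le_epsilon2)
  fix e :: real assume "0 < e"
  from d_fun_le_of_upper_type[OF upper_type_entire_le[OF f this]]
  show "d_fun f \<le> ereal (c k) + ereal e" by simp
qed

text \<open>An indicator equal to minus infinity would make the type smaller than every
  \<open>h\<close>, so that \<open>eq_zero_of_fast_decay\<close> forces the zero function; plus
  infinity is excluded by the weight.\<close>

lemma d_fun_real:
  assumes f: "entire_le k M f" and u: "f u \<noteq> 0"
  obtains h where "d_fun f = ereal h" "\<And>e. e > 0 \<Longrightarrow> upper_type f (h + e)" "\<And>e. e > 0 \<Longrightarrow> upper_big f (h - e)"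
proof -
  have "d_fun f \<noteq> \<infinity>" using d_fun_le_c[OF f] by auto
  moreover have "d_fun f \<noteq> -\<infinity>"
  proof
    assume "d_fun f = -\<infinity>"
    then have "upper_type f h" for h by (intro upper_type_of_d_fun[OF entire_leD(1)[OF f]]) simp
    then have "f u = 0" unfolding upper_type_def by (intro eq_zero_of_fast_decay[OF f]) blast
    then show False using u by simp
  qed
  ultimately obtain h where h: "d_fun f = ereal h" by (cases "d_fun f") auto
  show ?thesis
    by (rule that[OF h]) (auto intro!: upper_type_of_d_fun upper_big_of_d_fun simp: h entire_leD(1)[OF f])
qed

lemma d_fun_real_sign:
  assumes f: "f \<in> P" "f \<noteq> (\<lambda>_. 0)" and s: "s = 1 \<or> s = -1"
  obtains h where "d_fun (\<lambda>z. f (s * z)) = ereal h"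
    "\<And>e. e > 0 \<Longrightarrow> upper_type (\<lambda>z. f (s * z)) (h + e)" "\<And>e. e > 0 \<Longrightarrow> upper_big (\<lambda>z. f (s * z)) (h - e)"
proof -
  obtain k M where kM: "entire_le k M f" using f(1) P_iff by blast
  obtain u where "f u \<noteq> 0" using f(2) by blast
  moreover have "s * (s * u) = u" using s by auto
  ultimately have "f (s * (s * u)) \<noteq> 0" by (simp only: not_False_eq_True)
  from d_fun_real[OF entire_le_reflect[OF kM s] this] that show ?thesis by metis
qed

end

section \<open>From the indicator segment to weak localisability\<close>

context submodule_setting
begin

text \<open>For \<open>s = 1\<close> this is the right end of the indicator segment, for
  \<open>s = -1\<close> minus the left end; both ends become suprema and are treated alike.\<close>

definition type_sup :: "complex \<Rightarrow> ereal" where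
  "type_sup s = (SUP f\<in>J - {\<lambda>_. 0}. d_fun (\<lambda>z. f (s * z)))"

lemma type_sup_1: "type_sup 1 = d_sub J"
  by (simp add: type_sup_def d_sub_def)

lemma type_sup_minus_1: "type_sup (-1) = - c_sub J"
  by (simp only: type_sup_def c_sub_def d_fun_reflect ereal_SUP_uminus_eq)

lemma less_type_sup:
  assumes "ereal x < type_sup s" and s: "s = 1 \<or> s = -1"
  obtains f h k where "f \<in> J" "x < h" "h \<le> c k"
    "\<And>e. e > 0 \<Longrightarrow> upper_type (\<lambda>z. f (s * z)) (h + e)" "\<And>e. e > 0 \<Longrightarrow> upper_big (\<lambda>z. f (s * z)) (h - e)"
proof -
  obtain f where f: "f \<in> J" "f \<noteq> (\<lambda>_. 0)" "ereal x < d_fun (\<lambda>z. f (s * z))"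
    using assms(1) unfolding type_sup_def less_SUP_iff by blast
  have fP: "f \<in> P" using f(1) J_sub_P by blast
  obtain k M where "entire_le k M f" using fP P_iff by blast
  from d_fun_le_c[OF entire_le_reflect[OF this s]] have c: "d_fun (\<lambda>z. f (s * z)) \<le> ereal (c k)" .
  obtain h where h: "d_fun (\<lambda>z. f (s * z)) = ereal h"
    "\<And>e. e > 0 \<Longrightarrow> upper_type (\<lambda>z. f (s * z)) (h + e)" "\<And>e. e > 0 \<Longrightarrow> upper_big (\<lambda>z. f (s * z)) (h - e)"
    using d_fun_real_sign[OF fP f(2) s] by metis
  show ?thesis using f(3) c h(1) by (intro that[OF f(1) _ _ h(2,3)]) auto
qed

lemma type_sup_gt_minus_infinity:
  assumes s: "s = 1 \<or> s = -1" shows "-\<infinity> < type_sup s"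
proof -
  obtain f u where f: "f \<in> J" "f u \<noteq> 0" by (rule J_nonzero)
  have fne: "f \<noteq> (\<lambda>_. 0)" using f(2) by auto
  have fP: "f \<in> P" using f(1) J_sub_P by blast
  obtain h where "d_fun (\<lambda>z. f (s * z)) = ereal h" by (rule d_fun_real_sign[OF fP fne s])
  then have "-\<infinity> < d_fun (\<lambda>z. f (s * z))" by simp
  also have "\<dots> \<le> type_sup s" unfolding type_sup_def by (rule SUP_upper) (use f(1) fne in simp)
  finally show ?thesis .
qed

lemma interior_typeI:
  assumes "ereal h < type_sup s" "s = 1 \<or> s = -1" "upper_type (\<lambda>z. g (s * z)) \<eta>" "\<eta> < h"
  shows "interior_type s g"
proof -
  obtain f h' where f: "f \<in> J" "h < h'"
    "\<And>e. e > 0 \<Longrightarrow> upper_type (\<lambda>z. f (s * z)) (h' + e)" "\<And>e. e > 0 \<Longrightarrow> upper_big (\<lambda>z. f (s * z)) (h' - e)"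
    using less_type_sup[OF assms(1,2)] by metis
  have "\<exists>f\<in>J. \<exists>h'\<ge>h. upper_type (\<lambda>z. f (s * z)) (h' + e) \<and> upper_big (\<lambda>z. f (s * z)) (h' - e)" if "e > 0" for e
    using f(3,4)[OF that] f(1) less_imp_le[OF f(2)] by auto
  then show ?thesis unfolding interior_type_def using assms(3,4) by blast
qed

lemma boundary_typeI:
  assumes g: "g \<in> P" "g \<noteq> (\<lambda>_. 0)" and le: "d_fun (\<lambda>z. g (s * z)) \<le> type_sup s" and s: "s = 1 \<or> s = -1"
  shows "boundary_type s g"
  unfolding boundary_type_def
proof (intro allI impI)
  fix e :: real assume e: "e > 0"
  obtain h0 where h0: "d_fun (\<lambda>z. g (s * z)) = ereal h0"
    "\<And>e. e > 0 \<Longrightarrow> upper_type (\<lambda>z. g (s * z)) (h0 + e)"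
    using d_fun_real_sign[OF g s] by metis
  have "ereal (h0 - e / 2) < ereal h0" using e by simp
  also have "\<dots> \<le> type_sup s" using le h0(1) by simp
  finally have "ereal (h0 - e / 2) < type_sup s" .
  then obtain f h where f: "f \<in> J" "h0 - e / 2 < h"
    "\<And>e. e > 0 \<Longrightarrow> upper_type (\<lambda>z. f (s * z)) (h + e)" "\<And>e. e > 0 \<Longrightarrow> upper_big (\<lambda>z. f (s * z)) (h - e)"
    using less_type_sup[OF _ s] by metis
  have gt: "upper_type (\<lambda>z. g (s * z)) (h + e)"
    by (rule upper_type_mono[OF h0(2)[of "e / 2"]]) (use e f(2) in auto)
  then show "\<exists>f\<in>J. \<exists>h. upper_type (\<lambda>z. f (s * z)) (h + e) \<and> upper_big (\<lambda>z. f (s * z)) (h - e) \<and> upper_type (\<lambda>z. g (s * z)) (h + e)"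
    by (intro bexI[of _ f] exI[of _ h] conjI gt f(1) f(3,4)[OF e])
qed

text \<open>The transform has type at most \<open>R < \<rho>\<close> in both directions, so a
  segment of length \<open>2 * \<rho>\<close> contains its indicator segment and fits, after
  centring, strictly between \<open>c'\<close> and \<open>d\<close>.\<close>

lemma exists_interior_function:
  assumes inc: "\<not> exp_complete (zero_set J) \<rho>"
    and d: "ereal d < type_sup 1" and c: "ereal (- c') < type_sup (-1)" and gap: "2 * \<rho> < d - c'"
  obtains p u where "admissible p" "p u \<noteq> 0" "interior_type 1 p" "interior_type (-1) p"
proof -
  obtain f u R A N where f: "f holomorphic_on UNIV" "f u \<noteq> 0" "0 \<le> R" "R < \<rho>" "0 \<le> A"
    "\<And>z. norm (f z) \<le> A * (1 + norm z) ^ N * exp (R * \<bar>Im z\<bar>)"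
    "\<And>\<mu> n. enat n \<le> zero_set J \<mu> \<Longrightarrow> \<exists>q. q holomorphic_on UNIV \<and> (\<forall>z. f z = (z - \<mu>) ^ n * q z)"
    using incomplete_imp_entire_function[OF inc] by metis
  obtain h1 k1 where k1: "d < h1" "h1 \<le> c k1" by (rule less_type_sup[OF d]) auto
  obtain h2 k2 where k2: "- c' < h2" "h2 \<le> c k2" by (rule less_type_sup[OF c]) auto
  \<comment> \<open>Types occurring in \<open>J\<close> are bounded by some \<open>c k\<close>,
    hence so are the levels \<open>d\<close> and \<open>- c'\<close> below them; the shifted
    function therefore fits into the step \<open>k\<close>.\<close>
  define k where "k = max k1 k2"
  have "c k1 \<le> c k" "c k2 \<le> c k" by (auto simp: k_def intro!: incseqD[OF c_inc])
  then have ck: "d \<le> c k" "- c' \<le> c k" using k1 k2 by linarith+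
  \<comment> \<open>The midpoint of the target segment; the factor \<open>E\<close> moves the
    segment of \<open>f\<close>, which is centred at \<open>0\<close>, to be centred at
    \<open>m\<close>.\<close>
  define m where "m = (c' + d) / 2"
  define E where "E = (\<lambda>z::complex. exp (- \<i> * of_real m * z))"
  define p where "p = (\<lambda>z. f z * E z)"
  have m: "\<rho> + m < d" "\<rho> - m < - c'" using gap by (auto simp: m_def field_simps)
  then have mR: "\<bar>m\<bar> + R \<le> c k" using ck f(4) by linarith
  have E: "E holomorphic_on UNIV" unfolding E_def by (intro holomorphic_intros)
  have nE: "norm (E z) = exp (m * Im z)" for z by (simp add: E_def)
  have hol: "p holomorphic_on UNIV" unfolding p_def by (intro holomorphic_intros f(1) E)
  \<comment> \<open>The \<open>N\<close> factors \<open>1 + norm z\<close> together cost at most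
    \<open>r k * w (norm z)\<close>; adding \<open>1\<close> avoids division by zero for
    \<open>N = 0\<close>.\<close>
  define e where "e = r k / (of_nat N + 1)"
  have e: "e > 0" using r_pos[of k] by (simp add: e_def)
  obtain C where C: "C \<ge> 0" "\<And>x. x \<ge> 0 \<Longrightarrow> 1 + x \<le> C * exp (e * w x)" using linear_le_exp_w[OF e] by blast
  have Ne: "of_nat N * e \<le> r k" using r_pos[of k] by (simp add: e_def field_simps)
  have "norm (p z) \<le> (A * C ^ N) * W k z" for z
  proof -
    have "(1 + norm z) ^ N \<le> (C * exp (e * w (norm z))) ^ N" by (intro power_mono C) auto
    also have "\<dots> = C ^ N * exp (of_nat N * e * w (norm z))"
      by (simp add: power_mult_distrib mult.assoc flip: exp_of_nat_mult)
    also have "\<dots> \<le> C ^ N * exp (r k * w (norm z))"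
      using Ne w_nonneg[of "norm z"] C(1) by (intro mult_left_mono) (auto intro: mult_right_mono)
    finally have 1: "(1 + norm z) ^ N \<le> C ^ N * exp (r k * w (norm z))" .
    have "m * Im z \<le> \<bar>m\<bar> * \<bar>Im z\<bar>" by (metis abs_ge_self abs_mult)
    then have "R * \<bar>Im z\<bar> + m * Im z \<le> (\<bar>m\<bar> + R) * \<bar>Im z\<bar>" by (simp add: distrib_right)
    also have "\<dots> \<le> c k * \<bar>Im z\<bar>" by (rule mult_right_mono[OF mR]) simp
    finally have 2: "exp (R * \<bar>Im z\<bar> + m * Im z) \<le> exp (c k * \<bar>Im z\<bar>)" by simp
    have "norm (p z) \<le> (A * (1 + norm z) ^ N * exp (R * \<bar>Im z\<bar>)) * exp (m * Im z)"
      unfolding p_def norm_mult nE by (intro mult_right_mono f(6)) simp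
    also have "\<dots> = A * ((1 + norm z) ^ N * exp (R * \<bar>Im z\<bar> + m * Im z))" by (simp add: exp_add)
    also have "\<dots> \<le> A * ((C ^ N * exp (r k * w (norm z))) * exp (c k * \<bar>Im z\<bar>))"
      using 1 2 f(5) C(1) by (intro mult_left_mono mult_mono) auto
    also have "\<dots> = (A * C ^ N) * W k z" by (simp add: W_def exp_add)
    finally show ?thesis .
  qed
  then have "entire_le k (A * C ^ N) p" using hol by (simp add: entire_le_def)
  then have pP: "p \<in> P" using P_iff by blast
  have adm: "admissible p" unfolding admissible_def
  proof (intro conjI allI pP)
    fix \<mu>
    obtain n where n: "zero_set J \<mu> = enat n" using zero_set_attained by metis
    then obtain q where q: "q holomorphic_on UNIV" "\<And>z. f z = (z - \<mu>) ^ n * q z" using f(7)[of n \<mu>] by auto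
    have "\<exists>q. q holomorphic_on UNIV \<and> (\<forall>z. p z = (z - \<mu>) ^ n * q z)"
      by (intro exI[of _ "\<lambda>z. q z * E z"]) (auto intro!: holomorphic_intros q(1) E simp: p_def q(2))
    then show "zero_set J \<mu> \<le> vanishing_mult p \<mu>" unfolding n vanishing_mult_ge_iff[OF hol] .
  qed
  have up: "upper_type (\<lambda>z. p (of_real s * z)) (\<rho> + s * m)" if s: "s = 1 \<or> s = -1" for s :: real
  proof -
    \<comment> \<open>On the imaginary axis the same polynomial factor is paid for by the slack
      \<open>\<rho> - R\<close>.\<close>
    define t where "t = (\<rho> - R) / (of_nat N + 1)"
    have t: "t > 0" using f(4) by (simp add: t_def)
    have Nt: "of_nat N * t \<le> \<rho> - R" using f(4) by (simp add: t_def field_simps)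
    have "norm (p (of_real s * (\<i> * of_real y))) \<le> (A * (1 + 1 / t) ^ N) * exp ((\<rho> + s * m) * y)" if y: "y \<ge> 0" for y
    proof -
      have ty: "1 \<le> exp (t * y)" "t * y \<le> exp (t * y)"
        using t y exp_ge_add_one_self[of "t * y"] mult_nonneg_nonneg[of t y] by linarith+
      then have "y \<le> exp (t * y) / t" using t by (simp add: le_divide_eq mult.commute)
      moreover have "(1 + 1 / t) * exp (t * y) = exp (t * y) + exp (t * y) / t" by (simp add: distrib_right)
      ultimately have "1 + y \<le> (1 + 1 / t) * exp (t * y)" using ty(1) by linarith
      then have "(1 + y) ^ N \<le> ((1 + 1 / t) * exp (t * y)) ^ N" using y by (intro power_mono) auto
      also have "\<dots> = (1 + 1 / t) ^ N * exp (of_nat N * t * y)"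
        by (simp add: power_mult_distrib mult.assoc flip: exp_of_nat_mult)
      also have "\<dots> \<le> (1 + 1 / t) ^ N * exp ((\<rho> - R) * y)"
        using Nt y t by (intro mult_left_mono) (auto intro: mult_right_mono)
      finally have 1: "(1 + y) ^ N \<le> (1 + 1 / t) ^ N * exp ((\<rho> - R) * y)" .
      have z: "norm (of_real s * (\<i> * of_real y)) = y" "Im (of_real s * (\<i> * of_real y)) = s * y"
        "\<bar>s * y\<bar> = y" using s y by (auto simp: norm_mult)
      have "norm (p (of_real s * (\<i> * of_real y))) \<le> (A * (1 + y) ^ N * exp (R * y)) * exp (m * (s * y))"
        unfolding p_def norm_mult[of "f _"] nE z(2)
        by (intro mult_right_mono order_trans[OF f(6)]) (simp_all only: z order_refl exp_ge_zero)
      also have "\<dots> \<le> (A * ((1 + 1 / t) ^ N * exp ((\<rho> - R) * y)) * exp (R * y)) * exp (m * (s * y))"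
        by (intro mult_right_mono mult_left_mono 1 f(5)) auto
      also have "\<dots> = (A * (1 + 1 / t) ^ N) * exp ((\<rho> - R) * y + R * y + m * (s * y))"
        by (simp add: exp_add)
      also have "(\<rho> - R) * y + R * y + m * (s * y) = (\<rho> + s * m) * y" by (simp add: algebra_simps)
      finally show ?thesis .
    qed
    then show ?thesis by (auto simp: upper_type_def)
  qed
  have "interior_type 1 p" by (rule interior_typeI[OF d _ _ m(1)]) (use up[of 1] in auto)
  moreover have "interior_type (-1) p" by (rule interior_typeI[OF c _ _ m(2)]) (use up[of "-1"] in auto)
  moreover have "p u \<noteq> 0" using f(2) by (simp add: p_def E_def)
  ultimately show ?thesis by (intro that[OF adm])
qed

text \<open>The gap serves to produce the one function \<open>p\<close>. A larger submodule with the
  same zero set and segment consists of admissible functions that are zero or of boundary type in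
  both directions, and those lie in \<open>J\<close>.\<close>

theorem weakly_localisable_if_gap:
  assumes gap: "2 * completeness_radius (zero_set J) < d_sub J - c_sub J"
  shows "weakly_localisable w r c J"
proof -
  have dm: "-\<infinity> < d_sub J" using type_sup_gt_minus_infinity[of 1] by (simp add: type_sup_1)
  have cp: "c_sub J < \<infinity>" using type_sup_gt_minus_infinity[of "-1"] by (simp add: type_sup_minus_1 ereal_less_uminus_reorder)
  \<comment> \<open>A real number between the two sides allows infinite ends of the segment to be
    replaced by real levels \<open>d\<close> and \<open>c'\<close> at distance at least
    \<open>x\<close>.\<close>
  obtain x where x: "2 * completeness_radius (zero_set J) < ereal x" "ereal x < d_sub J - c_sub J"
    using ereal_dense2[OF gap] by blast
  have "completeness_radius (zero_set J) < ereal (x / 2)"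
    using x(1) by (cases "completeness_radius (zero_set J)") auto
  then obtain \<rho> where \<rho>: "\<not> exp_complete (zero_set J) \<rho>" "\<rho> < x / 2"
    unfolding completeness_radius_def INF_less_iff by auto
  have "\<exists>d c'. ereal d < d_sub J \<and> c_sub J < ereal c' \<and> x \<le> d - c'"
  proof (cases "d_sub J")
    case PInf
    obtain c' where "c_sub J < ereal c'" using ereal_dense2[OF cp] by blast
    then show ?thesis using PInf by (intro exI[of _ "c' + x"] exI[of _ c']) auto
  next
    case (real d)
    show ?thesis
    proof (cases "c_sub J")
      case (real c')
      define t where "t = (d - c' - x) / 2"
      have "t > 0" using x(2) real \<open>d_sub J = ereal d\<close> by (simp add: t_def)
      then show ?thesis using real \<open>d_sub J = ereal d\<close>
        by (intro exI[of _ "d - t"] exI[of _ "c' + t"]) (auto simp: t_def field_simps)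
    next
      case MInf
      then show ?thesis using real by (intro exI[of _ "d - 1"] exI[of _ "d - 1 - x"]) auto
    qed (use cp in simp)
  qed (use dm in simp)
  then obtain d c' where dc: "ereal d < d_sub J" "c_sub J < ereal c'" "x \<le> d - c'" by blast
  have "ereal (- c') < type_sup (-1)" using dc(2) by (simp add: type_sup_minus_1 ereal_less_uminus_reorder)
  moreover have "2 * \<rho> < d - c'" using \<rho>(2) dc(3) by simp
  ultimately obtain p u where p: "admissible p" "p u \<noteq> 0" "interior_type 1 p" "interior_type (-1) p"
    using exists_interior_function[OF \<rho>(1)] dc(1) type_sup_1 by metis
  have "J' = J" if J': "closed_submodule w r c J'" "zero_set J' = zero_set J" "c_sub J' = c_sub J"
    "d_sub J' = d_sub J" "J \<subseteq> J'" for J'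
  proof (rule antisym[OF subsetI J'(5)])
    fix g assume g: "g \<in> J'"
    show "g \<in> J"
    proof (cases "g = (\<lambda>_. 0)")
      case True
      then show ?thesis using complex_subspaceD(1)[OF J_subspace] by simp
    next
      case False
      have "closedin (P_top w r c) J'" using J'(1) by (simp add: closed_submodule_def)
      then have gP: "g \<in> P" using closedin_subset g topspace_P_top by blast
      have "zero_set J \<mu> \<le> vanishing_mult g \<mu>" for \<mu>
        unfolding J'(2)[symmetric] zero_set_def by (rule INF_lower[OF g])
      then have adm: "admissible g" using gP by (simp add: admissible_def)
      have "d_fun (\<lambda>z. g (1 * z)) \<le> type_sup 1"
        unfolding type_sup_1 J'(4)[symmetric] unfolding d_sub_def using g False by (auto intro: SUP_upper)
      moreover have "c_sub J' \<le> c_fun g" unfolding c_sub_def using g False by (auto intro: INF_lower)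
      then have "d_fun (\<lambda>z. g (-1 * z)) \<le> type_sup (-1)"
        unfolding type_sup_minus_1 d_fun_reflect J'(3) by simp
      ultimately show ?thesis
        by (intro boundary_type_in_J[OF adm _ _ p] boundary_typeI[OF gP False]) auto
    qed
  qed
  then show ?thesis unfolding weakly_localisable_def using closed_J nontrivial_J by blast
qed

end

theorem theorem3p2:
  fixes w :: "real \<Rightarrow> real" and a :: ereal and r c :: "nat \<Rightarrow> real"
    and J :: "(complex \<Rightarrow> complex) set"
  assumes "weight w"
    and "0 < a"
    and "incseq c" and "\<And>k. 0 < c k" and "\<And>k. ereal (c k) < a"
    and "(\<lambda>k. ereal (c k)) \<longlonglongrightarrow> a"
    and "incseq r" and "\<And>k. 0 < r k" and "\<And>k. r k < 1" and "r \<longlonglongrightarrow> 1"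
    and "closed_submodule w r c J"
    and "stable_submodule J"
    and "d_sub J - c_sub J > 2 * ereal pi * BM_density (zero_set J)"
  shows "J \<noteq> {\<lambda>_. 0} \<and> weakly_localisable w r c J"
proof -
  \<comment> \<open>For the zero submodule the supremum and infimum range over the empty set, so
    \<open>d_sub J - c_sub J\<close> is minus infinity and cannot exceed anything.\<close>
  have ne: "J \<noteq> {\<lambda>_. 0}"
  proof
    assume J: "J = {\<lambda>_. 0}"
    have "d_sub J - c_sub J = -\<infinity>" unfolding J d_sub_def c_sub_def by (simp add: bot_ereal_def top_ereal_def)
    then show False using assms(13) by simp
  qed
  interpret submodule_setting w a r c J
    by unfold_locales (use assms ne in auto)
  have "2 * ereal pi * BM_density (zero_set J) = 2 * completeness_radius (zero_set J)"
    unfolding BM_density_def by (cases "completeness_radius (zero_set J)") auto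
  then have "2 * completeness_radius (zero_set J) < d_sub J - c_sub J" using assms(13) by simp
  from weakly_localisable_if_gap[OF this] ne show ?thesis by blast
qed

end
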